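(* Let $n\ge1$, $\mathbb{V}=\mathbb{R}^{n+1,1}$, $\mathfrak{g}=\mathfrak{so}(n+1,1)$, $P=\mathrm{Sim}^0(n)$ the stabiliser of a null ray spanning the null line $\mathbb{K}$, $\mathfrak{p}=\mathfrak{sim}(n)$ its Lie algebra and $P_0=\mathrm{CO}^0(n)=\mathbb{R}^+\times \mathrm{SO}(n)$ its Levi part. The $P$-module $\mathbb{G}:=\mathbb{V}^*\otimes(\mathfrak{g}/\mathfrak{p})$ admits a filtration of $P$-modules $$\mathbb{G}^0\subset\mathbb{G}^{-1}\subset\mathbb{G}^{-2}=\mathbb{G},\qquad \mathbb{G}^i:=(\mathbb{V}^* )^{i+1}\otimes(\mathfrak{g}/\mathfrak{p}),\quad i=0,-1,-2.$$ The associated graded vector space $\mathrm{gr}(\mathbb{G})=\mathrm{gr}_0(\mathbb{G})\oplus\mathrm{gr}_{-1}(\mathbb{G})\oplus\mathrm{gr}_{-2}(\mathbb{G})$, where $\mathrm{gr}_i(\mathbb{G}):=\mathbb{G}^i/\mathbb{G}^{i+1}$ (with $\mathbb{G}^1:=0$), decomposes as a direct sum $$\mathrm{gr}_0(\mathbb{G})=\mathrm{gr}_0^0(\mathbb{G})=\mathbb{G}^0,\quad \mathrm{gr}_{-1}(\mathbb{G})=\mathrm{gr}_{-1}^0(\mathbb{G})\oplus\mathrm{gr}_{-1}^1(\mathbb{G})\oplus\mathrm{gr}_{-1}^2(\mathbb{G}),\quad \mathrm{gr}_{-2}(\mathbb{G})=\mathrm{gr}_{-2}^0(\mathbb{G})$$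 of $P$-modules $\mathrm{gr}_i^j(\mathbb{G})$ which are isomorphic, as $P_0$-modules, to the following modules $\mathbb{G}_i^j$: - $\mathbb{G}_{-2}^0\cong(\mathbb{R}^n)^*(2)$, of dimension $n$; - $\mathbb{G}_{-1}^0\cong\mathbb{R}(1)$, of dimension $1$; - $\mathbb{G}_{-1}^1\cong\bigwedge^2(\mathbb{R}^n)^*(1)$, of dimension $\frac12n(n-1)$; - $\mathbb{G}_{-1}^2\cong\odot^2_\circ(\mathbb{R}^n)^*(1)$, of dimension $\frac12n(n+1)-1$; - $\mathbb{G}_0^0\cong(\mathbb{R}^n)^*$, of dimension $n$. These modules are all irreducible (those that are non-zero), except in the case $n=4$, where $\mathbb{G}_{-1}^1$ splits further into two irreducibles $\mathbb{G}_{-1}^{1,+}\cong\bigwedge^{2,+}(\mathbb{R}^4)^*(1)$ and $\mathbb{G}_{-1}^{1,-}\cong\bigwedge^{2,-}(\mathbb{R}^4)^*(1)$, each of dimension $3$.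
   Context: $\mathbb{V}=\mathbb{R}^{n+1,1}$ has a basis $(e_0,e_1,\dots,e_n,e_{n+1})$ with $\langle e_0,e_{n+1}\rangle=1$, $\langle e_i,e_j\rangle=\delta_{ij}$ for $1\le i,j\le n$, all other products zero; $\mathbb{K}=\mathrm{span}(e_{n+1})$. In this basis $$P=\mathrm{Sim}^0(n)=\left\{(a,A,\xi)=\begin{pmatrix}a&0&0\\-aA\xi^\top&A&0\\-\frac a2\xi\xi^\top&\xi&a^{-1}\end{pmatrix}: a\in\mathbb{R}^+,\ A\in \mathrm{SO}(n),\ \xi\in(\mathbb{R}^n)^*\right\},$$ and $P_0=\{(a,A,0)\}$. $P$ acts on $\mathfrak{g}/\mathfrak{p}$ by the adjoint action and on $\mathbb{V}^*$ by the dual action. The filtration of $\mathbb{V}^*$ is $(\mathbb{V}^* )^{2}=0\subset(\mathbb{V}^* )^1=\mathrm{Ann}(\mathbb{K}^\perp)\subset(\mathbb{V}^* )^0=\mathrm{Ann}(\mathbb{K})\subset(\mathbb{V}^* )^{-1}=\mathbb{V}^*$. For $w\in\mathbb{R}$, $\mathbb{R}(w)$ is the one-dimensional representation $(a,A,\xi)\cdot r=a^wr$. Here $(\mathbb{R}^n)^*$ is the dual standard representation of $\mathrm{SO}(n)$ with $\mathbb{R}^+$ acting trivially, and $\mathbb{A}(w):=\mathbb{A}\otimes\mathbb{R}(w)$. $\odot^2_\circ$ denotes trace-free symmetric tensors, $\bigwedge^{2,\pm}$ the self-dual and anti-self-dual $2$-forms. *)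

theory Defs
  imports "HOL-Analysis.Analysis" "HOL-Library.Poly_Mapping"
begin

section \<open>Linear representations of matrix groups\<close>

text \<open>
  A representation is an action \<open>\<rho>\<close> of square matrices by linear maps of an ambient real vector
  space, considered on a subspace \<open>U\<close>; only the behaviour of \<open>\<rho>\<close> on the group \<open>G\<close> matters.
\<close>

definition is_module ::
    "(real^'m^'m) set \<Rightarrow> (real^'m^'m \<Rightarrow> 'a \<Rightarrow> 'a::real_vector) \<Rightarrow> 'a set \<Rightarrow> bool" where
  "is_module G \<rho> U \<longleftrightarrow> subspace U \<and>
     (\<forall>g\<in>G. linear (\<rho> g) \<and> \<rho> g ` U \<subseteq> U) \<and>
     (\<forall>x\<in>U. \<rho> (mat 1) x = x) \<and>
     (\<forall>g\<in>G. \<forall>h\<in>G. \<forall>x\<in>U. \<rho> (g ** h) x = \<rho> g (\<rho> h x))"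

definition is_module_iso ::
    "(real^'m^'m) set \<Rightarrow> (real^'m^'m \<Rightarrow> 'a \<Rightarrow> 'a::real_vector) \<Rightarrow> 'a set
      \<Rightarrow> (real^'m^'m \<Rightarrow> 'b \<Rightarrow> 'b::real_vector) \<Rightarrow> 'b set \<Rightarrow> ('a \<Rightarrow> 'b) \<Rightarrow> bool" where
  "is_module_iso G \<rho> U \<sigma> W f \<longleftrightarrow> is_module G \<rho> U \<and> is_module G \<sigma> W \<and> bij_betw f U W \<and>
     (\<forall>x\<in>U. \<forall>y\<in>U. f (x + y) = f x + f y) \<and>
     (\<forall>c. \<forall>x\<in>U. f (c *\<^sub>R x) = c *\<^sub>R f x) \<and>
     (\<forall>g\<in>G. \<forall>x\<in>U. f (\<rho> g x) = \<sigma> g (f x))"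

definition isomorphic_modules ::
    "(real^'m^'m) set \<Rightarrow> (real^'m^'m \<Rightarrow> 'a \<Rightarrow> 'a::real_vector) \<Rightarrow> 'a set
      \<Rightarrow> (real^'m^'m \<Rightarrow> 'b \<Rightarrow> 'b::real_vector) \<Rightarrow> 'b set \<Rightarrow> bool" where
  "isomorphic_modules G \<rho> U \<sigma> W \<longleftrightarrow> (\<exists>f. is_module_iso G \<rho> U \<sigma> W f)"

definition irreducible_module ::
    "(real^'m^'m) set \<Rightarrow> (real^'m^'m \<Rightarrow> 'a \<Rightarrow> 'a::real_vector) \<Rightarrow> 'a set \<Rightarrow> bool" where
  "irreducible_module G \<rho> U \<longleftrightarrow> is_module G \<rho> U \<and> U \<noteq> {0} \<and>
     (\<forall>W\<subseteq>U. is_module G \<rho> W \<longrightarrow> W = {0} \<or> W = U)"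

definition internal_direct_sum :: "'a::real_vector set \<Rightarrow> ('i \<Rightarrow> 'a set) \<Rightarrow> 'i set \<Rightarrow> bool" where
  "internal_direct_sum U S I \<longleftrightarrow> subspace U \<and> (\<forall>i\<in>I. subspace (S i) \<and> S i \<subseteq> U) \<and>
     (\<forall>x\<in>U. \<exists>!f. f \<in> (\<Pi>\<^sub>E i\<in>I. S i) \<and> x = (\<Sum>i\<in>I. f i))"

definition dual_act :: "real^'m^'m \<Rightarrow> ((real^'m) \<Rightarrow>\<^sub>L real) \<Rightarrow> ((real^'m) \<Rightarrow>\<^sub>L real)" where
  "dual_act g \<phi> = \<phi> o\<^sub>L Blinfun (\<lambda>v. matrix_inv g *v v)"

definition annihilator :: "'a::real_normed_vector set \<Rightarrow> ('a \<Rightarrow>\<^sub>L real) set" where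
  "annihilator U = {\<phi>. \<forall>v\<in>U. blinfun_apply \<phi> v = 0}"

text \<open>The Lie algebra of a matrix group, as its tangent space at the identity.\<close>

definition lie_algebra_of :: "(real^'m^'m) set \<Rightarrow> (real^'m^'m) set" where
  "lie_algebra_of G =
     {X. \<exists>\<gamma>. (\<forall>t. \<gamma> t \<in> G) \<and> \<gamma> 0 = mat 1 \<and> (\<gamma> has_vector_derivative X) (at (0::real))}"


section \<open>Quotients and tensor products\<close>

definition subquotient_rel :: "'a::real_vector set \<Rightarrow> 'a set \<Rightarrow> 'a \<Rightarrow> 'a \<Rightarrow> bool" where
  "subquotient_rel U W x y \<longleftrightarrow> x \<in> U \<and> y \<in> U \<and> x - y \<in> W"

lemma part_equivp_subquotient:
  assumes "subspace U" "subspace W"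
  shows "part_equivp (subquotient_rel U W)"
proof (rule part_equivpI)
  show "\<exists>x. subquotient_rel U W x x"
    using assms by (auto simp: subquotient_rel_def subspace_0 intro!: exI[of _ 0])
  show "symp (subquotient_rel U W)"
    unfolding symp_def subquotient_rel_def using subspace_neg[OF assms(2)] by fastforce
  show "transp (subquotient_rel U W)"
    unfolding transp_def subquotient_rel_def using subspace_add[OF assms(2)] by fastforce
qed

lemma equivp_subquotient:
  assumes "subspace W"
  shows "equivp (subquotient_rel UNIV W)"
  using part_equivp_subquotient[OF subspace_UNIV assms]
  by (intro equivpI) (auto simp: reflp_def subquotient_rel_def subspace_0[OF assms]
      elim: part_equivpE)

lemma subquotient_rel_add:
  assumes "subspace U" "subspace W" "subquotient_rel U W x x'" "subquotient_rel U W y y'"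
  shows "subquotient_rel U W (x + y) (x' + y')"
  using assms subspace_add[OF assms(2), of "x - x'" "y - y'"]
  by (auto simp: subquotient_rel_def subspace_add algebra_simps)

lemma subquotient_rel_scale:
  assumes "subspace U" "subspace W" "subquotient_rel U W x x'"
  shows "subquotient_rel U W (c *\<^sub>R x) (c *\<^sub>R x')"
  using assms subspace_scale[OF assms(2), of "x - x'" c]
  by (auto simp: subquotient_rel_def subspace_scale algebra_simps)

lemma subquotient_rel_neg:
  assumes "subspace U" "subspace W" "subquotient_rel U W x x'"
  shows "subquotient_rel U W (- x) (- x')"
  using subquotient_rel_scale[OF assms, of "-1"] by simp

lemma subquotient_rel_refl:
  assumes "subspace W" "x \<in> U"
  shows "subquotient_rel U W x x"
  using assms by (simp add: subquotient_rel_def subspace_0)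

instantiation poly_mapping :: (type, real_vector) real_vector
begin

lift_definition scaleR_poly_mapping :: "real \<Rightarrow> ('a \<Rightarrow>\<^sub>0 'b) \<Rightarrow> ('a \<Rightarrow>\<^sub>0 'b)"
  is "\<lambda>c f k. c *\<^sub>R f k"
  by (rule finite_subset) auto

instance
  by standard (transfer; simp add: algebra_simps)+

end

text \<open>
  The tensor product over the reals: the free vector space on pairs, modulo the span of the
  bilinearity relations.
\<close>

abbreviation free_pair :: "'a \<Rightarrow> 'b \<Rightarrow> ('a \<times> 'b) \<Rightarrow>\<^sub>0 real" where
  "free_pair x y \<equiv> Poly_Mapping.single (x, y) 1"

definition tensor_relations :: "(('a::real_vector \<times> 'b::real_vector) \<Rightarrow>\<^sub>0 real) set" where
  "tensor_relations = span (
     {free_pair (x + x') y - free_pair x y - free_pair x' y | x x' y. True} \<union>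
     {free_pair x (y + y') - free_pair x y - free_pair x y' | x y y'. True} \<union>
     {free_pair (c *\<^sub>R x) y - c *\<^sub>R free_pair x y | c x y. True} \<union>
     {free_pair x (c *\<^sub>R y) - c *\<^sub>R free_pair x y | c x y. True})"

lemma subspace_tensor_relations: "subspace tensor_relations"
  by (simp add: tensor_relations_def)

quotient_type (overloaded) ('a, 'b) tensor (infixr \<open>\<otimes>\<close> 75) =
  "('a::real_vector \<times> 'b::real_vector) \<Rightarrow>\<^sub>0 real" / "subquotient_rel UNIV tensor_relations"
  by (rule equivp_subquotient[OF subspace_tensor_relations])

instantiation tensor :: (real_vector, real_vector) real_vector
begin

lift_definition zero_tensor :: "'a \<otimes> 'b" is 0 .

lift_definition plus_tensor :: "'a \<otimes> 'b \<Rightarrow> 'a \<otimes> 'b \<Rightarrow> 'a \<otimes> 'b" is "(+)"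
  by (rule subquotient_rel_add[OF subspace_UNIV subspace_tensor_relations])

lift_definition uminus_tensor :: "'a \<otimes> 'b \<Rightarrow> 'a \<otimes> 'b" is "uminus"
  by (rule subquotient_rel_neg[OF subspace_UNIV subspace_tensor_relations])

definition minus_tensor :: "'a \<otimes> 'b \<Rightarrow> 'a \<otimes> 'b \<Rightarrow> 'a \<otimes> 'b" where
  "minus_tensor x y = x + - y"

lift_definition scaleR_tensor :: "real \<Rightarrow> 'a \<otimes> 'b \<Rightarrow> 'a \<otimes> 'b" is "scaleR"
  by (rule subquotient_rel_scale[OF subspace_UNIV subspace_tensor_relations])

instance
  by (standard; (simp add: minus_tensor_def)?;
      transfer; simp add: algebra_simps subquotient_rel_def subspace_0 subspace_tensor_relations)

end

definition tensor_pure :: "'a::real_vector \<Rightarrow> 'b::real_vector \<Rightarrow> 'a \<otimes> 'b" (infixr \<open>\<otimes>\<close> 75) where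
  "x \<otimes> y = abs_tensor (free_pair x y)"

text \<open>The linear map on the tensor product induced by \<open>b\<close>; meaningful only for bilinear \<open>b\<close>.\<close>

definition tensor_lift ::
    "('a::real_vector \<Rightarrow> 'b::real_vector \<Rightarrow> 'c::real_vector) \<Rightarrow> 'a \<otimes> 'b \<Rightarrow> 'c" where
  "tensor_lift b t = (\<Sum>p\<in>Poly_Mapping.keys (rep_tensor t).
      Poly_Mapping.lookup (rep_tensor t) p *\<^sub>R b (fst p) (snd p))"

definition tensor_map ::
    "('a::real_vector \<Rightarrow> 'c::real_vector) \<Rightarrow> ('b::real_vector \<Rightarrow> 'd::real_vector)
      \<Rightarrow> 'a \<otimes> 'b \<Rightarrow> 'c \<otimes> 'd" where
  "tensor_map f h = tensor_lift (\<lambda>x y. f x \<otimes> h y)"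

definition tensor_sub :: "'a::real_vector set \<Rightarrow> 'b::real_vector set \<Rightarrow> ('a \<otimes> 'b) set" where
  "tensor_sub U W = span {x \<otimes> y | x y. x \<in> U \<and> y \<in> W}"

lemma bilinear_tensor_pure: "bilinear (\<otimes>)"
proof -
  have rel: "abs_tensor u = abs_tensor v" if "u - v \<in> tensor_relations"
    for u v :: "('a \<times> 'b) \<Rightarrow>\<^sub>0 real"
    using that Quotient3_rel_abs[OF Quotient3_tensor, of u v] by (simp add: subquotient_rel_def)
  have add: "abs_tensor u + abs_tensor v = abs_tensor (u + v)" for u v :: "('a \<times> 'b) \<Rightarrow>\<^sub>0 real"
    by (rule plus_tensor.abs_eq)
  have scale: "c *\<^sub>R abs_tensor v = abs_tensor (c *\<^sub>R v)" for c and v :: "('a \<times> 'b) \<Rightarrow>\<^sub>0 real"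
    by (rule scaleR_tensor.abs_eq)
  have mem: "free_pair (x + x') y - (free_pair x y + free_pair x' y) \<in> tensor_relations"
      "free_pair x (y + y') - (free_pair x y + free_pair x y') \<in> tensor_relations"
      "free_pair (c *\<^sub>R x) y - c *\<^sub>R free_pair x y \<in> tensor_relations"
      "free_pair x (c *\<^sub>R y) - c *\<^sub>R free_pair x y \<in> tensor_relations"
    for x x' :: 'a and y y' :: 'b and c
    unfolding tensor_relations_def diff_diff_eq[symmetric] by (rule span_base, blast)+
  show ?thesis
    unfolding bilinear_def
    by (intro conjI allI linearI; unfold tensor_pure_def add scale; intro rel mem)
qed

lemma tensor_lift_aux:
  fixes b :: "'a::real_vector \<Rightarrow> 'b::real_vector \<Rightarrow> 'c::real_vector"
  assumes "bilinear b"
  shows "linear (tensor_lift b)" and "tensor_lift b (x \<otimes> y) = b x y"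
proof -
  define L where "L v = (\<Sum>p\<in>Poly_Mapping.keys v. Poly_Mapping.lookup v p *\<^sub>R b (fst p) (snd p))"
    for v :: "('a \<times> 'b) \<Rightarrow>\<^sub>0 real"
  have Lsup: "L v = (\<Sum>p\<in>S. Poly_Mapping.lookup v p *\<^sub>R b (fst p) (snd p))"
    if "finite S" "Poly_Mapping.keys v \<subseteq> S" for v S
    unfolding L_def using that by (intro sum.mono_neutral_left) (auto simp: in_keys_iff)
  have L_add: "L (u + v) = L u + L v" for u v
  proof -
    let ?S = "Poly_Mapping.keys u \<union> Poly_Mapping.keys v"
    have "Poly_Mapping.keys (u + v) \<subseteq> ?S" by (rule keys_add)
    then show ?thesis
      by (simp add: Lsup[of ?S] lookup_add scaleR_left_distrib sum.distrib)
  qed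
  have L_scale: "L (c *\<^sub>R v) = c *\<^sub>R L v" for c v
  proof -
    have "Poly_Mapping.keys (c *\<^sub>R v) \<subseteq> Poly_Mapping.keys v"
      by (auto simp: in_keys_iff scaleR_poly_mapping.rep_eq)
    then show ?thesis
      by (simp add: Lsup[of "Poly_Mapping.keys v"] scaleR_poly_mapping.rep_eq scaleR_sum_right)
  qed
  have linL: "linear L" by (rule linearI) (simp_all add: L_add L_scale)
  have L_single: "L (free_pair x y) = b x y" for x y
    by (simp add: L_def)
  have L_rel: "L v = 0" if "v \<in> tensor_relations" for v
    using that unfolding tensor_relations_def
  proof (induction rule: span_induct_alt)
    case base
    then show ?case using linear_0[OF linL] by simp
  next
    case (step c u v)
    have "L u = 0"
      using step(1) assms
      by (auto simp: linear_diff[OF linL] L_scale L_single bilinear_ladd bilinear_radd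
            bilinear_lmul bilinear_rmul)
    then show ?case using step by (simp add: L_add L_scale)
  qed
  have L_cong: "L u = L v" if "subquotient_rel UNIV tensor_relations u v" for u v
    using L_rel[of "u - v"] that by (simp add: subquotient_rel_def linear_diff[OF linL])
  have lift_abs: "tensor_lift b (abs_tensor u) = L u" for u
  proof -
    have "subquotient_rel UNIV tensor_relations (rep_tensor (abs_tensor u)) u"
      by (simp add: tensor.abs_eq_iff[symmetric] Quotient3_abs_rep[OF Quotient3_tensor])
    then show ?thesis using L_cong by (simp add: tensor_lift_def L_def)
  qed
  have ex: "\<exists>u. t = abs_tensor u" for t :: "'a \<otimes> 'b"
    by (metis Quotient3_abs_rep[OF Quotient3_tensor])
  show "linear (tensor_lift b)"
  proof (rule linearI)
    fix s t :: "'a \<otimes> 'b" and c :: real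
    obtain u v where [simp]: "s = abs_tensor u" "t = abs_tensor v" using ex by blast
    have "s + t = abs_tensor (u + v)"
      by (simp add: plus_tensor.abs_eq)
    then show "tensor_lift b (s + t) = tensor_lift b s + tensor_lift b t"
      by (simp add: lift_abs L_add)
    have "c *\<^sub>R s = abs_tensor (c *\<^sub>R u)"
      by (simp add: scaleR_tensor.abs_eq)
    then show "tensor_lift b (c *\<^sub>R s) = c *\<^sub>R tensor_lift b s"
      by (simp add: lift_abs L_scale)
  qed
  show "tensor_lift b (x \<otimes> y) = b x y"
    by (simp add: tensor_pure_def lift_abs L_single)
qed

lemmas linear_tensor_lift = tensor_lift_aux(1)
lemmas tensor_lift_pure = tensor_lift_aux(2)


section \<open>The Lorentzian vector space and its groups\<close>

text \<open>Indices of the basis \<open>e\<^sub>0, e\<^sub>1, \<dots>, e\<^sub>n, e\<^sub>n\<^sub>+\<^sub>1\<close>, where \<open>n = CARD('n)\<close>.\<close>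

datatype 'n idx = First | Mid 'n | Last

lemma UNIV_idx: "UNIV = {First, Last} \<union> Mid ` UNIV"
  by (auto, metis idx.exhaust rangeI)

instance idx :: (finite) finite
  by standard (simp add: UNIV_idx)

lemma sum_idx:
  fixes f :: "'n::finite idx \<Rightarrow> 'a::comm_monoid_add"
  shows "(\<Sum>k\<in>UNIV. f k) = f First + ((\<Sum>i\<in>UNIV. f (Mid i)) + f Last)"
proof -
  have "(\<Sum>k\<in>UNIV. f k) = sum f {First, Last} + sum f (range Mid)"
    unfolding UNIV_idx by (rule sum.union_disjoint) auto
  also have "sum f (range Mid) = (\<Sum>i\<in>UNIV. f (Mid i))"
    by (subst sum.reindex) (auto simp: inj_on_def)
  finally show ?thesis by (simp add: ac_simps)
qed

type_synonym 'n lorentz_space = "real^('n idx)"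

definition lorentz_form :: "'n::finite lorentz_space \<Rightarrow> 'n lorentz_space \<Rightarrow> real" where
  "lorentz_form x y = x $ First * y $ Last + x $ Last * y $ First
      + (\<Sum>i\<in>UNIV. x $ Mid i * y $ Mid i)"

definition null_line :: "'n::finite lorentz_space set" where
  "null_line = span {axis Last 1}"

definition null_line_perp :: "'n::finite lorentz_space set" where
  "null_line_perp = {x. \<forall>y\<in>null_line. lorentz_form x y = 0}"

definition so_lorentz :: "(real^('n::finite idx)^('n idx)) set" where
  "so_lorentz = {X. \<forall>x y. lorentz_form (X *v x) y + lorentz_form x (X *v y) = 0}"

text \<open>The matrix \<open>(a, A, \<xi>)\<close>; the row vector \<open>\<xi>\<close> is encoded as a vector.\<close>

definition sim_matrix :: "real \<Rightarrow> real^'n^'n \<Rightarrow> real^'n \<Rightarrow> real^('n::finite idx)^('n idx)" where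
  "sim_matrix a A \<xi> = (\<chi> r c.
     case r of
       First \<Rightarrow> (case c of First \<Rightarrow> a | Mid j \<Rightarrow> 0 | Last \<Rightarrow> 0)
     | Mid i \<Rightarrow> (case c of First \<Rightarrow> - a * (A *v \<xi>) $ i | Mid j \<Rightarrow> A $ i $ j | Last \<Rightarrow> 0)
     | Last \<Rightarrow> (case c of First \<Rightarrow> - (a / 2) * (\<xi> \<bullet> \<xi>) | Mid j \<Rightarrow> \<xi> $ j | Last \<Rightarrow> inverse a))"

definition Sim0 :: "(real^('n::finite idx)^('n idx)) set" where
  "Sim0 = {sim_matrix a A \<xi> | a A \<xi>. a > 0 \<and> rotation_matrix A}"

definition CO0 :: "(real^('n::finite idx)^('n idx)) set" where
  "CO0 = {sim_matrix a A 0 | a A. a > 0 \<and> rotation_matrix A}"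

definition scale_part :: "real^('n::finite idx)^('n idx) \<Rightarrow> real" where
  "scale_part g = g $ First $ First"

definition rot_part :: "real^('n::finite idx)^('n idx) \<Rightarrow> real^'n^'n" where
  "rot_part g = (\<chi> i j. g $ Mid i $ Mid j)"

lemma scale_part_sim_matrix [simp]: "scale_part (sim_matrix a A \<xi>) = a"
  by (simp add: scale_part_def sim_matrix_def)

lemma rot_part_sim_matrix [simp]: "rot_part (sim_matrix a A \<xi>) = A"
  by (simp add: rot_part_def sim_matrix_def vec_eq_iff)

lemma sim_matrix_one: "sim_matrix 1 (mat 1) 0 = mat 1"
  by (auto simp: sim_matrix_def mat_def vec_eq_iff split: idx.splits)

lemma sim_matrix_mult:
  assumes "a \<noteq> 0" "b \<noteq> 0" "orthogonal_matrix B"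
  shows "sim_matrix a A \<xi> ** sim_matrix b B \<eta> = sim_matrix (a * b) (A ** B) (\<xi> v* B + inverse a *\<^sub>R \<eta>)"
proof -
  have BB: "B *v (\<xi> v* B) = \<xi>"
    using assms(3)
    by (metis matrix_vector_mul_assoc matrix_vector_mul_lid orthogonal_matrix_def
        transpose_matrix_vector)
  have nB: "(\<xi> v* B) \<bullet> (\<xi> v* B) = \<xi> \<bullet> \<xi>"
    by (metis BB dot_lmul_matrix)
  have xB: "(\<xi> v* B) \<bullet> \<eta> = \<xi> \<bullet> (B *v \<eta>)"
    by (rule dot_lmul_matrix)
  have *: "(sim_matrix a A \<xi> ** sim_matrix b B \<eta>) $ r $ c
      = sim_matrix (a * b) (A ** B) (\<xi> v* B + inverse a *\<^sub>R \<eta>) $ r $ c" for r c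
  proof (cases r)
    case First
    then show ?thesis
      by (cases c) (simp_all add: sim_matrix_def matrix_matrix_mult_def sum_idx)
  next
    case (Mid i)
    define m where "m = (A ** B) *v (\<xi> v* B + inverse a *\<^sub>R \<eta>)"
    have m: "m $ i = (A *v \<xi>) $ i + inverse a * (A *v (B *v \<eta>)) $ i"
      by (simp add: m_def matrix_vector_mul_assoc[symmetric] matrix_vector_right_distrib BB
          matrix_vector_mult_scaleR)
    have e: "(\<Sum>k\<in>UNIV. A $ i $ k * (- (b * (B *v \<eta>) $ k))) = - (b * (A *v (B *v \<eta>)) $ i)"
      by (simp add: matrix_vector_mult_def[of A] sum_distrib_left sum_negf ac_simps)
    show ?thesis
    proof (cases c)
      case First
      have "(sim_matrix a A \<xi> ** sim_matrix b B \<eta>) $ r $ c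
          = - (a * (A *v \<xi>) $ i * b) + (\<Sum>k\<in>UNIV. A $ i $ k * (- (b * (B *v \<eta>) $ k)))"
        using Mid First by (simp add: sim_matrix_def matrix_matrix_mult_def sum_idx)
      also have "\<dots> = - (a * b) * m $ i"
        unfolding m e using assms by (simp add: field_simps)
      finally show ?thesis
        using Mid First by (simp add: sim_matrix_def m_def)
    qed (use Mid in \<open>simp_all add: sim_matrix_def matrix_matrix_mult_def sum_idx\<close>)
  next
    case Last
    have e: "(\<Sum>k\<in>UNIV. \<xi> $ k * (- (b * (B *v \<eta>) $ k))) = - (b * (\<xi> \<bullet> (B *v \<eta>)))"
      by (simp add: inner_vec_def sum_distrib_left sum_negf ac_simps)
    have f: "(\<xi> v* B + inverse a *\<^sub>R \<eta>) \<bullet> (\<xi> v* B + inverse a *\<^sub>R \<eta>)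
        = \<xi> \<bullet> \<xi> + 2 * inverse a * (\<xi> \<bullet> (B *v \<eta>)) + inverse a * inverse a * (\<eta> \<bullet> \<eta>)"
      unfolding inner_add_left inner_add_right inner_scaleR_left inner_scaleR_right nB
        inner_commute[of \<eta> "\<xi> v* B"] xB by (simp add: algebra_simps)
    show ?thesis
    proof (cases c)
      case First
      have "(sim_matrix a A \<xi> ** sim_matrix b B \<eta>) $ r $ c
          = - (a / 2 * (\<xi> \<bullet> \<xi>) * b) + ((\<Sum>k\<in>UNIV. \<xi> $ k * (- (b * (B *v \<eta>) $ k)))
            - inverse a * (b / 2 * (\<eta> \<bullet> \<eta>)))"
        using Last First by (simp add: sim_matrix_def matrix_matrix_mult_def sum_idx)
      also have "\<dots> = - (a * b / 2) * ((\<xi> v* B + inverse a *\<^sub>R \<eta>) \<bullet> (\<xi> v* B + inverse a *\<^sub>R \<eta>))"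
        unfolding e f using assms(1) by (simp add: field_simps)
      finally show ?thesis
        using Last First by (simp add: sim_matrix_def)
    next
      case (Mid j)
      then show ?thesis
        using Last by (simp add: sim_matrix_def matrix_matrix_mult_def sum_idx
            vector_matrix_mult_def mult.commute)
    qed (use Last in \<open>simp add: sim_matrix_def matrix_matrix_mult_def sum_idx\<close>)
  qed
  then show ?thesis by (simp add: vec_eq_iff)
qed

lemma Sim0_one: "mat 1 \<in> Sim0"
  unfolding Sim0_def mem_Collect_eq
  by (rule exI[of _ 1], rule exI[of _ "mat 1"], rule exI[of _ 0])
     (simp add: sim_matrix_one rotation_matrix_def orthogonal_matrix_id)

lemma Sim0_mult:
  assumes "g \<in> Sim0" "h \<in> Sim0"
  shows "g ** h \<in> Sim0"
proof -
  obtain a A \<xi> b B \<eta> where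
    *: "g = sim_matrix a A \<xi>" "h = sim_matrix b B \<eta>" "a > 0" "b > 0"
      "rotation_matrix A" "rotation_matrix B"
    using assms unfolding Sim0_def by blast
  have "rotation_matrix (A ** B)"
    using * by (simp add: rotation_matrix_def orthogonal_matrix_mul det_mul)
  moreover have "g ** h = sim_matrix (a * b) (A ** B) (\<xi> v* B + inverse a *\<^sub>R \<eta>)"
    using * by (simp add: sim_matrix_mult rotation_matrix_def)
  moreover have "a * b > 0" using * by simp
  ultimately show ?thesis unfolding Sim0_def by blast
qed

definition sim_algebra :: "(real^('n::finite idx)^('n idx)) set" where
  "sim_algebra = lie_algebra_of Sim0"

lemma subspace_so_lorentz: "subspace (so_lorentz :: (real^('n::finite idx)^('n idx)) set)"
proof -
  have add: "lorentz_form (x + x') y = lorentz_form x y + lorentz_form x' y"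
       "lorentz_form y (x + x') = lorentz_form y x + lorentz_form y x'"
       "lorentz_form (c *\<^sub>R x) y = c * lorentz_form x y"
       "lorentz_form y (c *\<^sub>R x) = c * lorentz_form y x" for x x' y :: "'n lorentz_space" and c
    by (simp_all add: lorentz_form_def algebra_simps sum.distrib sum_distrib_left)
  have zero: "lorentz_form 0 y = 0" "lorentz_form y 0 = 0" for y :: "'n lorentz_space"
    by (simp_all add: lorentz_form_def)
  show ?thesis
    unfolding subspace_def so_lorentz_def
  proof (intro conjI ballI allI; clarsimp)
    show "lorentz_form 0 y + lorentz_form x 0 = 0" for x y :: "'n lorentz_space"
      by (simp add: zero)
  next
    fix X Y :: "real^('n idx)^('n idx)" and x y
    assume "\<forall>x y. lorentz_form (X *v x) y + lorentz_form x (X *v y) = 0"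
      "\<forall>x y. lorentz_form (Y *v x) y + lorentz_form x (Y *v y) = 0"
    then have "lorentz_form (X *v x) y + lorentz_form x (X *v y) = 0"
      "lorentz_form (Y *v x) y + lorentz_form x (Y *v y) = 0" by blast+
    then show "lorentz_form ((X + Y) *v x) y + lorentz_form x ((X + Y) *v y) = 0"
      by (simp add: matrix_vector_mult_add_rdistrib add)
  next
    fix X :: "real^('n idx)^('n idx)" and c x y
    assume "\<forall>x y. lorentz_form (X *v x) y + lorentz_form x (X *v y) = 0"
    then have "c * (lorentz_form (X *v x) y + lorentz_form x (X *v y)) = 0" by simp
    then show "lorentz_form (c *\<^sub>R X *v x) y + lorentz_form x (c *\<^sub>R X *v y) = 0"
      by (simp add: scaleR_matrix_vector_assoc[symmetric] add distrib_left)
  qed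
qed

lemma bounded_bilinear_matrix_mult:
  "bounded_bilinear ((**) :: real^'m^'m \<Rightarrow> real^'m^'m \<Rightarrow> real^'m^'m)"
  unfolding bilinear_conv_bounded_bilinear[symmetric] bilinear_def linear_iff
  by (simp add: vec_eq_iff matrix_matrix_mult_def algebra_simps sum.distrib sum_distrib_left)

lemma subspace_lie_algebra_of:
  assumes one: "mat 1 \<in> G" and mult: "\<And>g h. g \<in> G \<Longrightarrow> h \<in> G \<Longrightarrow> g ** h \<in> G"
  shows "subspace (lie_algebra_of G)"
  unfolding subspace_def lie_algebra_of_def
proof (intro conjI ballI allI; clarsimp)
  show "\<exists>\<gamma>. (\<forall>t. \<gamma> t \<in> G) \<and> \<gamma> 0 = mat 1 \<and> (\<gamma> has_vector_derivative 0) (at (0::real))"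
    using one by (intro exI[of _ "\<lambda>_. mat 1"]) auto
next
  fix X Y \<gamma> \<delta>
  assume "\<forall>t. \<gamma> t \<in> G" "\<gamma> 0 = mat 1" "(\<gamma> has_vector_derivative X) (at (0::real))"
    "\<forall>t. \<delta> t \<in> G" "\<delta> 0 = mat 1" "(\<delta> has_vector_derivative Y) (at (0::real))"
  moreover from this have "((\<lambda>t. \<gamma> t ** \<delta> t) has_vector_derivative (\<gamma> 0 ** Y + X ** \<delta> 0)) (at 0)"
    by (intro bounded_bilinear.has_vector_derivative[OF bounded_bilinear_matrix_mult])
  ultimately show "\<exists>\<gamma>. (\<forall>t. \<gamma> t \<in> G) \<and> \<gamma> 0 = mat 1 \<and> (\<gamma> has_vector_derivative X + Y) (at (0::real))"
    using mult by (intro exI[of _ "\<lambda>t. \<gamma> t ** \<delta> t"]) (auto simp: add.commute)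
next
  fix c X \<gamma>
  assume a: "\<forall>t. \<gamma> t \<in> G" "\<gamma> 0 = mat 1" "(\<gamma> has_vector_derivative X) (at (0::real))"
  have "((\<lambda>t. c * t) has_real_derivative c) (at 0)"
    by (auto intro!: derivative_eq_intros)
  then have "((\<gamma> \<circ> (\<lambda>t. c * t)) has_vector_derivative c *\<^sub>R X) (at 0)"
    using a(3) by (intro vector_diff_chain_at) (auto simp: has_real_derivative_iff_has_vector_derivative)
  then show "\<exists>\<gamma>. (\<forall>t. \<gamma> t \<in> G) \<and> \<gamma> 0 = mat 1 \<and> (\<gamma> has_vector_derivative c *\<^sub>R X) (at (0::real))"
    using a by (intro exI[of _ "\<gamma> \<circ> (\<lambda>t. c * t)"]) auto
qed

lemma subspace_sim_algebra: "subspace sim_algebra"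
  unfolding sim_algebra_def by (rule subspace_lie_algebra_of) (auto intro: Sim0_one Sim0_mult)


section \<open>The module and its associated graded\<close>

quotient_type (overloaded) 'n so_mod_sim =
  "real^('n::finite idx)^('n idx)" / partial: "subquotient_rel so_lorentz sim_algebra"
  by (rule part_equivp_subquotient[OF subspace_so_lorentz subspace_sim_algebra])

instantiation so_mod_sim :: (finite) real_vector
begin

lift_definition zero_so_mod_sim :: "'a so_mod_sim" is 0
  by (simp add: subquotient_rel_refl subspace_sim_algebra subspace_so_lorentz subspace_0)

lift_definition plus_so_mod_sim :: "'a so_mod_sim \<Rightarrow> 'a so_mod_sim \<Rightarrow> 'a so_mod_sim" is "(+)"
  by (rule subquotient_rel_add[OF subspace_so_lorentz subspace_sim_algebra])

lift_definition uminus_so_mod_sim :: "'a so_mod_sim \<Rightarrow> 'a so_mod_sim" is "uminus"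
  by (rule subquotient_rel_neg[OF subspace_so_lorentz subspace_sim_algebra])

definition minus_so_mod_sim :: "'a so_mod_sim \<Rightarrow> 'a so_mod_sim \<Rightarrow> 'a so_mod_sim" where
  "minus_so_mod_sim x y = x + - y"

lift_definition scaleR_so_mod_sim :: "real \<Rightarrow> 'a so_mod_sim \<Rightarrow> 'a so_mod_sim" is "scaleR"
  by (rule subquotient_rel_scale[OF subspace_so_lorentz subspace_sim_algebra])

instance
  by (standard; (simp add: minus_so_mod_sim_def)?;
      transfer; simp add: algebra_simps subquotient_rel_def subspace_0 subspace_add subspace_scale
        subspace_so_lorentz subspace_sim_algebra)

end

text \<open>Independent of the chosen representative only for \<open>g \<in> Sim0\<close>; the same holds for \<open>gr_act\<close>.\<close>

definition adjoint_act ::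
    "real^('n::finite idx)^('n idx) \<Rightarrow> 'n so_mod_sim \<Rightarrow> 'n so_mod_sim" where
  "adjoint_act g x = abs_so_mod_sim (g ** rep_so_mod_sim x ** matrix_inv g)"

definition dual_filtration :: "int \<Rightarrow> ('n::finite lorentz_space \<Rightarrow>\<^sub>L real) set" where
  "dual_filtration j =
     (if j \<ge> 2 then {0}
      else if j = 1 then annihilator null_line_perp
      else if j = 0 then annihilator null_line
      else UNIV)"

type_synonym 'n GG = "('n lorentz_space \<Rightarrow>\<^sub>L real) \<otimes> 'n so_mod_sim"

definition GG_act :: "real^('n::finite idx)^('n idx) \<Rightarrow> 'n GG \<Rightarrow> 'n GG" where
  "GG_act g = tensor_map (dual_act g) (adjoint_act g)"

definition GG_filtration :: "int \<Rightarrow> 'n::finite GG set" where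
  "GG_filtration i = tensor_sub (dual_filtration (i + 1)) UNIV"

lemma subspace_GG_filtration: "subspace (GG_filtration i)"
  by (simp add: GG_filtration_def tensor_sub_def)

text \<open>
  The degree of a graded piece is passed as a numeral type: \<open>('n, k) gr\<close> is the quotient of
  \<open>GG_filtration (-k)\<close> by \<open>GG_filtration (-k+1)\<close>, so that the pieces of degrees 0, -1 and -2 are
  \<open>('n, 0) gr\<close>, \<open>('n, 1) gr\<close> and \<open>('n, 2) gr\<close>.  (The type \<open>0\<close> is infinite, so \<open>CARD(0) = 0\<close>.)
  As \<open>quotient_type\<close> does not admit the phantom parameter, the set of cosets is written out.
\<close>

abbreviation gr_numerator :: "'k itself \<Rightarrow> 'n::finite GG set" where
  "gr_numerator _ \<equiv> GG_filtration (- int CARD('k))"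

abbreviation gr_denominator :: "'k itself \<Rightarrow> 'n::finite GG set" where
  "gr_denominator _ \<equiv> GG_filtration (- int CARD('k) + 1)"

typedef (overloaded) ('n, 'k) gr =
  "{Collect (subquotient_rel (gr_numerator TYPE('k)) (gr_denominator TYPE('k)) x) | x :: 'n::finite GG.
      x \<in> gr_numerator TYPE('k)}"
  morphisms coset_of_gr gr_of_coset
  using subspace_0[OF subspace_GG_filtration] by blast

definition gr_proj :: "'n::finite GG \<Rightarrow> ('n, 'k) gr" where
  "gr_proj x = gr_of_coset
     (Collect (subquotient_rel (gr_numerator TYPE('k)) (gr_denominator TYPE('k)) x))"

definition gr_repr :: "('n::finite, 'k) gr \<Rightarrow> 'n GG" where
  "gr_repr u = (SOME x. x \<in> coset_of_gr u)"

lemma gr_repr: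
  fixes u :: "('n::finite, 'k) gr"
  shows gr_repr_mem: "gr_repr u \<in> gr_numerator TYPE('k)" and gr_proj_repr: "gr_proj (gr_repr u) = u"
proof -
  let ?R = "subquotient_rel (gr_numerator TYPE('k)) (gr_denominator TYPE('k)) :: 'n GG \<Rightarrow> _"
  obtain x where x: "x \<in> gr_numerator TYPE('k)" "coset_of_gr u = Collect (?R x)"
    using coset_of_gr[of u] by auto
  have "?R x x" by (rule subquotient_rel_refl[OF subspace_GG_filtration x(1)])
  then have "?R x (gr_repr u)"
    unfolding gr_repr_def x(2) by (metis mem_Collect_eq someI)
  moreover have "part_equivp ?R"
    by (rule part_equivp_subquotient[OF subspace_GG_filtration subspace_GG_filtration])
  ultimately have "?R x = ?R (gr_repr u)"
    unfolding part_equivp_def by blast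
  with x(2) show "gr_proj (gr_repr u) = u"
    unfolding gr_proj_def by (metis coset_of_gr_inverse)
  show "gr_repr u \<in> gr_numerator TYPE('k)"
    using \<open>?R x (gr_repr u)\<close> by (simp add: subquotient_rel_def)
qed

lemma gr_proj_eq_iff:
  fixes x y :: "'n::finite GG"
  assumes "x \<in> gr_numerator TYPE('k)" "y \<in> gr_numerator TYPE('k)"
  shows "(gr_proj x :: ('n, 'k) gr) = gr_proj y \<longleftrightarrow> x - y \<in> gr_denominator TYPE('k)"
proof -
  let ?R = "subquotient_rel (gr_numerator TYPE('k)) (gr_denominator TYPE('k)) :: 'n GG \<Rightarrow> _"
  have "?R x x" "?R y y"
    using assms by (simp_all add: subquotient_rel_refl subspace_GG_filtration)
  moreover have "part_equivp ?R"
    by (rule part_equivp_subquotient[OF subspace_GG_filtration subspace_GG_filtration])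
  ultimately have "?R x y \<longleftrightarrow> ?R x = ?R y"
    unfolding part_equivp_def by blast
  moreover have "(gr_proj x :: ('n, 'k) gr) = gr_proj y \<longleftrightarrow> Collect (?R x) = Collect (?R y)"
    unfolding gr_proj_def using assms by (intro gr_of_coset_inject) auto
  ultimately show ?thesis
    using assms by (auto simp: subquotient_rel_def)
qed

instantiation gr :: (finite, type) real_vector
begin

definition zero_gr :: "('a, 'b) gr" where
  "0 = gr_proj 0"

definition plus_gr :: "('a, 'b) gr \<Rightarrow> ('a, 'b) gr \<Rightarrow> ('a, 'b) gr" where
  "u + v = gr_proj (gr_repr u + gr_repr v)"

definition uminus_gr :: "('a, 'b) gr \<Rightarrow> ('a, 'b) gr" where
  "- u = gr_proj (- gr_repr u)"

definition minus_gr :: "('a, 'b) gr \<Rightarrow> ('a, 'b) gr \<Rightarrow> ('a, 'b) gr" where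
  "u - v = gr_proj (gr_repr u - gr_repr v)"

definition scaleR_gr :: "real \<Rightarrow> ('a, 'b) gr \<Rightarrow> ('a, 'b) gr" where
  "c *\<^sub>R u = gr_proj (c *\<^sub>R gr_repr u)"

lemma gr_repr_proj:
  assumes "x \<in> gr_numerator TYPE('b)"
  shows "gr_repr (gr_proj x :: ('a, 'b) gr) - x \<in> gr_denominator TYPE('b)"
  by (metis assms gr_proj_eq_iff gr_proj_repr gr_repr_mem)

lemma gr_proj_add:
  assumes "x \<in> gr_numerator TYPE('b)" "y \<in> gr_numerator TYPE('b)"
  shows "gr_proj x + gr_proj y = (gr_proj (x + y) :: ('a, 'b) gr)"
  using subspace_add[OF subspace_GG_filtration gr_repr_proj[OF assms(1)] gr_repr_proj[OF assms(2)]]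
  by (simp add: plus_gr_def gr_proj_eq_iff gr_repr_mem assms subspace_add subspace_GG_filtration
      algebra_simps)

lemma gr_proj_scaleR:
  assumes "x \<in> gr_numerator TYPE('b)"
  shows "c *\<^sub>R gr_proj x = (gr_proj (c *\<^sub>R x) :: ('a, 'b) gr)"
  using subspace_scale[OF subspace_GG_filtration gr_repr_proj[OF assms], of c]
  by (simp add: scaleR_gr_def gr_proj_eq_iff gr_repr_mem assms subspace_scale subspace_GG_filtration
      algebra_simps)

instance
proof
  note closed = gr_repr_mem subspace_add[OF subspace_GG_filtration]
    subspace_scale[OF subspace_GG_filtration] subspace_neg[OF subspace_GG_filtration]
    subspace_0[OF subspace_GG_filtration]
  fix u v w :: "('a, 'b) gr" and c d :: real
  obtain x y z where u: "u = gr_proj x" "v = gr_proj y" "w = gr_proj z"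
    and m: "x \<in> gr_numerator TYPE('b)" "y \<in> gr_numerator TYPE('b)" "z \<in> gr_numerator TYPE('b)"
    by (metis gr_proj_repr gr_repr_mem)
  have neg: "- s = (-1) *\<^sub>R s" for s :: "('a, 'b) gr"
    by (simp add: uminus_gr_def scaleR_gr_def)
  have sub: "s - t = s + (-1) *\<^sub>R t" for s t :: "('a, 'b) gr"
    by (subst (2) gr_proj_repr[symmetric], subst (3) gr_proj_repr[symmetric])
       (simp add: gr_proj_scaleR gr_proj_add closed minus_gr_def)
  show "u + v + w = u + (v + w)" "u + v = v + u" "0 + u = u" "- u + u = 0" "u - v = u + - v"
    "c *\<^sub>R (u + v) = c *\<^sub>R u + c *\<^sub>R v" "(c + d) *\<^sub>R u = c *\<^sub>R u + d *\<^sub>R u"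
    "c *\<^sub>R d *\<^sub>R u = (c * d) *\<^sub>R u" "1 *\<^sub>R u = u"
    by (simp_all add: neg sub u zero_gr_def gr_proj_add gr_proj_scaleR m closed algebra_simps)
qed

end

definition gr_act :: "real^('n::finite idx)^('n idx) \<Rightarrow> ('n, 'k) gr \<Rightarrow> ('n, 'k) gr" where
  "gr_act g u = gr_proj (GG_act g (gr_repr u))"

type_synonym 'n assoc_gr = "('n, 0) gr \<times> ('n, 1) gr \<times> ('n, 2) gr"

definition assoc_gr_act :: "real^('n::finite idx)^('n idx) \<Rightarrow> 'n assoc_gr \<Rightarrow> 'n assoc_gr" where
  "assoc_gr_act g = map_prod (gr_act g) (map_prod (gr_act g) (gr_act g))"


section \<open>Representations of the Levi part\<close>

text \<open>
  \<open>weight_act w\<close> is the representation \<open>\<real>(w)\<close>, and \<open>twist w \<rho>\<close> is the tensor product of \<open>\<rho>\<close> with it.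
\<close>

definition weight_act :: "real \<Rightarrow> real^('n::finite idx)^('n idx) \<Rightarrow> real \<Rightarrow> real" where
  "weight_act w g r = scale_part g powr w * r"

definition twist ::
    "real \<Rightarrow> (real^('n idx)^('n idx) \<Rightarrow> 'a::real_vector \<Rightarrow> 'a)
      \<Rightarrow> real^('n::finite idx)^('n idx) \<Rightarrow> 'a \<otimes> real \<Rightarrow> 'a \<otimes> real" where
  "twist w \<rho> g = tensor_map (\<rho> g) (weight_act w g)"

type_synonym 'n covec = "(real^'n) \<Rightarrow>\<^sub>L real"

definition covec_act :: "real^('n::finite idx)^('n idx) \<Rightarrow> 'n covec \<Rightarrow> 'n covec" where
  "covec_act g = dual_act (rot_part g)"

definition covec2_act ::
    "real^('n::finite idx)^('n idx) \<Rightarrow> 'n covec \<otimes> 'n covec \<Rightarrow> 'n covec \<otimes> 'n covec" where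
  "covec2_act g = tensor_map (covec_act g) (covec_act g)"

definition transpose_tensor :: "'a::real_vector \<otimes> 'a \<Rightarrow> 'a \<otimes> 'a" where
  "transpose_tensor = tensor_lift (\<lambda>x y. y \<otimes> x)"

text \<open>
  Two-forms and symmetric tensors are the antisymmetric and symmetric elements of the tensor
  square; the trace is taken with respect to the standard Euclidean metric.
\<close>

definition two_forms :: "('n::finite covec \<otimes> 'n covec) set" where
  "two_forms = {t. transpose_tensor t = - t}"

definition tensor_trace :: "'n::finite covec \<otimes> 'n covec \<Rightarrow> real" where
  "tensor_trace = tensor_lift (\<lambda>\<phi> \<psi>. \<Sum>i\<in>UNIV. blinfun_apply \<phi> (axis i 1) * blinfun_apply \<psi> (axis i 1))"

definition sym_tracefree :: "('n::finite covec \<otimes> 'n covec) set" where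
  "sym_tracefree = {t. transpose_tensor t = t \<and> tensor_trace t = 0}"

definition tensor_eval :: "'n::finite covec \<otimes> 'n covec \<Rightarrow> real^'n \<Rightarrow> real^'n \<Rightarrow> real" where
  "tensor_eval t x y = tensor_lift (\<lambda>\<phi> \<psi>. blinfun_apply \<phi> x * blinfun_apply \<psi> y) t"

text \<open>
  For \<open>n = 4\<close>, the orientation is given by an enumeration \<open>b\<close> of the index type (a bijection from
  \<open>{..<4}\<close>): the ordered basis \<open>e\<^bsub>b 0\<^esub>, \<dots>, e\<^bsub>b 3\<^esub>\<close> is positive.  The Hodge star is
  \<open>(\<star>\<omega>)\<^sub>i\<^sub>j = 1/2 \<Sum>\<^sub>k\<^sub>l \<epsilon>\<^sub>i\<^sub>j\<^sub>k\<^sub>l \<omega>\<^sub>k\<^sub>l\<close>.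
\<close>

definition volume4 :: "(nat \<Rightarrow> 'n::finite) \<Rightarrow> real^'n \<Rightarrow> real^'n \<Rightarrow> real^'n \<Rightarrow> real^'n \<Rightarrow> real" where
  "volume4 b x0 x1 x2 x3 = det (\<chi> r. [x0, x1, x2, x3] ! inv_into {..<4} b r)"

definition hodge_star :: "(nat \<Rightarrow> 'n::finite) \<Rightarrow> 'n covec \<otimes> 'n covec \<Rightarrow> 'n covec \<otimes> 'n covec" where
  "hodge_star b t = (\<Sum>i\<in>UNIV. \<Sum>j\<in>UNIV.
     (1 / 2 * (\<Sum>k\<in>UNIV. \<Sum>l\<in>UNIV.
        volume4 b (axis i 1) (axis j 1) (axis k 1) (axis l 1) * tensor_eval t (axis k 1) (axis l 1)))
     *\<^sub>R (blinfun_inner_right (axis i 1) \<otimes> blinfun_inner_right (axis j 1)))"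

text \<open>Self-dual forms for \<open>s = 1\<close>, anti-self-dual forms for \<open>s = -1\<close>.\<close>

definition dual_two_forms :: "(nat \<Rightarrow> 'n::finite) \<Rightarrow> real \<Rightarrow> ('n covec \<otimes> 'n covec) set" where
  "dual_two_forms b s = {t \<in> two_forms. hodge_star b t = s *\<^sub>R t}"

end

theory Submission
  imports Defs
begin

text \<open>
  Choosing dual bases turns every module in sight into a space of vectors or matrices.  Sending
  \<open>X\<close> to \<open>X e\<^sub>n\<^sub>+\<^sub>1\<close> modulo the null line identifies the quotient of the Lie algebras with \<open>\<real>\<^sup>n\<close>, so
  the filtered module becomes the space of matrices with rows indexed by \<open>e\<^sub>0, \<dots>, e\<^sub>n\<^sub>+\<^sub>1\<close>.  The
  graded pieces are the last row, the middle block and the first row, on which \<open>(a, A, \<xi>)\<close> acts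
  by \<open>a\<^sup>2 A v\<close>, \<open>a A M A\<^sup>T\<close> and \<open>A v\<close>.

  Irreducibility then only needs a few explicit rotations.  Vectors are handled by transitivity
  on spheres.  For trace-free symmetric matrices an alternating sum over quarter turns in a
  coordinate plane isolates a nonzero trace-free \<open>2 \<times> 2\<close> block; for antisymmetric ones, products of
  half turns isolate a single pair of entries, except that in dimension four a pair of indices
  cannot be separated from its complement, which is where the Hodge star enters.
\<close>

section \<open>Transport of modules along equivariant embeddings\<close>

text \<open>The scale weights have one source: the inverse of \<open>(a, A, \<xi>)\<close>
  multiplies e_{n+1} by a. Hence the quotient of the Lie algebras carries weight 1, while the last,
  middle and first rows of the dual space carry weights 1, 0 and -1. The parameter \<xi> only adds
  to a row multiples of rows that vanish in the same graded piece, so it acts trivially on the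
  models; irreducibility can be tested over the Levi part and is inherited by the larger group. The
  exceptional dimension is a matter of signs. Products of half turns in coordinate planes are the
  diagonal sign matrices with an even number of minus signs, and such a matrix multiplies the entry
  at k, l by \<epsilon>_k \<epsilon>_l. Two distinct pairs define the same character exactly when
  their symmetric difference is the whole index set. It has two or four elements, and it is
  everything only for complementary pairs among four indices. Quotients and tensor products come
  with chosen representatives, so most properties of their actions are pulled back from matrices
  along injective equivariant maps.\<close>

lemma
  assumes "is_module G \<rho> U"
  shows is_module_subspace: "subspace U"
    and is_module_linear: "g \<in> G \<Longrightarrow> linear (\<rho> g)"
    and is_module_closed: "g \<in> G \<Longrightarrow> x \<in> U \<Longrightarrow> \<rho> g x \<in> U"
    and is_module_one: "x \<in> U \<Longrightarrow> \<rho> (mat 1) x = x"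
    and is_module_mult: "g \<in> G \<Longrightarrow> h \<in> G \<Longrightarrow> x \<in> U \<Longrightarrow> \<rho> (g ** h) x = \<rho> g (\<rho> h x)"
  using assms by (auto simp: is_module_def image_subset_iff)

lemma is_moduleI:
  assumes "subspace U" "\<And>g. g \<in> G \<Longrightarrow> linear (\<rho> g)" "\<And>g x. g \<in> G \<Longrightarrow> x \<in> U \<Longrightarrow> \<rho> g x \<in> U"
    "\<And>x. x \<in> U \<Longrightarrow> \<rho> (mat 1) x = x"
    "\<And>g h x. g \<in> G \<Longrightarrow> h \<in> G \<Longrightarrow> x \<in> U \<Longrightarrow> \<rho> (g ** h) x = \<rho> g (\<rho> h x)"
  shows "is_module G \<rho> U"
  using assms unfolding is_module_def image_subset_iff by (intro conjI ballI)

lemma is_module_mono: "is_module G \<rho> U \<Longrightarrow> H \<subseteq> G \<Longrightarrow> is_module H \<rho> U"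
  unfolding is_module_def subset_eq by simp

text \<open>A larger group has fewer invariant subspaces, so irreducibility over \<open>CO0\<close>
  passes to \<open>Sim0\<close> once the module structure is known there.\<close>

lemma irreducible_module_mono:
  assumes "irreducible_module H \<rho> U" "is_module G \<rho> U" "H \<subseteq> G"
  shows "irreducible_module G \<rho> U"
  unfolding irreducible_module_def
proof (intro conjI allI impI)
  show "is_module G \<rho> U" by fact
  show "U \<noteq> {0}" using assms(1) by (simp add: irreducible_module_def)
  fix W assume "W \<subseteq> U" "is_module G \<rho> W"
  then show "W = {0} \<or> W = U"
    using assms(1) is_module_mono[OF _ assms(3), of \<rho> W]
    by (auto simp: irreducible_module_def)
qed

text \<open>Only \<open>F\<close> is assumed linear. Linearity and multiplicativity of \<rho> are
  consequences, read off from a model \<sigma> through injectivity of \<open>F\<close>; this is how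
  actions defined by chosen representatives are handled.\<close>

locale equivariant_embedding =
  fixes G :: "(real^'m^'m) set"
    and \<rho> :: "real^'m^'m \<Rightarrow> 'a \<Rightarrow> 'a::real_vector"
    and \<sigma> :: "real^'m^'m \<Rightarrow> 'b \<Rightarrow> 'b::real_vector"
    and F :: "'a \<Rightarrow> 'b"
  assumes one_mem: "mat 1 \<in> G"
    and mult_mem: "g \<in> G \<Longrightarrow> h \<in> G \<Longrightarrow> g ** h \<in> G"
    and linear_F: "linear F"
    and inj_F: "inj F"
    and equivariant: "g \<in> G \<Longrightarrow> F (\<rho> g x) = \<sigma> g (F x)"
begin

lemma is_module_pullback:
  assumes M: "is_module G \<sigma> (F ` U)"
  shows "is_module G \<rho> U"
proof -
  have mem: "F x \<in> F ` U \<longleftrightarrow> x \<in> U" for x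
    using inj_F by (auto dest: injD)
  note sub = is_module_subspace[OF M] and lin = is_module_linear[OF M]
  show ?thesis
  proof (rule is_moduleI)
    show "subspace U"
      unfolding subspace_def mem[symmetric]
      by (simp add: linear_0[OF linear_F] linear_add[OF linear_F] linear_scale[OF linear_F]
          subspace_0[OF sub] subspace_add[OF sub] subspace_scale[OF sub])
    show "linear (\<rho> g)" if g: "g \<in> G" for g
    proof (rule linearI)
      show "\<rho> g (x + y) = \<rho> g x + \<rho> g y" for x y
        by (rule injD[OF inj_F])
           (simp add: equivariant g linear_add[OF linear_F] linear_add[OF lin[OF g]])
      show "\<rho> g (c *\<^sub>R x) = c *\<^sub>R \<rho> g x" for c x
        by (rule injD[OF inj_F])
           (simp add: equivariant g linear_scale[OF linear_F] linear_scale[OF lin[OF g]])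
    qed
    show "\<rho> g x \<in> U" if "g \<in> G" "x \<in> U" for g x
      using is_module_closed[OF M that(1), of "F x"] that by (simp add: mem flip: equivariant)
    show "\<rho> (mat 1) x = x" if "x \<in> U" for x
      by (rule injD[OF inj_F]) (simp add: equivariant one_mem is_module_one[OF M] that)
    show "\<rho> (g ** h) x = \<rho> g (\<rho> h x)" if "g \<in> G" "h \<in> G" "x \<in> U" for g h x
      by (rule injD[OF inj_F]) (simp add: equivariant that mult_mem is_module_mult[OF M])
  qed
qed

lemma is_module_image:
  assumes lin: "\<And>g. g \<in> G \<Longrightarrow> linear (\<sigma> g)" and M: "is_module G \<rho> U"
  shows "is_module G \<sigma> (F ` U)"
proof (rule is_moduleI[OF _ lin])
  show "subspace (F ` U)"
    by (rule linear_subspace_image[OF linear_F is_module_subspace[OF M]])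
qed (auto simp: is_module_closed[OF M] is_module_one[OF M] is_module_mult[OF M] one_mem mult_mem
    simp flip: equivariant)

lemma irreducible_module_pullback:
  assumes "irreducible_module G \<sigma> (F ` U)"
  shows "irreducible_module G \<rho> U"
proof -
  have M: "is_module G \<sigma> (F ` U)" and nz: "F ` U \<noteq> {0}"
    using assms by (simp_all add: irreducible_module_def)
  have irr: "W = {0} \<or> W = F ` U" if "W \<subseteq> F ` U" "is_module G \<sigma> W" for W
    using assms that unfolding irreducible_module_def by (elim conjE allE[of _ W]) iprover
  have zero: "F ` {0} = {0}"
    by (simp add: linear_0[OF linear_F])
  have sub: "W = {0} \<or> W = U" if W: "W \<subseteq> U" "is_module G \<rho> W" for W
  proof -
    have "is_module G \<sigma> (F ` W)"
      by (intro is_module_image W is_module_linear[OF M])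
    then have "F ` W = F ` {0} \<or> F ` W = F ` U"
      using irr[of "F ` W"] W(1) zero by auto
    then show ?thesis
      by (simp only: inj_image_eq_iff[OF inj_F])
  qed
  have nzU: "U \<noteq> {0}"
  proof
    assume "U = {0}"
    then have "F ` U = {0}" by (simp only: zero)
    then show False using nz by contradiction
  qed
  show ?thesis
    unfolding irreducible_module_def
    by (intro conjI allI impI is_module_pullback[OF M] nzU sub)
qed

end

text \<open>Both modules are compared with a third: the isomorphism is \<open>F\<close> followed by
  a partial inverse of \<open>F'\<close>. In the applications one side is a graded piece, the other
  a tensor or weight module, and the common image consists of vectors or matrices.\<close>

lemma isomorphic_modules_via:
  assumes F: "equivariant_embedding G \<rho> \<sigma> F" and F': "equivariant_embedding G \<rho>' \<sigma> F'"
    and eq: "F ` U = F' ` U'" and M: "is_module G \<sigma> (F ` U)"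
  shows "isomorphic_modules G \<rho> U \<rho>' U'"
proof -
  interpret F: equivariant_embedding G \<rho> \<sigma> F by (fact F)
  interpret F': equivariant_embedding G \<rho>' \<sigma> F' by (fact F')
  define f where "f x = inv F' (F x)" for x
  have F'f: "F' (f x) = F x" if "x \<in> U" for x
  proof -
    have "F x \<in> range F'" using that eq by blast
    then show ?thesis unfolding f_def by (rule f_inv_into_f)
  qed
  have f_eqI: "f x = y" if "x \<in> U" "F x = F' y" for x y
    using that unfolding f_def by (simp add: F'.inj_F)
  have MU: "is_module G \<rho> U" and MU': "is_module G \<rho>' U'"
    using F.is_module_pullback[OF M] F'.is_module_pullback M eq by auto
  note sub = is_module_subspace[OF MU] and inv = is_module_closed[OF MU]
  have bij: "bij_betw f U U'"
  proof (rule bij_betwI')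
    show "f x = f y \<longleftrightarrow> x = y" if "x \<in> U" "y \<in> U" for x y
      using F'f[OF that(1)] F'f[OF that(2)] injD[OF F.inj_F, of x y] by auto
    show "f x \<in> U'" if "x \<in> U" for x
    proof -
      have "F' (f x) \<in> F' ` U'" using that F'f eq by auto
      then show ?thesis by (simp add: inj_image_mem_iff[OF F'.inj_F])
    qed
    show "\<exists>x\<in>U. y = f x" if "y \<in> U'" for y
    proof -
      have "F' y \<in> F ` U" using that eq by auto
      then obtain x where "x \<in> U" "F x = F' y" by auto
      then show ?thesis using f_eqI[of x y] by blast
    qed
  qed
  have add: "f (x + y) = f x + f y" if "x \<in> U" "y \<in> U" for x y
    using that sub by (intro f_eqI)
      (auto simp: subspace_add linear_add[OF F.linear_F] linear_add[OF F'.linear_F] F'f)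
  have scale: "f (c *\<^sub>R x) = c *\<^sub>R f x" if "x \<in> U" for c x
    using that sub by (intro f_eqI)
      (auto simp: subspace_scale linear_scale[OF F.linear_F] linear_scale[OF F'.linear_F] F'f)
  have act: "f (\<rho> g x) = \<rho>' g (f x)" if "x \<in> U" "g \<in> G" for g x
    using that by (intro f_eqI) (auto simp: inv F.equivariant F'.equivariant F'f)
  show ?thesis
    unfolding isomorphic_modules_def is_module_iso_def
    by (intro exI[of _ f] conjI ballI allI MU MU' bij add scale act)
qed

section \<open>Direct sums and dimensions under linear bijections\<close>

text \<open>Unique decomposition is traded for existence together with independence, a form that
  travels along a bijection without extensional functions. Uniqueness follows because the difference
  of two decompositions decomposes 0.\<close>

lemma internal_direct_sum_iff:
  assumes "finite I"
  shows "internal_direct_sum U S I \<longleftrightarrow> subspace U \<and> (\<forall>i\<in>I. subspace (S i) \<and> S i \<subseteq> U) \<and>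
    (\<forall>x\<in>U. \<exists>f. (\<forall>i\<in>I. f i \<in> S i) \<and> x = sum f I) \<and>
    (\<forall>f. (\<forall>i\<in>I. f i \<in> S i) \<longrightarrow> sum f I = 0 \<longrightarrow> (\<forall>i\<in>I. f i = 0))"
    (is "?L \<longleftrightarrow> ?A \<and> ?B \<and> ?C \<and> ?D")
proof -
  have "(\<forall>x\<in>U. \<exists>!f. f \<in> (\<Pi>\<^sub>E i\<in>I. S i) \<and> x = sum f I) \<longleftrightarrow> ?C \<and> ?D" if "?A" "?B"
  proof (intro iffI conjI)
    assume ex1: "\<forall>x\<in>U. \<exists>!f. f \<in> (\<Pi>\<^sub>E i\<in>I. S i) \<and> x = sum f I"
    then show ?C by (metis PiE_E)
    show ?D
    proof (intro allI impI ballI)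
      fix f i assume f: "\<forall>i\<in>I. f i \<in> S i" "sum f I = 0" and i: "i \<in> I"
      \<comment> \<open>Members of the extensional product are \<open>undefined\<close> off
        \<open>I\<close>, so both decompositions of 0 are restricted before uniqueness
        applies.\<close>
      let ?r = "restrict f I" and ?z = "restrict (\<lambda>_. 0) I"
      have "?r \<in> (\<Pi>\<^sub>E i\<in>I. S i) \<and> 0 = sum ?r I" "?z \<in> (\<Pi>\<^sub>E i\<in>I. S i) \<and> 0 = sum ?z I"
        using f \<open>?B\<close> by (auto simp: subspace_0)
      moreover have "0 \<in> U" using \<open>?A\<close> by (rule subspace_0)
      ultimately have "?r = ?z" using ex1 by blast
      then show "f i = 0" using i by (metis restrict_apply')
    qed
  next
    assume CD: "?C \<and> ?D"
    show "\<forall>x\<in>U. \<exists>!f. f \<in> (\<Pi>\<^sub>E i\<in>I. S i) \<and> x = sum f I"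
    proof
      fix x assume "x \<in> U"
      then obtain f where f: "\<forall>i\<in>I. f i \<in> S i" "x = sum f I" using CD by blast
      show "\<exists>!f. f \<in> (\<Pi>\<^sub>E i\<in>I. S i) \<and> x = sum f I"
      proof (rule ex1I[of _ "restrict f I"])
        show "restrict f I \<in> (\<Pi>\<^sub>E i\<in>I. S i) \<and> x = sum (restrict f I) I"
          using f by auto
        fix h assume h: "h \<in> (\<Pi>\<^sub>E i\<in>I. S i) \<and> x = sum h I"
        have hP: "h \<in> (\<Pi>\<^sub>E i\<in>I. S i)" using h by (rule conjunct1)
        have mem: "\<forall>i\<in>I. h i - f i \<in> S i"
          using hP f(1) \<open>?B\<close> by (auto intro!: subspace_diff dest: PiE_mem)
        have "(\<Sum>i\<in>I. h i - f i) = 0"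
          by (simp only: sum_subtractf conjunct2[OF h, symmetric] f(2)[symmetric] diff_self)
        with mem have "\<forall>i\<in>I. h i - f i = 0"
          by (rule spec[OF conjunct2[OF CD], of "\<lambda>i. h i - f i", THEN mp, THEN mp])
        then show "h = restrict f I"
          using hP by (intro extensionalityI[where A = I]) (auto simp: PiE_def)
      qed
    qed
  qed
  then have "(?A \<and> ?B \<and> (\<forall>x\<in>U. \<exists>!f. f \<in> (\<Pi>\<^sub>E i\<in>I. S i) \<and> x = sum f I)) \<longleftrightarrow> ?A \<and> ?B \<and> ?C \<and> ?D"
    by (rule conj_cong[OF refl conj_cong[OF refl]])
  then show ?thesis
    by (simp only: internal_direct_sum_def)
qed

lemma linear_inv_of_bij:
  assumes "linear F" "bij F"
  shows "linear (inv F)"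
proof (rule linearI)
  have F: "F (inv F y) = y" for y
    using assms(2) by (simp add: bij_is_surj surj_f_inv_f)
  show "inv F (x + y) = inv F x + inv F y" for x y
    by (rule injD[OF bij_is_inj[OF assms(2)]]) (simp add: F linear_add[OF assms(1)])
  show "inv F (c *\<^sub>R x) = c *\<^sub>R inv F x" for c x
    by (rule injD[OF bij_is_inj[OF assms(2)]]) (simp add: F linear_scale[OF assms(1)])
qed

lemma internal_direct_sum_vimage:
  assumes "linear F" "bij F" "finite I" and ds: "internal_direct_sum V S I"
  shows "internal_direct_sum (F -` V) (\<lambda>i. F -` S i) I"
proof -
  note ds = ds[unfolded internal_direct_sum_iff[OF assms(3)]]
  have sV: "subspace V" and sS: "\<And>i. i \<in> I \<Longrightarrow> subspace (S i) \<and> S i \<subseteq> V"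
    using ds by simp_all
  have ex: "\<exists>f. (\<forall>i\<in>I. f i \<in> S i) \<and> x = sum f I" if "x \<in> V" for x
    using ds that by simp
  have un: "f i = 0" if "\<forall>i\<in>I. f i \<in> S i" "sum f I = 0" "i \<in> I" for f i
    using ds that by simp
  have FF: "F (inv F y) = y" for y
    using \<open>bij F\<close> by (simp add: bij_is_surj surj_f_inv_f)
  show ?thesis
    unfolding internal_direct_sum_iff[OF assms(3)]
  proof (intro conjI ballI allI impI)
    show "subspace (F -` V)"
      by (rule linear_subspace_vimage[OF assms(1) sV])
    show "subspace (F -` S i)" "F -` S i \<subseteq> F -` V" if "i \<in> I" for i
      using linear_subspace_vimage[OF assms(1)] sS[OF that] by auto
    show "\<exists>f. (\<forall>i\<in>I. f i \<in> F -` S i) \<and> x = sum f I" if "x \<in> F -` V" for x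
    proof -
      have "F x \<in> V" using that by simp
      from ex[OF this] obtain f where f: "\<forall>i\<in>I. f i \<in> S i" "F x = sum f I" by iprover
      have "F (\<Sum>i\<in>I. inv F (f i)) = F x"
        by (simp add: linear_sum[OF assms(1)] FF f)
      then have "x = (\<Sum>i\<in>I. inv F (f i))"
        using \<open>bij F\<close> by (metis bij_is_inj injD)
      then show ?thesis
        using f FF by (intro exI[of _ "\<lambda>i. inv F (f i)"]) auto
    qed
    show "f i = 0" if f: "\<forall>i\<in>I. f i \<in> F -` S i" "sum f I = 0" and i: "i \<in> I" for f i
    proof -
      have "(\<Sum>i\<in>I. F (f i)) = 0"
        using f by (metis linear_sum[OF assms(1)] linear_0[OF assms(1)])
      then have "F (f i) = F 0"
        using un[of "\<lambda>i. F (f i)" i] f i by (simp add: linear_0[OF assms(1)])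
      then show ?thesis
        using \<open>bij F\<close> by (metis bij_is_inj injD)
    qed
  qed
qed

text \<open>The source may be a tensor product, known only as a \<open>real_vector\<close> type; its
  dimension is computed in the Euclidean target.\<close>

lemma dim_vimage:
  fixes F :: "'a::real_vector \<Rightarrow> 'b::euclidean_space"
  assumes "linear F" "bij F"
  shows "dim (F -` V) = dim V"
proof -
  have "F -` V = inv F ` V"
    using assms(2) by (simp add: bij_vimage_eq_inv_image)
  moreover have "inj_on (inv F) (span V)"
    using assms(2) by (metis bij_imp_bij_inv bij_is_inj inj_on_subset subset_UNIV)
  ultimately show ?thesis
    using dim_image_eq[OF linear_inv_of_bij[OF assms]] by simp
qed

section \<open>Coordinates on tensor products\<close>

text \<open>Every representative is a finitely supported function, built by updating one fresh key
  at a time; in the quotient such an update adds a multiple of a pure tensor.\<close>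

lemma span_pure_tensors: "t \<in> span {x \<otimes> y | x y. True}"
proof -
  have ex: "\<exists>u. t = abs_tensor u"
    by (metis Quotient3_abs_rep[OF Quotient3_tensor])
  have add: "abs_tensor u + abs_tensor v = abs_tensor (u + v)" for u v :: "('a \<times> 'b) \<Rightarrow>\<^sub>0 real"
    by (rule plus_tensor.abs_eq)
  have scale: "c *\<^sub>R abs_tensor v = abs_tensor (c *\<^sub>R v)" for c and v :: "('a \<times> 'b) \<Rightarrow>\<^sub>0 real"
    by (rule scaleR_tensor.abs_eq)
  have "abs_tensor u \<in> span {x \<otimes> y | x y. True}" for u :: "('a \<times> 'b) \<Rightarrow>\<^sub>0 real"
  proof (induction u rule: update_induct)
    case const
    have "abs_tensor 0 = (0 :: 'a \<otimes> 'b)" by (simp add: zero_tensor.abs_eq)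
    then show ?case by (metis span_zero zero_poly_mapping_def)
  next
    case (update u p c)
    obtain x y where p: "p = (x, y)" by (cases p)
    have "Poly_Mapping.update p c u = u + c *\<^sub>R free_pair x y"
      using update(1) by (intro poly_mapping_eqI)
        (auto simp: p lookup_update lookup_add lookup_single scaleR_poly_mapping.rep_eq
            in_keys_iff when_def)
    then have "abs_tensor (Poly_Mapping.update p c u) = abs_tensor u + c *\<^sub>R (x \<otimes> y)"
      by (simp add: tensor_pure_def add scale)
    moreover have "x \<otimes> y \<in> span {x \<otimes> y | x y. True}"
      by (rule span_base) blast
    ultimately show ?case
      using update(3) by (simp add: span_add span_scale)
  qed
  then show ?thesis using ex by auto
qed

text \<open>The uniqueness half of the universal property, by which later identities between maps on
  tensor products are reduced to pure tensors.\<close>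

lemma tensor_linear_eqI:
  assumes "linear L" "linear L'" "\<And>x y. L (x \<otimes> y) = L' (x \<otimes> y)"
  shows "L t = L' t"
  by (rule linear_eq_on[OF assms(1,2) span_pure_tensors]) (use assms(3) in auto)

lemma bilinear_tensor_map:
  assumes "linear f" "linear h"
  shows "bilinear (\<lambda>x y. f x \<otimes> h y)"
  using bilinear_tensor_pure assms unfolding bilinear_def linear_iff by auto

lemma linear_tensor_map: "linear f \<Longrightarrow> linear h \<Longrightarrow> linear (tensor_map f h)"
  unfolding tensor_map_def by (intro linear_tensor_lift bilinear_tensor_map)

lemma tensor_map_pure: "linear f \<Longrightarrow> linear h \<Longrightarrow> tensor_map f h (x \<otimes> y) = f x \<otimes> h y"
  unfolding tensor_map_def by (intro tensor_lift_pure bilinear_tensor_map)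

lemma sum_delta2:
  fixes f :: "'p::finite \<Rightarrow> 'q::finite \<Rightarrow> 'c::comm_monoid_add"
  shows "(\<Sum>i\<in>UNIV. \<Sum>j\<in>UNIV. if i = k then if j = l then f i j else 0 else 0) = f k l"
proof -
  have "(\<Sum>j\<in>UNIV. if i = k then if j = l then f i j else 0 else 0) = (if i = k then f i l else 0)" for i
    by simp
  then show ?thesis by simp
qed

definition tensor_coords ::
    "('a::real_vector \<Rightarrow> real^'p) \<Rightarrow> ('b::real_vector \<Rightarrow> real^'q) \<Rightarrow> 'a \<otimes> 'b \<Rightarrow> real^'q^'p" where
  "tensor_coords f h = tensor_lift (\<lambda>x y. \<chi> i j. f x $ i * h y $ j)"

context
  fixes f :: "'a::real_vector \<Rightarrow> real^'p" and h :: "'b::real_vector \<Rightarrow> real^'q"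
  assumes lf: "linear f" and lh: "linear h"
begin

lemma bilinear_coords: "bilinear (\<lambda>x y. (\<chi> i j. f x $ i * h y $ j) :: real^'q^'p)"
  unfolding bilinear_def linear_iff vec_eq_iff
  by (simp add: linear_add[OF lf] linear_add[OF lh] linear_scale[OF lf] linear_scale[OF lh]
      algebra_simps)

lemma linear_tensor_coords: "linear (tensor_coords f h)"
  unfolding tensor_coords_def by (rule linear_tensor_lift[OF bilinear_coords])

lemma tensor_coords_pure: "tensor_coords f h (x \<otimes> y) = (\<chi> i j. f x $ i * h y $ j)"
  unfolding tensor_coords_def by (rule tensor_lift_pure[OF bilinear_coords])

context
  assumes bf: "bij f" and bh: "bij h"
begin

definition from_coords :: "real^'q^'p \<Rightarrow> 'a \<otimes> 'b" where
  "from_coords M = (\<Sum>i\<in>UNIV. \<Sum>j\<in>UNIV. M $ i $ j *\<^sub>R (inv f (axis i 1) \<otimes> inv h (axis j 1)))"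

lemma tensor_coords_from_coords: "tensor_coords f h (from_coords M) = M"
proof -
  have [simp]: "f (inv f x) = x" "h (inv h y) = y" for x y
    using bf bh by (simp_all add: bij_is_surj surj_f_inv_f)
  have *: "M $ i $ j * (axis i 1 $ k * axis j 1 $ l)
      = (if i = k then if j = l then M $ i $ j else 0 else 0)"
    for i j k l by (simp add: axis_def)
  show ?thesis
    by (simp add: from_coords_def linear_sum[OF linear_tensor_coords]
        linear_scale[OF linear_tensor_coords] tensor_coords_pure vec_eq_iff * sum_delta2)
qed

text \<open>This gives injectivity of the coordinate map, the delicate half of bijectivity, since
  vanishing in the quotient is hard to detect directly. On pure tensors, bilinearity expands both
  factors in the bases coming from \<open>inv f\<close> and \<open>inv h\<close>.\<close>

lemma from_coords_tensor_coords: "from_coords (tensor_coords f h t) = t"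
proof (rule tensor_linear_eqI[of "\<lambda>t. from_coords (tensor_coords f h t)" "\<lambda>t. t"])
  have "linear from_coords"
    by (auto simp: linear_iff from_coords_def scaleR_sum_right sum.distrib algebra_simps)
  then show "linear (\<lambda>t. from_coords (tensor_coords f h t))"
    using linear_compose[OF linear_tensor_coords] by (simp add: o_def)
  show "linear (\<lambda>t. t)" by (simp add: linear_iff)
  fix x y
  have lif: "linear (inv f)" "linear (inv h)"
    using lf lh bf bh by (auto intro: linear_inv_of_bij)
  have l: "linear (\<lambda>x. x \<otimes> y)" "linear (\<lambda>y. x \<otimes> y)" for x :: 'a and y :: 'b
    using bilinear_tensor_pure unfolding bilinear_def by blast+
  have expand: "v = (\<Sum>i\<in>UNIV. v $ i *\<^sub>R axis i 1)" for v :: "real^'k"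
    by (simp add: vec_eq_iff axis_def if_distrib cong: if_cong)
  have x: "x = (\<Sum>i\<in>UNIV. f x $ i *\<^sub>R inv f (axis i 1))"
    using arg_cong[OF expand[of "f x"], of "inv f"] bf
    by (simp add: linear_sum[OF lif(1)] linear_scale[OF lif(1)] bij_is_inj)
  have y: "y = (\<Sum>i\<in>UNIV. h y $ i *\<^sub>R inv h (axis i 1))"
    using arg_cong[OF expand[of "h y"], of "inv h"] bh
    by (simp add: linear_sum[OF lif(2)] linear_scale[OF lif(2)] bij_is_inj)
  have "x \<otimes> y = (\<Sum>i\<in>UNIV. f x $ i *\<^sub>R inv f (axis i 1)) \<otimes> (\<Sum>j\<in>UNIV. h y $ j *\<^sub>R inv h (axis j 1))"
    by (simp flip: x y)
  also have "\<dots> = (\<Sum>i\<in>UNIV. \<Sum>j\<in>UNIV. (f x $ i * h y $ j) *\<^sub>R (inv f (axis i 1) \<otimes> inv h (axis j 1)))"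
    unfolding linear_sum[OF l(1)] linear_scale[OF l(1)]
    unfolding linear_sum[OF l(2)] linear_scale[OF l(2)] scaleR_sum_right scaleR_scaleR ..
  finally have pure: "x \<otimes> y = \<dots>" .
  show "from_coords (tensor_coords f h (x \<otimes> y)) = x \<otimes> y"
    by (simp only: from_coords_def tensor_coords_pure vec_lambda_beta pure[symmetric])
qed

lemma bij_tensor_coords: "bij (tensor_coords f h)"
  by (rule bijI') (metis from_coords_tensor_coords, metis tensor_coords_from_coords)

text \<open>\<open>Z\<close> lists the coordinates required to vanish on the first factor. Each step
  of the filtration has this shape and so becomes the vanishing of certain rows.\<close>

lemma mem_tensor_sub_UNIV_iff:
  "t \<in> tensor_sub {x. \<forall>k\<in>Z. f x $ k = 0} UNIV \<longleftrightarrow> (\<forall>k\<in>Z. tensor_coords f h t $ k = 0)"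
proof
  assume "t \<in> tensor_sub {x. \<forall>k\<in>Z. f x $ k = 0} UNIV"
  then show "\<forall>k\<in>Z. tensor_coords f h t $ k = 0"
    unfolding tensor_sub_def
    by (induction rule: span_induct_alt)
       (auto simp: linear_0 linear_add linear_scale linear_tensor_coords tensor_coords_pure vec_eq_iff)
next
  assume Z: "\<forall>k\<in>Z. tensor_coords f h t $ k = 0"
  have [simp]: "f (inv f x) = x" for x
    using bf by (simp add: bij_is_surj surj_f_inv_f)
  \<comment> \<open>Terms with \<open>i\<close> in \<open>Z\<close> have coefficient 0; for all
    others the first tensor factor satisfies the conditions itself.\<close>
  have "from_coords (tensor_coords f h t) \<in> tensor_sub {x. \<forall>k\<in>Z. f x $ k = 0} UNIV"
    unfolding from_coords_def
  proof (intro subspace_sum)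
    fix i j
    show "tensor_coords f h t $ i $ j *\<^sub>R (inv f (axis i 1) \<otimes> inv h (axis j 1))
        \<in> tensor_sub {x. \<forall>k\<in>Z. f x $ k = 0} UNIV"
    proof (cases "i \<in> Z")
      case True
      then show ?thesis using Z by (simp add: tensor_sub_def span_zero)
    next
      case False
      then have "\<forall>k\<in>Z. f (inv f (axis i 1)) $ k = 0" by (auto simp: axis_def)
      then show ?thesis unfolding tensor_sub_def by (intro span_scale span_base) blast
    qed
  qed (simp_all add: tensor_sub_def)
  then show "t \<in> tensor_sub {x. \<forall>k\<in>Z. f x $ k = 0} UNIV"
    by (simp add: from_coords_tensor_coords)
qed

end

end

text \<open>The canonical isomorphism that removes the one-dimensional factor of a twisted
  module.\<close>

definition absorb_scalar :: "'a::real_vector \<otimes> real \<Rightarrow> 'a" where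
  "absorb_scalar = tensor_lift (\<lambda>x r. r *\<^sub>R x)"

lemma bilinear_scaleR_flip: "bilinear (\<lambda>x r. r *\<^sub>R (x :: 'a::real_vector))"
  by (auto simp: bilinear_def linear_iff algebra_simps)

lemma linear_absorb_scalar: "linear absorb_scalar"
  unfolding absorb_scalar_def by (rule linear_tensor_lift[OF bilinear_scaleR_flip])

lemma absorb_scalar_pure [simp]: "absorb_scalar (x \<otimes> r) = r *\<^sub>R x"
  unfolding absorb_scalar_def by (rule tensor_lift_pure[OF bilinear_scaleR_flip])

lemma absorb_scalar_inverse: "absorb_scalar t \<otimes> 1 = t"
proof (rule tensor_linear_eqI[of "\<lambda>t. absorb_scalar t \<otimes> 1" "\<lambda>t. t"])
  have l: "linear (\<lambda>x. x \<otimes> y)" "linear (\<lambda>y :: real. x \<otimes> y)" for x :: 'a and y :: real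
    using bilinear_tensor_pure unfolding bilinear_def by blast+
  show "linear (\<lambda>t. absorb_scalar t \<otimes> (1::real))"
    using linear_compose[OF linear_absorb_scalar l(1)] by (simp add: o_def)
  show "absorb_scalar (x \<otimes> r) \<otimes> 1 = x \<otimes> r" for x :: 'a and r
    unfolding absorb_scalar_pure
        using linear_scale[OF l(1)[of 1], of r x] linear_scale[OF l(2)[of x], of r 1] by simp
qed (simp add: linear_iff)

lemma bij_absorb_scalar: "bij absorb_scalar"
proof (rule bijI')
  show "absorb_scalar s = absorb_scalar t \<longleftrightarrow> s = t" for s t :: "'a \<otimes> real"
    by (metis absorb_scalar_inverse)
  show "\<exists>t. x = absorb_scalar t" for x :: 'a
    by (rule exI[of _ "x \<otimes> 1"]) simp
qed

lemma tensor_sub_eq_vimage_absorb: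
  assumes "subspace A"
  shows "tensor_sub A UNIV = absorb_scalar -` A"
proof (intro equalityI subsetI)
  fix t assume "t \<in> tensor_sub A (UNIV :: real set)"
  then show "t \<in> absorb_scalar -` A"
    unfolding tensor_sub_def
    by (induction rule: span_induct_alt)
       (use assms in \<open>auto simp: linear_0 linear_add linear_scale linear_absorb_scalar subspace_0
           subspace_add subspace_scale\<close>)
next
  fix t assume "t \<in> absorb_scalar -` A"
  then have "absorb_scalar t \<otimes> 1 \<in> tensor_sub A (UNIV :: real set)"
    unfolding tensor_sub_def by (intro span_base) blast
  then show "t \<in> tensor_sub A UNIV" by (simp add: absorb_scalar_inverse)
qed

section \<open>Irreducible spaces of vectors and matrices\<close>

text \<open>The dual action involves the inverse transpose, which for a rotation is \<open>A\<close>
  itself, so this is the action on the coefficients of a covariant 2-tensor.\<close>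

definition congruence :: "real^'n^'n \<Rightarrow> real^'n^'n \<Rightarrow> real^'n^'n" where
  "congruence A M = A ** M ** transpose A"

text \<open>Entries are expressed through the rows of \<open>A\<close>, which for
  \<open>plane_rot\<close> are combinations of at most two basis vectors.\<close>

lemma congruence_entry: "congruence A M $ k $ l = (A $ k) \<bullet> (M *v (A $ l))"
proof -
  have "congruence A M $ k $ l = (\<Sum>q\<in>UNIV. \<Sum>p\<in>UNIV. A $ k $ p * M $ p $ q * A $ l $ q)"
    by (simp add: congruence_def matrix_matrix_mult_def transpose_def sum_distrib_right)
  also have "\<dots> = (\<Sum>p\<in>UNIV. \<Sum>q\<in>UNIV. A $ k $ p * M $ p $ q * A $ l $ q)"
    by (rule sum.swap)
  finally show ?thesis
    by (simp add: inner_vec_def matrix_vector_mult_def sum_distrib_left mult.assoc)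
qed

lemma linear_congruence: "linear (congruence A)"
  by (rule linearI; simp add: vec_eq_iff congruence_entry matrix_vector_mult_add_rdistrib inner_add_right
      scaleR_matrix_vector_assoc[symmetric])

lemmas congruence_diff = linear_diff[OF linear_congruence]
lemmas congruence_add = linear_add[OF linear_congruence]
lemmas congruence_scale = linear_scale[OF linear_congruence]

lemma congruence_mult: "congruence (A ** B) M = congruence A (congruence B M)"
  by (simp add: congruence_def matrix_transpose_mul matrix_mul_assoc)

lemma transpose_congruence: "transpose (congruence A M) = congruence A (transpose M)"
  by (simp add: congruence_def matrix_transpose_mul matrix_mul_assoc)

lemma trace_congruence: "orthogonal_matrix A \<Longrightarrow> trace (congruence A M) = trace M"
  unfolding congruence_def
  by (subst trace_mul_sym) (simp add: matrix_mul_assoc orthogonal_matrix_def)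

definition outer :: "real^'n \<Rightarrow> real^'n \<Rightarrow> real^'n^'n" where
  "outer u v = (\<chi> i j. u $ i * v $ j)"

lemma congruence_outer: "congruence A (outer u v) = outer (A *v u) (A *v v)"
proof -
  have "outer u v *v w = (v \<bullet> w) *\<^sub>R u" for w
    by (simp add: outer_def matrix_vector_mult_def vec_eq_iff inner_vec_def sum_distrib_left ac_simps)
  then have "congruence A (outer u v) $ k $ l = (v \<bullet> A $ l) * (A $ k \<bullet> u)" for k l
    by (simp add: congruence_entry)
  then show ?thesis
    by (simp add: vec_eq_iff outer_def matrix_vector_mul_component inner_commute mult.commute)
qed

subsection \<open>Rotations in coordinate planes\<close>

text \<open>Given by rows to match \<open>congruence_entry\<close>; for distinct indices it turns
  the axis of \<open>i\<close> towards that of \<open>j\<close> by the angle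
  \<open>t\<close>.\<close>

definition plane_rot :: "'n \<Rightarrow> 'n \<Rightarrow> real \<Rightarrow> real^'n^'n" where
  "plane_rot i j t = (\<chi> k. if k = i then cos t *\<^sub>R axis i 1 - sin t *\<^sub>R axis j 1
     else if k = j then sin t *\<^sub>R axis i 1 + cos t *\<^sub>R axis j 1 else axis k 1)"

lemma plane_rot_vec:
  "(plane_rot i j t *v x) $ k = (if k = i then cos t * x $ i - sin t * x $ j
     else if k = j then sin t * x $ i + cos t * x $ j else x $ k)"
  by (simp add: plane_rot_def matrix_vector_mul_component inner_diff_left inner_add_left inner_axis')

lemma plane_rot_add:
  assumes "i \<noteq> j"
  shows "plane_rot i j s ** plane_rot i j t = plane_rot i j (s + t)"
  using assms unfolding matrix_eq
  by (simp add: vec_eq_iff matrix_vector_mul_assoc[symmetric] plane_rot_vec cos_add sin_add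
      algebra_simps)

lemma plane_rot_0: "plane_rot i j 0 = mat 1"
  by (simp add: matrix_eq vec_eq_iff plane_rot_vec)

lemma plane_rot_minus: "i \<noteq> j \<Longrightarrow> plane_rot i j (- t) = transpose (plane_rot i j t)"
  by (auto simp: vec_eq_iff plane_rot_def transpose_def axis_def)

lemma rotation_plane_rot:
  assumes "i \<noteq> j"
  shows "rotation_matrix (plane_rot i j t)"
proof -
  have orth: "orthogonal_matrix (plane_rot i j s)" for s
    using assms by (simp add: orthogonal_matrix plane_rot_minus[symmetric] plane_rot_add plane_rot_0)
  \<comment> \<open>The rotation is the square of the one by half the angle, whose determinant is 1
    or -1.\<close>
  have "det (plane_rot i j t) = det (plane_rot i j (t/2)) * det (plane_rot i j (t/2))"
    by (metis assms det_mul field_sum_of_halves plane_rot_add)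
  also have "\<dots> = 1"
    using det_orthogonal_matrix[OF orth[of "t/2"]] by auto
  finally show ?thesis
    using orth by (simp add: rotation_matrix_def)
qed

lemma plane_rot_axis:
  assumes "i \<noteq> j"
  shows "plane_rot i j (pi/2) *v axis i 1 = axis j 1"
    and "plane_rot i j (pi/2) *v axis j 1 = - axis i 1"
    and "k \<noteq> i \<Longrightarrow> k \<noteq> j \<Longrightarrow> plane_rot i j t *v axis k 1 = axis k 1"
  using assms by (auto simp: vec_eq_iff plane_rot_vec axis_def)

lemma matrix_vector_mult_minus: "M *v (- x) = - (M *v (x :: real^'n))"
  by (rule linear_neg[OF matrix_vector_mul_linear])

lemma inner_axis_mult_axis: "axis k 1 \<bullet> (M *v axis l 1) = M $ k $ l"
  by (simp add: inner_axis' matrix_vector_mult_basis column_def)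

lemma congruence_half_turn:
  "congruence (plane_rot i j pi) M $ k $ l
     = (if k = i \<or> k = j then -1 else 1) * (if l = i \<or> l = j then -1 else 1) * M $ k $ l"
  by (auto simp: congruence_entry plane_rot_def inner_axis_mult_axis matrix_vector_mult_minus)

text \<open>In dimension at least two, rotations are transitive on spheres, so one nonzero vector
  reaches a multiple of every other. In dimension one a nonzero subspace is everything already by
  its dimension.\<close>

lemma rotation_invariant_subspace_UNIV:
  fixes W :: "(real^'n) set"
  assumes W: "subspace W" and inv: "\<And>A v. rotation_matrix A \<Longrightarrow> v \<in> W \<Longrightarrow> A *v v \<in> W"
    and v: "v \<in> W" "v \<noteq> 0"
  shows "W = UNIV"
proof (cases "CARD('n) = 1")
  case True
  then have "dim (span {v}) = DIM(real^'n)"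
    using v by (simp add: dim_span)
  then have "span {v} = UNIV"
    by (metis dim_eq_full span_span)
  then show ?thesis
    using span_minimal[of "{v}" W] W v by blast
next
  case False
  have "CARD('n) > 0" by simp
  then have n: "CARD('n) \<ge> 2" using False by linarith
  have "w \<in> W" for w
  proof (cases "w = 0")
    case True then show ?thesis using W by (simp add: subspace_0)
  next
    case False
    have "norm v = norm ((norm v / norm w) *\<^sub>R w)" using False by simp
    then obtain f where f: "orthogonal_transformation f" "det (matrix f) = 1"
        "f v = (norm v / norm w) *\<^sub>R w"
      using rotation_exists[OF n] by metis
    then have "rotation_matrix (matrix f)"
      by (simp add: rotation_matrix_def orthogonal_transformation_matrix)
    moreover have "matrix f *v v = f v"
      using f by (simp add: matrix_works orthogonal_transformation_linear)
    ultimately have "(norm v / norm w) *\<^sub>R w \<in> W"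
      using inv v f by metis
    then have "(norm w / norm v) *\<^sub>R (norm v / norm w) *\<^sub>R w \<in> W"
      by (rule subspace_scale[OF W])
    then show ?thesis using False v by simp
  qed
  then show ?thesis by blast
qed

subsection \<open>Symmetric and antisymmetric matrices\<close>

lemma ex_notin_of_card_less:
  "card S < CARD('n::finite) \<Longrightarrow> \<exists>x. x \<notin> (S :: 'n set)"
  by (metis UNIV_eq_I less_irrefl)

text \<open>A pair of distinct indices is carried to any other by replacing one index at a time and
  swapping. The case \<open>k = j\<close> is set apart because replacing \<open>i\<close> by
  \<open>k\<close> would repeat an index there.\<close>

lemma distinct_pair_propagation:
  assumes sym: "\<And>a b. P a b \<Longrightarrow> P b a"
    and step: "\<And>a b c. a \<noteq> b \<Longrightarrow> a \<noteq> c \<Longrightarrow> b \<noteq> c \<Longrightarrow> P a b \<Longrightarrow> P c b"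
    and P: "P i j" and ij: "i \<noteq> j" and kl: "k \<noteq> l"
  shows "P k l"
proof (cases "k = j")
  case True
  then have "P i k" using P by simp
  then show ?thesis using step[of i k l] sym True ij kl by metis
next
  case False
  then have "P j k" using step[of i j k] sym P ij by metis
  then show ?thesis using step[of j k l] sym False kl by metis
qed

definition skew_matrices :: "(real^'n^'n) set" where
  "skew_matrices = {M. transpose M = - M}"

definition sym_matrices :: "(real^'n^'n) set" where
  "sym_matrices = {M. transpose M = M}"

definition sym_tracefree_matrices :: "(real^'n^'n) set" where
  "sym_tracefree_matrices = {M. transpose M = M \<and> trace M = 0}"

definition wedge :: "'n \<Rightarrow> 'n \<Rightarrow> real^'n^'n" where
  "wedge i j = outer (axis i 1) (axis j 1) - outer (axis j 1) (axis i 1)"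

definition diag_diff :: "'n \<Rightarrow> 'n \<Rightarrow> real^'n^'n" where
  "diag_diff i j = outer (axis i 1) (axis i 1) - outer (axis j 1) (axis j 1)"

definition sym_pair :: "'n \<Rightarrow> 'n \<Rightarrow> real^'n^'n" where
  "sym_pair i j = outer (axis i 1) (axis j 1) + outer (axis j 1) (axis i 1)"

lemma linear_transpose: "linear (transpose :: real^'n^'m \<Rightarrow> real^'m^'n)"
  by (rule linearI; simp add: transpose_def vec_eq_iff)

lemma linear_trace: "linear (trace :: real^'n^'n \<Rightarrow> real)"
  by (rule linearI; simp add: trace_def sum.distrib sum_distrib_left)

lemma subspace_linear_eq:
  assumes "linear f" "linear g"
  shows "subspace {x. f x = g x}"
  using assms by (simp add: subspace_def linear_0 linear_add linear_scale)

lemma subspace_skew_matrices: "subspace skew_matrices"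
  unfolding skew_matrices_def by (intro subspace_linear_eq linear_transpose linear_uminus)

lemma subspace_sym_matrices: "subspace sym_matrices"
  unfolding sym_matrices_def by (intro subspace_linear_eq linear_transpose linear_ident)

lemma subspace_sym_tracefree_matrices: "subspace sym_tracefree_matrices"
  unfolding sym_tracefree_matrices_def Collect_conj_eq
  by (intro subspace_inter subspace_linear_eq linear_transpose linear_ident linear_trace linear_zero)

lemma congruence_wedge_quarter:
  "a \<noteq> b \<Longrightarrow> a \<noteq> c \<Longrightarrow> b \<noteq> c \<Longrightarrow> congruence (plane_rot a c (pi/2)) (wedge a b) = wedge c b"
  by (simp add: wedge_def congruence_diff congruence_outer plane_rot_axis)

lemma congruence_diag_diff_quarter:
  "a \<noteq> b \<Longrightarrow> a \<noteq> c \<Longrightarrow> b \<noteq> c \<Longrightarrow> congruence (plane_rot a c (pi/2)) (diag_diff a b) = diag_diff c b"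
  by (simp add: diag_diff_def congruence_diff congruence_outer plane_rot_axis)

lemma congruence_sym_pair_quarter:
  "a \<noteq> b \<Longrightarrow> a \<noteq> c \<Longrightarrow> b \<noteq> c \<Longrightarrow> congruence (plane_rot a c (pi/2)) (sym_pair a b) = sym_pair c b"
  by (simp add: sym_pair_def congruence_add congruence_outer plane_rot_axis)

lemma matrix_expand:
  "(\<Sum>k\<in>UNIV. \<Sum>l\<in>UNIV. M $ k $ l *\<^sub>R outer (axis k 1) (axis l 1)) = M"
proof -
  have *: "M $ k $ l * (axis k 1 $ x * axis l 1 $ y)
      = (if k = x then if l = y then M $ k $ l else 0 else 0)"
    for k l x y by (simp add: axis_def)
  show ?thesis
    by (simp add: vec_eq_iff outer_def * sum_delta2)
qed

lemma matrix_expand_transpose: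
  "(\<Sum>k\<in>UNIV. \<Sum>l\<in>UNIV. M $ k $ l *\<^sub>R outer (axis l 1) (axis k 1)) = transpose M"
  by (subst sum.swap, subst matrix_expand[symmetric]) (simp add: transpose_def)

lemma skew_expand:
  assumes "M \<in> skew_matrices"
  shows "M = (\<Sum>k\<in>UNIV. \<Sum>l\<in>UNIV. (M $ k $ l / 2) *\<^sub>R wedge k l)"
proof -
  have "(\<Sum>k\<in>UNIV. \<Sum>l\<in>UNIV. (M $ k $ l / 2) *\<^sub>R wedge k l)
      = (1/2) *\<^sub>R (\<Sum>k\<in>UNIV. \<Sum>l\<in>UNIV. M $ k $ l *\<^sub>R wedge k l)"
    by (simp add: scaleR_sum_right)
  also have "\<dots> = (1/2) *\<^sub>R (M - transpose M)"
    unfolding wedge_def scaleR_diff_right sum_subtractf matrix_expand matrix_expand_transpose ..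
  also have "\<dots> = M"
    using assms by (simp add: skew_matrices_def vec_eq_iff)
  finally show ?thesis ..
qed

text \<open>The reference index \<open>i\<close> is arbitrary: the multiples of its diagonal unit
  add up to the trace of \<open>M\<close>, which is 0.\<close>

lemma sym_tracefree_expand:
  fixes M :: "real^'n^'n"
  assumes "M \<in> sym_tracefree_matrices"
  shows "M = (\<Sum>k\<in>UNIV. \<Sum>l\<in>UNIV.
    if k = l then (M $ k $ k) *\<^sub>R diag_diff k i else (M $ k $ l / 2) *\<^sub>R sym_pair k l)"
    (is "_ = ?R")
proof -
  let ?E = "outer (axis i 1) (axis i 1) :: real^'n^'n"
  \<comment> \<open>\<open>sym_pair k k\<close> is twice a diagonal unit, so both branches contain
    the same halved \<open>sym_pair\<close> term and differ only by a multiple of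
    \<open>?E\<close>.\<close>
  have "(if k = l then (M $ k $ k) *\<^sub>R diag_diff k i else (M $ k $ l / 2) *\<^sub>R sym_pair k l)
      = (1/2) *\<^sub>R (M $ k $ l *\<^sub>R sym_pair k l) - (if k = l then (M $ k $ k) *\<^sub>R ?E else 0)" for k l
    by (simp add: sym_pair_def diag_diff_def scaleR_add_left[symmetric] algebra_simps)
  then have "?R = (\<Sum>k\<in>UNIV. \<Sum>l\<in>UNIV. (1/2) *\<^sub>R (M $ k $ l *\<^sub>R sym_pair k l))
      - (\<Sum>k\<in>UNIV. (M $ k $ k) *\<^sub>R ?E)"
    by (simp only: sum_subtractf sum.delta finite_class.finite_UNIV UNIV_I if_True)
       (simp add: sum.delta')
  also have "(\<Sum>k\<in>UNIV. (M $ k $ k) *\<^sub>R ?E) = trace M *\<^sub>R ?E"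
    by (simp add: trace_def scaleR_sum_left)
  also have "(\<Sum>k\<in>UNIV. \<Sum>l\<in>UNIV. (1/2) *\<^sub>R (M $ k $ l *\<^sub>R sym_pair k l)) = (1/2) *\<^sub>R (M + transpose M)"
    unfolding sym_pair_def scaleR_add_right sum.distrib scaleR_sum_right[symmetric]
      matrix_expand matrix_expand_transpose ..
  finally show ?thesis
    using assms by (simp add: sym_tracefree_matrices_def flip: scaleR_2)
qed

lemma wedge_antisym: "wedge j i = - wedge i j"
  by (simp add: wedge_def)

lemma wedge_self: "wedge i i = 0"
  by (simp add: wedge_def)

context
  fixes W :: "(real^'n^'n) set"
  assumes W: "subspace W"
    and inv: "\<And>A M. rotation_matrix A \<Longrightarrow> M \<in> W \<Longrightarrow> congruence A M \<in> W"
begin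

lemma invariant_plane_rot: "i \<noteq> j \<Longrightarrow> M \<in> W \<Longrightarrow> congruence (plane_rot i j t) M \<in> W"
  by (simp add: inv rotation_plane_rot)

text \<open>Quarter turns replace one index of a wedge and a swap only changes its sign, so one
  wedge yields all of them, and these span.\<close>

lemma skew_subset_of_wedge:
  assumes "wedge i j \<in> W" "i \<noteq> j"
  shows "skew_matrices \<subseteq> W"
proof
  have mem: "wedge k l \<in> W" if "k \<noteq> l" for k l
  proof (rule distinct_pair_propagation[of "\<lambda>k l. wedge k l \<in> W"])
    show "wedge a b \<in> W \<Longrightarrow> wedge b a \<in> W" for a b
      by (subst wedge_antisym) (simp add: W subspace_neg)
    show "wedge c b \<in> W" if "a \<noteq> b" "a \<noteq> c" "b \<noteq> c" "wedge a b \<in> W" for a b c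
      using invariant_plane_rot[OF that(2,4), of "pi/2"] that by (simp add: congruence_wedge_quarter)
  qed (use assms that in auto)
  have mem: "wedge k l \<in> W" for k l
    using mem[of k l] by (cases "k = l") (auto simp: wedge_self subspace_0 W)
  fix M :: "real^'n^'n" assume "M \<in> skew_matrices"
  then show "M \<in> W"
    by (subst skew_expand) (auto intro!: subspace_sum subspace_scale W mem)
qed

text \<open>The averaging over the four quarter turns in the plane of \<open>i\<close> and \<open>j\<close> isolates the
  component of weight two, which lives in the trace-free symmetric part of the \<open>2 \<times> 2\<close> block.\<close>

lemma sym_tracefree_subset:
  assumes sub: "W \<subseteq> sym_tracefree_matrices" and M: "M \<in> W" "M \<noteq> 0"
  shows "sym_tracefree_matrices \<subseteq> W"
proof -
  have sym: "M $ l $ k = M $ k $ l" for k l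
    using sub M by (auto simp: sym_tracefree_matrices_def vec_eq_iff transpose_def)
  have tr: "(\<Sum>k\<in>UNIV. M $ k $ k) = 0"
    using sub M by (auto simp: sym_tracefree_matrices_def trace_def)
  \<comment> \<open>Without such a pair \<open>M\<close> would be a multiple of the identity, and
    its trace forces that multiple to be 0.\<close>
  obtain i j where ij: "i \<noteq> j" and nz: "M $ i $ j \<noteq> 0 \<or> M $ i $ i \<noteq> M $ j $ j"
  proof (rule ccontr)
    assume "\<not> thesis"
    then have off: "M $ i $ j = 0" and diag: "M $ i $ i = M $ j $ j" if "i \<noteq> j" for i j
      using that \<open>\<And>j i. i \<noteq> j \<Longrightarrow> _ \<Longrightarrow> thesis\<close> by blast+
    have "M $ k $ l = 0" for k l
    proof (cases "k = l")
      case True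
      have "(\<Sum>i\<in>UNIV. M $ i $ i) = (\<Sum>i\<in>(UNIV::'n set). M $ k $ k)"
        by (rule sum.cong) (use diag in metis)+
      then show ?thesis using tr True by simp
    qed (use off in auto)
    then show False using M by (simp add: vec_eq_iff)
  qed
  \<comment> \<open>The trace-free part of the symmetric block at \<open>i\<close>, \<open>j\<close>
    is half the diagonal difference times \<open>diag_diff i j\<close> plus \<open>M $ i $ j\<close>
    times \<open>sym_pair i j\<close>. A quarter turn negates it, so the four terms of
    \<open>N\<close> add up to four times this part; everything else cancels.\<close>
  define \<alpha> \<beta> where "\<alpha> = 2 * (M $ i $ i - M $ j $ j)" and "\<beta> = 4 * M $ i $ j"
  define N where "N = M - congruence (plane_rot i j (pi/2)) M + congruence (plane_rot i j pi) M
    - congruence (plane_rot i j (-(pi/2))) M"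
  have N: "N \<in> W"
    unfolding N_def by (intro subspace_add[OF W] subspace_diff[OF W] invariant_plane_rot ij M)
  have rows: "plane_rot i j (pi/2) $ k
      = (if k = i then - axis j 1 else if k = j then axis i 1 else axis k 1)"
    "plane_rot i j (- (pi/2)) $ k
        = (if k = i then axis j 1 else if k = j then - axis i 1 else axis k 1)" for k
    by (simp_all add: plane_rot_def)
  have "N $ k $ l = (\<alpha> *\<^sub>R diag_diff i j + \<beta> *\<^sub>R sym_pair i j) $ k $ l" for k l
    using ij by (cases "k = i"; cases "k = j"; cases "l = i"; cases "l = j")
      (simp_all add: N_def congruence_half_turn congruence_entry[of "plane_rot i j (pi/2)"]
        congruence_entry[of "plane_rot i j (- (pi/2))"] rows matrix_vector_mult_minus
        inner_axis_mult_axis \<alpha>_def \<beta>_def diag_diff_def sym_pair_def outer_def sym, simp_all add: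
            axis_def)
  then have "N = \<alpha> *\<^sub>R diag_diff i j + \<beta> *\<^sub>R sym_pair i j"
    by (simp add: vec_eq_iff)
  note N = N[unfolded this]
  define c :: real where "c = sqrt 2 / 2"
  have cc: "c * c = 1/2" by (simp add: c_def)
  have t: "cos (pi/4) = c" "sin (pi/4) = c"
    by (simp_all add: c_def cos_45 sin_45)
  have R: "plane_rot i j (pi/4) *v axis i 1 = c *\<^sub>R (axis i 1 + axis j 1)"
    "plane_rot i j (pi/4) *v axis j 1 = c *\<^sub>R (axis j 1 - axis i 1)"
    using ij by (auto simp: vec_eq_iff plane_rot_vec t axis_def)
  have outer_c: "outer (c *\<^sub>R u) (c *\<^sub>R v) = (1/2) *\<^sub>R outer u v" for u v :: "real^'n"
    by (simp add: vec_eq_iff outer_def cc[symmetric])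
  \<comment> \<open>An eighth turn of the coordinate plane acts on the span of
    \<open>diag_diff i j\<close> and \<open>sym_pair i j\<close> as a quarter turn.\<close>
  have D: "congruence (plane_rot i j (pi/4)) (diag_diff i j) = sym_pair i j"
   and S: "congruence (plane_rot i j (pi/4)) (sym_pair i j) = - diag_diff i j"
    unfolding diag_diff_def sym_pair_def congruence_diff congruence_add congruence_outer R outer_c
    by (simp_all add: vec_eq_iff outer_def algebra_simps)
  have N': "\<alpha> *\<^sub>R sym_pair i j - \<beta> *\<^sub>R diag_diff i j \<in> W"
    using invariant_plane_rot[OF ij N, of "pi/4"] by (simp add: congruence_add congruence_scale D S)
  have ab: "\<alpha> * \<alpha> + \<beta> * \<beta> \<noteq> 0"
  proof -
    have "\<alpha> \<noteq> 0 \<or> \<beta> \<noteq> 0" using nz by (auto simp: \<alpha>_def \<beta>_def)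
    then show ?thesis by (simp add: sum_squares_eq_zero_iff)
  qed
  \<comment> \<open>With J for that quarter turn, the isolated block is \<alpha> + \<beta> J applied
    to \<open>diag_diff i j\<close>; applying \<alpha> - \<beta> J leaves \<alpha>^2 + \<beta>^2
    times \<open>diag_diff i j\<close>.\<close>
  have "\<alpha> *\<^sub>R (\<alpha> *\<^sub>R diag_diff i j + \<beta> *\<^sub>R sym_pair i j)
      - \<beta> *\<^sub>R (\<alpha> *\<^sub>R sym_pair i j - \<beta> *\<^sub>R diag_diff i j) \<in> W"
    by (intro subspace_diff[OF W] subspace_scale[OF W] N N')
  then have "(\<alpha> * \<alpha> + \<beta> * \<beta>) *\<^sub>R diag_diff i j \<in> W"
    by (simp add: algebra_simps)
  from subspace_scale[OF W this, of "inverse (\<alpha> * \<alpha> + \<beta> * \<beta>)"] have Dij: "diag_diff i j \<in> W"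
    using ab by simp
  then have Sij: "sym_pair i j \<in> W"
    using invariant_plane_rot[OF ij Dij, of "pi/4"] by (simp add: D)
  have mem: "diag_diff k l \<in> W \<and> sym_pair k l \<in> W" if "k \<noteq> l" for k l
  proof (rule distinct_pair_propagation[of "\<lambda>k l. diag_diff k l \<in> W \<and> sym_pair k l \<in> W"])
    show "diag_diff b a \<in> W \<and> sym_pair b a \<in> W" if "diag_diff a b \<in> W \<and> sym_pair a b \<in> W" for a b
    proof -
      have "diag_diff b a = - diag_diff a b" "sym_pair b a = sym_pair a b"
        by (simp_all add: diag_diff_def sym_pair_def)
      then show ?thesis using that by (simp add: W subspace_neg)
    qed
    show "diag_diff c b \<in> W \<and> sym_pair c b \<in> W"
      if "a \<noteq> b" "a \<noteq> c" "b \<noteq> c" "diag_diff a b \<in> W \<and> sym_pair a b \<in> W" for a b c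
      using invariant_plane_rot[OF that(2), of _ "pi/2"] that
      by (metis congruence_diag_diff_quarter congruence_sym_pair_quarter)
  qed (use Dij Sij ij that in auto)
  have mem_diag: "diag_diff k i \<in> W" for k
    using mem[of k i] by (cases "k = i") (auto simp: diag_diff_def subspace_0 W)
  show ?thesis
  proof
    fix X :: "real^'n^'n" assume "X \<in> sym_tracefree_matrices"
    then show "X \<in> W"
      by (subst sym_tracefree_expand[of _ i])
          (auto intro!: subspace_sum subspace_scale W mem[THEN conjunct2] mem_diag)
  qed
qed

text \<open>Products of operators \<open>1 \<plusminus> congruence (half turn)\<close> isolate a single pair of entries; in
  dimension 4 the half turns cannot separate a pair of indices from the complementary pair.\<close>

lemma skew_subset:
  assumes n: "CARD('n) \<noteq> 4" and sub: "W \<subseteq> skew_matrices" and M: "M \<in> W" "M \<noteq> 0"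
  shows "skew_matrices \<subseteq> W"
proof -
  have sk: "M $ l $ k = - M $ k $ l" for k l
    using sub M by (auto simp: skew_matrices_def vec_eq_iff transpose_def)
  have diag: "M $ k $ k = 0" for k
    using sk[of k k] by simp
  obtain p q where pq: "M $ p $ q \<noteq> 0"
    using M by (auto simp: vec_eq_iff)
  then have ne: "p \<noteq> q" "q \<noteq> p" using diag by auto
  define plus minus where
    "plus i j X = X + congruence (plane_rot i j pi) X" and
    "minus i j X = X - congruence (plane_rot i j pi) X" for i j and X :: "real^'n^'n"
  have mem: "plus i j X \<in> W" "minus i j X \<in> W" if "i \<noteq> j" "X \<in> W" for i j X
    unfolding plus_def minus_def
    by (intro subspace_add[OF W] subspace_diff[OF W] invariant_plane_rot that)+
  \<comment> \<open>The half turn fixes the entry at \<open>k\<close>, \<open>l\<close> when both or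
    neither of these indices belong to the pair \<open>i\<close>, \<open>j\<close>, and negates it
    otherwise. So \<open>plus\<close> keeps the first kind of entry, \<open>minus\<close> the
    second, each doubled.\<close>
  define same where "same i j k l \<longleftrightarrow> (k = i \<or> k = j) = (l = i \<or> l = j)" for i j k l :: 'n
  have ent: "plus i j X $ k $ l = (if same i j k l then 2 * X $ k $ l else 0)"
    "minus i j X $ k $ l = (if same i j k l then 0 else 2 * X $ k $ l)"
    for i j X k l by (auto simp: plus_def minus_def same_def congruence_half_turn)
  have wedge_pq: "wedge p q $ x $ y
      = (if x = p \<and> y = q then 1 else if x = q \<and> y = p then -1 else 0)" for x y
    using ne by (simp add: wedge_def outer_def axis_def)
  have "\<exists>N c. N \<in> W \<and> c \<noteq> 0 \<and> N = (c * M $ p $ q) *\<^sub>R wedge p q"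
  proof -
    have "card {p, q} \<le> CARD('n)" by (rule card_mono) auto
    then have "CARD('n) \<ge> 2" using ne by simp
    then consider "CARD('n) = 2" | "CARD('n) = 3" | "CARD('n) \<ge> 5"
      using n by linarith
    then show ?thesis
    proof cases
      case 1
      \<comment> \<open>Skew matrices form a line here, so nothing has to be isolated.\<close>
      have "UNIV = {p, q}"
        by (rule sym, rule card_subset_eq) (auto simp: 1 ne)
      then have U: "\<And>x. x = p \<or> x = q" by blast
      have "M $ x $ y = ((1 * M $ p $ q) *\<^sub>R wedge p q) $ x $ y" for x y
        using U[of x] U[of y] ne
        by (elim disjE) (simp_all add: wedge_def outer_def axis_def diag sk[of p q])
      then have "M = (1 * M $ p $ q) *\<^sub>R wedge p q"
        unfolding vec_eq_iff by iprover
      then show ?thesis using M by (metis one_neq_zero)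
    next
      case 2
      then obtain r where r: "r \<notin> {p, q}"
        using ex_notin_of_card_less[of "{p, q}"] ne by auto
      have "UNIV = {p, q, r}"
        by (rule sym, rule card_subset_eq) (use r ne in \<open>auto simp: 2\<close>)
      then have U: "\<And>x. x = p \<or> x = q \<or> x = r" by blast
      \<comment> \<open>The other two pairs share exactly one index with \<open>p\<close>,
        \<open>q\<close>, so a single \<open>plus\<close> removes them.\<close>
      have "plus p q M $ x $ y = ((2 * M $ p $ q) *\<^sub>R wedge p q) $ x $ y" for x y
      proof -
        have "same p q x y \<longleftrightarrow> x = y \<or> x = p \<and> y = q \<or> x = q \<and> y = p"
          unfolding same_def using U[of x] U[of y] r by auto
        then show ?thesis
          using ne by (auto simp: ent wedge_pq diag sk[of p q])
      qed
      then have "plus p q M = (2 * M $ p $ q) *\<^sub>R wedge p q"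
        by (simp add: vec_eq_iff)
      then show ?thesis using mem(1)[OF ne(1) M(1)] by (metis zero_neq_numeral)
    next
      case 3
      have ex: "\<exists>x. x \<notin> set xs" if "length xs < 5" for xs :: "'n list"
        by (rule ex_notin_of_card_less) (use card_length[of xs] 3 that in linarith)
      obtain r where r: "r \<notin> set [p, q]" using ex[of "[p, q]"] by auto
      obtain s where s: "s \<notin> set [p, q, r]" using ex[of "[p, q, r]"] by auto
      obtain t where t: "t \<notin> set [p, q, r, s]" using ex[of "[p, q, r, s]"] by auto
      \<comment> \<open>Off the diagonal, \<open>plus p q\<close> leaves the pair itself and the
        pairs disjoint from it. A disjoint pair survives \<open>minus p x\<close> only if it
        contains \<open>x\<close>, and two indices cannot include all of \<open>r\<close>,
        \<open>s\<close>, \<open>t\<close>; the pair \<open>p\<close>, \<open>q\<close> survives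
        throughout. Four doublings give the factor 16.\<close>
      define N where "N = minus p t (minus p s (minus p r (plus p q M)))"
      have "N $ x $ y = (if same p q x y \<and> \<not> same p r x y \<and> \<not> same p s x y \<and> \<not> same p t x y
          then 16 * M $ x $ y else 0)" for x y
        by (simp add: N_def ent)
      moreover have "same p q x y \<and> \<not> same p r x y \<and> \<not> same p s x y \<and> \<not> same p t x y
          \<longleftrightarrow> x = p \<and> y = q \<or> x = q \<and> y = p" for x y
        unfolding same_def using r s t ne by simp metis
      ultimately have "N $ x $ y = (if x = p \<and> y = q \<or> x = q \<and> y = p then 16 * M $ x $ y else 0)" for x y
        by simp
      then have "N = (16 * M $ p $ q) *\<^sub>R wedge p q"
        using ne by (simp add: vec_eq_iff wedge_pq sk[of p q])
      moreover have "N \<in> W"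
        unfolding N_def using r s t ne by (intro mem M) auto
      ultimately show ?thesis by (metis zero_neq_numeral)
    qed
  qed
  then obtain c where c: "c \<noteq> 0" "(c * M $ p $ q) *\<^sub>R wedge p q \<in> W" by blast
  then have "wedge p q \<in> W"
    using subspace_scale[OF W c(2), of "inverse (c * M $ p $ q)"] pq
    by (simp del: inverse_mult_distrib)
  then show ?thesis
    using ne(1) by (rule skew_subset_of_wedge)
qed

end

subsection \<open>Dimensions\<close>

lemma inner_outer_axis: "outer (axis i 1) (axis j 1) \<bullet> M = M $ i $ j"
proof -
  have "outer (axis i 1) (axis j 1) = axis i (axis j 1)"
    by (auto simp: outer_def axis_def vec_eq_iff)
  then show ?thesis by (simp add: inner_axis')
qed

lemma inner_wedge: "wedge i j \<bullet> M = M $ i $ j - M $ j $ i"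
  by (simp add: wedge_def inner_diff_left inner_outer_axis)

lemma wedge_entry: "wedge i j $ k $ l = of_bool (k = i \<and> l = j) - of_bool (k = j \<and> l = i)"
  by (auto simp: wedge_def outer_def axis_def)

lemma skew_entry:
  assumes "M \<in> skew_matrices"
  shows "M $ j $ i = - M $ i $ j"
proof -
  have "transpose M $ i $ j = (- M) $ i $ j"
    using assms by (simp only: skew_matrices_def mem_Collect_eq)
  then show ?thesis by (simp add: transpose_def)
qed

lemma skewI: "(\<And>i j. M $ j $ i = - M $ i $ j) \<Longrightarrow> M \<in> skew_matrices"
  unfolding skew_matrices_def mem_Collect_eq vec_eq_iff transpose_def vec_lambda_beta
    vector_uminus_component by iprover

lemma wedge_skew: "wedge i j \<in> (skew_matrices :: (real^'n^'n) set)"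
proof -
  have "transpose (outer u v) = outer v u" for u v :: "real^'n"
    by (simp add: transpose_def outer_def vec_eq_iff mult.commute)
  then show ?thesis
    by (simp add: skew_matrices_def wedge_def linear_diff[OF linear_transpose])
qed

text \<open>The wedges of increasing pairs form an orthogonal basis, and these pairs are counted.
  The index type carries no order, so \<open>f\<close> borrows one from the naturals.\<close>

lemma dim_skew_matrices:
  "real (dim (skew_matrices :: (real^'n^'n) set)) = 1/2 * real CARD('n) * (real CARD('n) - 1)"
proof -
  obtain f :: "'n \<Rightarrow> nat" where f: "inj f"
    using finite_imp_inj_to_nat_seg[OF finite_class.finite_UNIV] by metis
  define P where "P = {(i, j). f i < f j}"
  define w where "w = (\<lambda>(i :: 'n, j). wedge i j)"
  have inner_w: "w p \<bullet> w q = (if p = q then 2 else 0)" if "p \<in> P" "q \<in> P" for p q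
  proof -
    obtain i j k l where pq: "p = (i, j)" "q = (k, l)"
      by (cases p, cases q)
    with that have "f i < f j" "f k < f l" by (simp_all add: P_def)
    then have "i \<noteq> j" "k \<noteq> l" "\<not> (i = l \<and> j = k)" by auto
    then show ?thesis by (auto simp: pq w_def inner_wedge wedge_entry)
  qed
  have inj: "inj_on w P"
  proof (rule inj_onI)
    fix p q assume "p \<in> P" "q \<in> P" "w p = w q"
    then show "p = q" using inner_w[of p p] inner_w[of p q] by (auto split: if_splits)
  qed
  have "pairwise orthogonal (w ` P)"
    unfolding pairwise_image using inner_w by (auto simp: pairwise_def orthogonal_def)
  moreover have "0 \<notin> w ` P"
  proof
    assume "0 \<in> w ` P"
    then obtain p where "p \<in> P" "w p = 0" by force
    then show False using inner_w[of p p] by simp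
  qed
  ultimately have "independent (w ` P)"
    by (rule pairwise_orthogonal_independent)
  moreover have "span (w ` P) = span skew_matrices"
  proof (intro span_eq[THEN iffD2] conjI subsetI)
    fix x assume "x \<in> w ` P"
    then show "x \<in> span skew_matrices"
      by (auto simp: w_def wedge_skew intro: span_base)
  next
    fix M :: "real^'n^'n" assume M: "M \<in> skew_matrices"
    have "wedge i j \<in> span (w ` P)" for i j :: 'n
    proof -
      consider "f i < f j" | "f j < f i" | "i = j"
        using f by (metis injD linorder_neqE_nat)
      then show ?thesis
      proof cases
        case 1
        then have "wedge i j \<in> w ` P"
          by (intro image_eqI[of _ _ "(i, j)"]) (simp_all add: w_def P_def)
        then show ?thesis by (rule span_base)
      next
        case 2
        then have "wedge j i \<in> w ` P"
          by (intro image_eqI[of _ _ "(j, i)"]) (simp_all add: w_def P_def)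
        then have "wedge j i \<in> span (w ` P)" by (rule span_base)
        then show ?thesis by (subst wedge_antisym) (rule span_neg)
      qed (simp add: wedge_self span_zero)
    qed
    then show "M \<in> span (w ` P)"
      by (subst skew_expand[OF M]) (intro span_sum span_scale)
  qed
  ultimately have "dim (skew_matrices :: (real^'n^'n) set) = card P"
    by (metis card_image dim_eq_card inj)
  moreover have "2 * card P = CARD('n) * CARD('n) - CARD('n)"
  proof -
    \<comment> \<open>All pairs split into the increasing ones, their swaps and the
      diagonal.\<close>
    have "(UNIV :: ('n \<times> 'n) set) = (P \<union> prod.swap ` P) \<union> range (\<lambda>i. (i, i))"
    proof (intro equalityI subsetI)
      fix p :: "'n \<times> 'n"
      obtain i j where p: "p = (i, j)" by (cases p)
      consider "f i < f j" | "f j < f i" | "i = j"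
        using f by (metis injD linorder_neqE_nat)
      then show "p \<in> (P \<union> prod.swap ` P) \<union> range (\<lambda>i. (i, i))"
        by cases (auto simp: p P_def image_iff)
    qed simp
    then have "CARD('n \<times> 'n) = card ((P \<union> prod.swap ` P) \<union> range (\<lambda>i. (i, i)))"
      by simp
    also have "\<dots> = card (P \<union> prod.swap ` P) + card (range (\<lambda>i::'n. (i, i)))"
      by (intro card_Un_disjoint) (auto simp: P_def)
    also have "card (P \<union> prod.swap ` P) = card P + card (prod.swap ` P)"
      by (intro card_Un_disjoint) (auto simp: P_def)
    also have "card (prod.swap ` P) = card P"
      by (intro card_image) auto
    also have "card (range (\<lambda>i::'n. (i, i))) = CARD('n)"
      by (intro card_image) (auto simp: inj_on_def)
    finally show ?thesis by simp
  qed
  \<comment> \<open>The count is put in additive form before the cast to the reals, as subtraction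
    of naturals is truncated.\<close>
  ultimately have "2 * dim (skew_matrices :: (real^'n^'n) set) + CARD('n) = CARD('n) * CARD('n)"
    by simp
  then have "2 * real (dim (skew_matrices :: (real^'n^'n) set)) + real CARD('n)
      = real CARD('n) * real CARD('n)"
    by (metis of_nat_add of_nat_mult of_nat_numeral)
  then show ?thesis by (simp add: algebra_simps)
qed

text \<open>Pairing with \<open>wedge i j\<close> gives \<open>M $ i $ j - M $ j $ i\<close>, so
  symmetry is orthogonality to all wedges. The dimension of the symmetric matrices is then that of
  an orthogonal complement, with no basis constructed.\<close>

lemma sym_matrices_orthogonal_skew:
  "sym_matrices = {M \<in> UNIV. \<forall>N\<in>skew_matrices. orthogonal N M}"
proof (intro equalityI subsetI)
  fix M :: "real^'n^'n" assume M: "M \<in> sym_matrices"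
  have "N \<bullet> M = 0" if N: "N \<in> skew_matrices" for N
  proof -
    have "N \<bullet> M = transpose N \<bullet> transpose M"
      by (simp add: inner_vec_def transpose_def sum.swap[of "\<lambda>i j. N $ i $ j * M $ i $ j"])
    also have "\<dots> = - (N \<bullet> M)"
      using M N by (simp add: sym_matrices_def skew_matrices_def)
    finally show ?thesis by simp
  qed
  then show "M \<in> {M \<in> UNIV. \<forall>N\<in>skew_matrices. orthogonal N M}"
    by (simp add: orthogonal_def)
next
  fix M :: "real^'n^'n" assume M: "M \<in> {M \<in> UNIV. \<forall>N\<in>skew_matrices. orthogonal N M}"
  then have "wedge i j \<bullet> M = 0" for i j
    using wedge_skew[of i j] by (auto simp: orthogonal_def)
  then show "M \<in> sym_matrices"
    by (simp add: inner_wedge sym_matrices_def vec_eq_iff transpose_def)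
qed

lemma sym_tracefree_orthogonal_identity:
  "(sym_tracefree_matrices :: (real^'n^'n) set) = {M \<in> sym_matrices. \<forall>N\<in>span {mat 1}. orthogonal N M}"
proof -
  have "mat 1 \<bullet> M = trace M" for M :: "real^'n^'n"
    by (simp add: inner_vec_def trace_def mat_def if_distrib[of "\<lambda>x. x * _"] cong: if_cong)
  then show ?thesis
    by (auto simp: sym_tracefree_matrices_def sym_matrices_def span_singleton orthogonal_def)
qed

text \<open>Two successive orthogonal complements: of the skew matrices among all matrices, then of
  the line of the identity among the symmetric ones.\<close>

lemma dim_sym_tracefree_matrices:
  "real (dim (sym_tracefree_matrices :: (real^'n^'n) set))
      = 1/2 * real CARD('n) * (real CARD('n) + 1) - 1"
proof -
  let ?n = "real CARD('n)"
  have "dim (sym_matrices :: (real^'n^'n) set) + dim (skew_matrices :: (real^'n^'n) set)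
      = CARD('n) * CARD('n)"
    unfolding sym_matrices_orthogonal_skew
    by (subst dim_subspace_orthogonal_to_vectors) (auto simp: subspace_skew_matrices)
  moreover have "(mat 1 :: real^'n^'n) \<in> sym_matrices"
    by (simp add: sym_matrices_def transpose_mat)
  then have "span {mat 1 :: real^'n^'n} \<subseteq> sym_matrices"
    by (intro span_minimal) (auto simp: subspace_sym_matrices)
  then have "dim (sym_tracefree_matrices :: (real^'n^'n) set) + dim (span {mat 1 :: real^'n^'n})
      = dim (sym_matrices :: (real^'n^'n) set)"
    unfolding sym_tracefree_orthogonal_identity
    by (intro dim_subspace_orthogonal_to_vectors) (auto simp: subspace_sym_matrices)
  moreover have "(mat 1 :: real^'n^'n) \<noteq> 0"
    by (simp add: vec_eq_iff mat_def)
  then have "dim (span {mat 1 :: real^'n^'n}) = 1"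
    by simp
  ultimately have "dim (sym_tracefree_matrices :: (real^'n^'n) set) + 1
      + dim (skew_matrices :: (real^'n^'n) set) = CARD('n) * CARD('n)"
    by linarith
  then have "real (dim (sym_tracefree_matrices :: (real^'n^'n) set)) + 1
      + real (dim (skew_matrices :: (real^'n^'n) set)) = ?n * ?n"
    by (metis of_nat_add of_nat_mult of_nat_1)
  moreover have e1: "1/2 * ?n * (?n - 1) = (?n * ?n - ?n) / 2" and e2:
      "1/2 * ?n * (?n + 1) - 1 = (?n * ?n + ?n) / 2 - 1"
    by (simp_all add: field_simps)
  ultimately have "real (dim (sym_tracefree_matrices :: (real^'n^'n) set)) + 1
      + (?n * ?n - ?n) / 2 = ?n * ?n"
    unfolding dim_skew_matrices e1 by iprover
  then show ?thesis
    unfolding e2 by (simp add: field_simps)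
qed

subsection \<open>The Hodge star in dimension four\<close>

text \<open>The coordinate form of \<open>hodge_star\<close>; it keeps tensors out of the
  four-dimensional computations.\<close>

definition hodge_matrix :: "(nat \<Rightarrow> 'n::finite) \<Rightarrow> real^'n^'n \<Rightarrow> real^'n^'n" where
  "hodge_matrix b M = (\<chi> i j. 1 / 2 * (\<Sum>k\<in>UNIV. \<Sum>l\<in>UNIV.
     volume4 b (axis i 1) (axis j 1) (axis k 1) (axis l 1) * M $ k $ l))"

definition dual_skew_matrices :: "(nat \<Rightarrow> 'n::finite) \<Rightarrow> real \<Rightarrow> (real^'n^'n) set" where
  "dual_skew_matrices b s = {M \<in> skew_matrices. hodge_matrix b M = s *\<^sub>R M}"

lemma linear_hodge_matrix: "linear (hodge_matrix b)"
  by (rule linearI; simp add: hodge_matrix_def vec_eq_iff algebra_simps sum.distrib sum_distrib_left)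

lemma subspace_dual_skew_matrices: "subspace (dual_skew_matrices b s)"
proof -
  have "dual_skew_matrices b s = skew_matrices \<inter> {M. hodge_matrix b M = s *\<^sub>R M}"
    by (auto simp: dual_skew_matrices_def)
  then show ?thesis
    by (simp add: subspace_inter subspace_skew_matrices subspace_linear_eq linear_hodge_matrix
        linear_scale_self)
qed

text \<open>\<open>One_nat_def\<close> is removed so that \<open>b 1\<close> keeps the form in which
  the index facts are stated and does not become \<open>b (Suc 0)\<close>.\<close>

context
  fixes b :: "nat \<Rightarrow> 'n::finite"
  assumes b: "bij_betw b {..<4} (UNIV :: 'n set)"
  notes One_nat_def [simp del]
begin

abbreviation volume :: "real^'n \<Rightarrow> real^'n \<Rightarrow> real^'n \<Rightarrow> real^'n \<Rightarrow> real" where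
  "volume \<equiv> volume4 b"

lemma enum4_inv: "m < 4 \<Longrightarrow> inv_into {..<4} b (b m) = m"
  using b by (intro inv_into_f_f) (auto simp: bij_betw_def)

lemma enum4_range: "\<exists>m<4. r = b m"
  using b unfolding bij_betw_def by blast

lemma nat_less_4_iff: "m < 4 \<longleftrightarrow> m = 0 \<or> m = 1 \<or> m = 2 \<or> m = (3::nat)"
  by auto

lemma enum4_distinct:
  "b 0 \<noteq> b 1" "b 0 \<noteq> b 2" "b 0 \<noteq> b 3" "b 1 \<noteq> b 2" "b 1 \<noteq> b 3" "b 2 \<noteq> b 3"
  "b 1 \<noteq> b 0" "b 2 \<noteq> b 0" "b 3 \<noteq> b 0" "b 2 \<noteq> b 1" "b 3 \<noteq> b 1" "b 3 \<noteq> b 2"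
  using inj_on_eq_iff[OF bij_betw_imp_inj_on[OF b]] by simp_all

lemma enum4_cases: "r = b 0 \<or> r = b 1 \<or> r = b 2 \<or> r = b 3"
  using enum4_range[of r] by (auto simp: nat_less_4_iff)

lemma enum4_sum: "(\<Sum>k\<in>UNIV. g k) = g (b 0) + g (b 1) + g (b 2) + g (b 3)"
proof -
  have "(\<Sum>k\<in>UNIV. g k) = (\<Sum>m<4. g (b m))"
    by (rule sum.reindex_bij_betw[OF b, symmetric])
  moreover have "{..<4} = {0, 1, 2, 3::nat}" by auto
  ultimately show ?thesis by (simp add: add.assoc)
qed

text \<open>Brings the update of one list position into the \<open>if\<close> shape in which
  linearity of the determinant in a row is stated.\<close>

lemma volume_row:
  assumes "m < 4" "length xs = 4"
  shows "det (\<chi> r. xs[m := v] ! inv_into {..<4} b r)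
      = det (\<chi> r. if r = b m then v else xs ! inv_into {..<4} b r)"
proof -
  have "xs[m := v] ! inv_into {..<4} b r = (if r = b m then v else xs ! inv_into {..<4} b r)" for r
    using assms enum4_range[of r] by (auto simp: enum4_inv nth_list_update)
  then show ?thesis by simp
qed

lemma linear_volume_row:
  assumes "m < 4" "length xs = 4"
  shows "linear (\<lambda>v :: real^'n. det (\<chi> r. xs[m := v] ! inv_into {..<4} b r))"
  unfolding volume_row[OF assms]
proof (rule linearI)
  show "det (\<chi> r. if r = b m then c *\<^sub>R v else xs ! inv_into {..<4} b r)
      = c *\<^sub>R det (\<chi> r. if r = b m then v else xs ! inv_into {..<4} b r)" for c and v :: "real^'n"
    using det_row_mul[of "b m" c "\<lambda>_. v" "\<lambda>r. xs ! inv_into {..<4} b r"]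
    by (simp only: scalar_mult_eq_scaleR real_scaleR_def)
qed (simp add: det_row_add)

lemma linear_volume:
  "linear (\<lambda>v. volume v x1 x2 x3)" "linear (\<lambda>v. volume x0 v x2 x3)"
  "linear (\<lambda>v. volume x0 x1 v x3)" "linear (\<lambda>v. volume x0 x1 x2 v)"
  using linear_volume_row[of 0 "[0, x1, x2, x3]"] linear_volume_row[of 1 "[x0, 0, x2, x3]"]
    linear_volume_row[of 2 "[x0, x1, 0, x3]"] linear_volume_row[of 3 "[x0, x1, x2, 0]"]
  by (simp_all add: volume4_def eval_nat_numeral One_nat_def)

lemma volume_alternating:
  "volume x x y z = 0" "volume x y y z = 0" "volume x y z z = 0"
proof -
  have *: "det (\<chi> r. xs ! inv_into {..<4} b r) = 0"
    if "m < 4" "k < 4" "m \<noteq> k" "xs ! m = xs ! k" for m k and xs :: "(real^'n) list"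
    using that enum4_distinct b
    by (intro det_identical_rows[of "b m" "b k"])
        (auto simp: enum4_inv row_def bij_betw_def inj_on_def vec_nth_inverse)
  show "volume x x y z = 0" "volume x y y z = 0" "volume x y z z = 0"
    unfolding volume4_def using *[of 0 1] *[of 1 2] *[of 2 3] by simp_all
qed

text \<open>Polarisation: a multilinear alternating form vanishes when a sum of two vectors is
  repeated, and only the two mixed terms of the expansion remain.\<close>

lemma volume_swap:
  "volume y x z w = - volume x y z w" "volume x z y w = - volume x y z w"
      "volume x y w z = - volume x y z w"
proof -
  note add = linear_add[OF linear_volume(1)] linear_add[OF linear_volume(2)]
    linear_add[OF linear_volume(3)] linear_add[OF linear_volume(4)]
  show "volume y x z w = - volume x y z w"
    using volume_alternating(1)[of "x + y" z w] unfolding add by (simp add: volume_alternating)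
  show "volume x z y w = - volume x y z w"
    using volume_alternating(2)[of x "y + z" w] unfolding add by (simp add: volume_alternating)
  show "volume x y w z = - volume x y z w"
    using volume_alternating(3)[of x y "z + w"] unfolding add by (simp add: volume_alternating)
qed

lemma volume_repeated:
  "volume x y x z = 0" "volume x y z x = 0" "volume x y z y = 0"
  using volume_swap(2)[of x x y z] volume_swap(3)[of x y x z] volume_swap(3)[of x y y z]
    volume_swap(2)[of x x y z]
  by (simp_all add: volume_alternating)

lemma volume_basis: "volume (axis (b 0) 1) (axis (b 1) 1) (axis (b 2) 1) (axis (b 3) 1) = 1"
proof -
  have "[axis (b 0) 1, axis (b 1) 1, axis (b 2) 1, axis (b 3) 1] ! inv_into {..<4} b r
      = axis r (1::real)" for r
    using enum4_cases[of r] by (elim disjE) (simp_all add: enum4_inv)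
  then have "volume (axis (b 0) 1) (axis (b 1) 1) (axis (b 2) 1) (axis (b 3) 1)
      = det (mat 1 :: real^'n^'n)"
    unfolding volume4_def by (intro arg_cong[of _ _ det]) (simp add: vec_eq_iff axis_def mat_def)
  then show ?thesis by simp
qed

text \<open>For each of the six positions above the diagonal these are the two orders of the
  complementary indices, reached from \<open>volume_basis\<close> by adjacent
  transpositions.\<close>

lemma volume_permuted_basis:
  defines "e \<equiv> \<lambda>m. axis (b m) (1::real)"
  shows "volume (e 0) (e 1) (e 2) (e 3) = 1" "volume (e 0) (e 1) (e 3) (e 2) = -1"
    "volume (e 0) (e 2) (e 1) (e 3) = -1" "volume (e 0) (e 2) (e 3) (e 1) = 1"
    "volume (e 0) (e 3) (e 1) (e 2) = 1" "volume (e 0) (e 3) (e 2) (e 1) = -1"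
    "volume (e 1) (e 2) (e 0) (e 3) = 1" "volume (e 1) (e 2) (e 3) (e 0) = -1"
    "volume (e 1) (e 3) (e 0) (e 2) = -1" "volume (e 1) (e 3) (e 2) (e 0) = 1"
    "volume (e 2) (e 3) (e 0) (e 1) = 1" "volume (e 2) (e 3) (e 1) (e 0) = -1"
proof -
  show 1: "volume (e 0) (e 1) (e 2) (e 3) = 1" by (simp add: e_def volume_basis)
  show 2: "volume (e 0) (e 1) (e 3) (e 2) = -1" by (subst volume_swap(3)) (simp add: 1)
  show 3: "volume (e 0) (e 2) (e 1) (e 3) = -1" by (subst volume_swap(2)) (simp add: 1)
  show 4: "volume (e 0) (e 2) (e 3) (e 1) = 1" by (subst volume_swap(3)) (simp add: 3)
  show 5: "volume (e 0) (e 3) (e 1) (e 2) = 1" by (subst volume_swap(2)) (simp add: 2)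
  show 6: "volume (e 0) (e 3) (e 2) (e 1) = -1" by (subst volume_swap(3)) (simp add: 5)
  have 7: "volume (e 1) (e 0) (e 2) (e 3) = -1" by (subst volume_swap(1)) (simp add: 1)
  show 8: "volume (e 1) (e 2) (e 0) (e 3) = 1" by (subst volume_swap(2)) (simp add: 7)
  show "volume (e 1) (e 2) (e 3) (e 0) = -1" by (subst volume_swap(3)) (simp add: 8)
  have 9: "volume (e 1) (e 0) (e 3) (e 2) = 1" by (subst volume_swap(1)) (simp add: 2)
  show 10: "volume (e 1) (e 3) (e 0) (e 2) = -1" by (subst volume_swap(2)) (simp add: 9)
  show "volume (e 1) (e 3) (e 2) (e 0) = 1" by (subst volume_swap(3)) (simp add: 10)
  have 11: "volume (e 2) (e 0) (e 3) (e 1) = -1" by (subst volume_swap(1)) (simp add: 4)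
  show 12: "volume (e 2) (e 3) (e 0) (e 1) = 1" by (subst volume_swap(2)) (simp add: 11)
  show "volume (e 2) (e 3) (e 1) (e 0) = -1" by (subst volume_swap(3)) (simp add: 12)
qed

lemma hodge_matrix_entries:
  "hodge_matrix b M $ b 0 $ b 1 = (M $ b 2 $ b 3 - M $ b 3 $ b 2) / 2"
  "hodge_matrix b M $ b 0 $ b 2 = (M $ b 3 $ b 1 - M $ b 1 $ b 3) / 2"
  "hodge_matrix b M $ b 0 $ b 3 = (M $ b 1 $ b 2 - M $ b 2 $ b 1) / 2"
  "hodge_matrix b M $ b 1 $ b 2 = (M $ b 0 $ b 3 - M $ b 3 $ b 0) / 2"
  "hodge_matrix b M $ b 1 $ b 3 = (M $ b 2 $ b 0 - M $ b 0 $ b 2) / 2"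
  "hodge_matrix b M $ b 2 $ b 3 = (M $ b 0 $ b 1 - M $ b 1 $ b 0) / 2"
  by (simp_all add: hodge_matrix_def enum4_sum volume_alternating volume_repeated volume_permuted_basis
     )

lemma hodge_matrix_skew: "hodge_matrix b M \<in> skew_matrices"
proof -
  have "hodge_matrix b M $ j $ i = - hodge_matrix b M $ i $ j" for i j
    by (simp add: hodge_matrix_def volume_swap(1)[of "axis j 1" "axis i 1"] sum_negf)
  then show ?thesis by (rule skewI)
qed

lemma skew_eqI:
  assumes M: "M \<in> skew_matrices" and N: "N \<in> skew_matrices"
    and "M $ b 0 $ b 1 = N $ b 0 $ b 1" "M $ b 0 $ b 2 = N $ b 0 $ b 2" "M $ b 0 $ b 3 = N $ b 0 $ b 3"
    "M $ b 1 $ b 2 = N $ b 1 $ b 2" "M $ b 1 $ b 3 = N $ b 1 $ b 3" "M $ b 2 $ b 3 = N $ b 2 $ b 3"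
  shows "M = N"
proof -
  have diag: "M $ r $ r = N $ r $ r" for r
    using skew_entry[OF M, of r r] skew_entry[OF N, of r r] by simp
  have flip: "M $ c $ r = N $ c $ r" if "M $ r $ c = N $ r $ c" for r c
    using that skew_entry[OF M, of r c] skew_entry[OF N, of r c] by simp
  have "M $ r $ c = N $ r $ c" for r c
    using enum4_cases[of r] enum4_cases[of c]
    by (elim disjE) (simp_all only: diag assms(3-8) assms(3-8)[THEN flip])
  then show ?thesis by (simp add: vec_eq_iff)
qed

lemma hodge_matrix_entries_skew:
  assumes "M \<in> skew_matrices"
  shows "hodge_matrix b M $ b 0 $ b 1 = M $ b 2 $ b 3" "hodge_matrix b M $ b 0 $ b 2 = - M $ b 1 $ b 3"
    "hodge_matrix b M $ b 0 $ b 3 = M $ b 1 $ b 2" "hodge_matrix b M $ b 1 $ b 2 = M $ b 0 $ b 3"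
    "hodge_matrix b M $ b 1 $ b 3 = - M $ b 0 $ b 2" "hodge_matrix b M $ b 2 $ b 3 = M $ b 0 $ b 1"
proof -
  note flip = skew_entry[OF assms, of "b 1" "b 0"] skew_entry[OF assms, of "b 2" "b 0"]
      skew_entry[OF assms, of "b 3" "b 0"]
    skew_entry[OF assms, of "b 2" "b 1"] skew_entry[OF assms, of "b 3" "b 1"]
        skew_entry[OF assms, of "b 3" "b 2"]
  show "hodge_matrix b M $ b 0 $ b 1 = M $ b 2 $ b 3" "hodge_matrix b M $ b 0 $ b 2 = - M $ b 1 $ b 3"
    "hodge_matrix b M $ b 0 $ b 3 = M $ b 1 $ b 2" "hodge_matrix b M $ b 1 $ b 2 = M $ b 0 $ b 3"
    "hodge_matrix b M $ b 1 $ b 3 = - M $ b 0 $ b 2" "hodge_matrix b M $ b 2 $ b 3 = M $ b 0 $ b 1"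
    unfolding hodge_matrix_entries flip by simp_all
qed

lemma hodge_matrix_involution:
  assumes "M \<in> skew_matrices"
  shows "hodge_matrix b (hodge_matrix b M) = M"
  by (rule skew_eqI[OF hodge_matrix_skew assms])
     (simp_all add: hodge_matrix_entries_skew hodge_matrix_skew assms)

text \<open>On skew matrices the star is an involution, so the space splits into its two
  eigenspaces.\<close>

lemma internal_direct_sum_dual_skew:
  "internal_direct_sum skew_matrices (dual_skew_matrices b) {1, -1}"
  unfolding internal_direct_sum_iff[OF finite.insertI[OF finite.insertI[OF finite.emptyI]]]
proof (intro conjI ballI allI impI)
  show "subspace (skew_matrices :: (real^'n^'n) set)" by (rule subspace_skew_matrices)
  show "subspace (dual_skew_matrices b s)" "dual_skew_matrices b s \<subseteq> skew_matrices" for s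
    by (auto simp: subspace_dual_skew_matrices) (auto simp: dual_skew_matrices_def)
next
  fix M :: "real^'n^'n" assume M: "M \<in> skew_matrices"
  note lin = linear_add[OF linear_hodge_matrix] linear_scale[OF linear_hodge_matrix]
  \<comment> \<open>For a sign \<open>s\<close> this is the projection onto the eigenspace of the
    star with eigenvalue \<open>s\<close>.\<close>
  define f where "f s = (1/2) *\<^sub>R (M + s *\<^sub>R hodge_matrix b M)" for s
  have "f s \<in> skew_matrices" for s
    unfolding f_def by (intro subspace_scale subspace_add subspace_skew_matrices M hodge_matrix_skew)
  then have "f s \<in> dual_skew_matrices b s" if "s * s = 1" for s
    using that by (simp add: dual_skew_matrices_def f_def lin hodge_matrix_involution[OF M]
        algebra_simps)
  then have "\<forall>i\<in>{1, - 1}. f i \<in> dual_skew_matrices b i" by auto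
  moreover have "M = sum f {1, -1}"
    by (simp add: f_def algebra_simps flip: scaleR_add_left)
  ultimately show "\<exists>f. (\<forall>i\<in>{1, - 1}. f i \<in> dual_skew_matrices b i) \<and> M = sum f {1, - 1}"
    by blast
next
  fix f :: "real \<Rightarrow> real^'n^'n" and i
  assume f: "\<forall>i\<in>{1, - 1}. f i \<in> dual_skew_matrices b i" "sum f {1, - 1} = 0" and i: "i \<in> {1, -1::real}"
  have sum: "f 1 + f (-1) = 0" using f(2) by simp
  have h: "hodge_matrix b (f 1) = f 1" "hodge_matrix b (f (-1)) = - f (-1)"
    using f(1) by (simp_all add: dual_skew_matrices_def)
  have "hodge_matrix b (f 1 + f (-1)) = 0"
    by (simp add: sum linear_0[OF linear_hodge_matrix])
  then have "f 1 - f (-1) = 0"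
    by (simp add: linear_add[OF linear_hodge_matrix] h)
  then have "f 1 = 0 \<and> f (-1) = 0"
    using sum by (simp add: eq_neg_iff_add_eq_0 flip: scaleR_2)
  then show "f i = 0" using i by auto
qed

text \<open>Applying \<open>A\<close> to every row multiplies the matrix of rows by
  \<open>transpose A\<close>, which has determinant 1.\<close>

lemma volume_rotation:
  assumes "rotation_matrix A"
  shows "volume (A *v x0) (A *v x1) (A *v x2) (A *v x3) = volume x0 x1 x2 x3"
proof -
  have "[A *v x0, A *v x1, A *v x2, A *v x3] ! inv_into {..<4} b r
      = A *v ([x0, x1, x2, x3] ! inv_into {..<4} b r)" for r
    using enum4_cases[of r] by (elim disjE) (simp_all add: enum4_inv)
  then have "volume (A *v x0) (A *v x1) (A *v x2) (A *v x3)
      = det ((\<chi> r. [x0, x1, x2, x3] ! inv_into {..<4} b r) ** transpose A)"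
    unfolding volume4_def by (intro arg_cong[of _ _ det])
      (simp add: vec_eq_iff matrix_matrix_mult_def matrix_vector_mult_def transpose_def mult.commute)
  then show ?thesis
    using assms by (simp add: det_mul det_transpose rotation_matrix_def volume4_def)
qed

lemma bilinear_form_expand:
  fixes B :: "real^'n \<Rightarrow> real^'n \<Rightarrow> real"
  assumes l: "\<And>y. linear (\<lambda>x. B x y)" and r: "\<And>x. linear (B x)"
  shows "B u v = (\<Sum>k\<in>UNIV. \<Sum>l\<in>UNIV. u $ k * (v $ l * B (axis k 1) (axis l 1)))"
proof -
  have expand: "x = (\<Sum>k\<in>UNIV. x $ k *\<^sub>R axis k 1)" for x :: "real^'n"
    by (simp add: basis_expansion flip: scalar_mult_eq_scaleR)
  have "B u v = B (\<Sum>k\<in>UNIV. u $ k *\<^sub>R axis k 1) (\<Sum>l\<in>UNIV. v $ l *\<^sub>R axis l 1)"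
    by (simp only: expand[symmetric])
  then show ?thesis
    unfolding linear_sum[OF l] linear_scale[OF l] unfolding linear_sum[OF r] linear_scale[OF r]
    by (simp add: sum_distrib_left)
qed

text \<open>By multilinearity the double sum in the Hodge star may be taken over any rotated basis.\<close>

lemma hodge_matrix_congruence:
  assumes A: "rotation_matrix A"
  shows "hodge_matrix b (congruence A M) = congruence A (hodge_matrix b M)"
proof -
  \<comment> \<open>\<open>T x y N\<close> extends twice the star of \<open>N\<close> from basis
    vectors to arbitrary arguments.\<close>
  define T where "T x y N = (\<Sum>k\<in>UNIV. \<Sum>l\<in>UNIV. volume x y (axis k 1) (axis l 1) * N $ k $ l)"
    for x y and N :: "real^'n^'n"
  have linT: "linear (\<lambda>x. T x y N)" "linear (\<lambda>y. T x y N)" "linear (T x y)" for x y N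
    unfolding T_def
    by (rule linearI; simp add: linear_add[OF linear_volume(1)] linear_scale[OF linear_volume(1)]
        linear_add[OF linear_volume(2)] linear_scale[OF linear_volume(2)] algebra_simps
            sum.distrib sum_distrib_left)+
  have T_outer: "T x y (outer u v) = volume x y u v" for x y u v
    by (subst bilinear_form_expand[OF linear_volume(3,4)]) (simp add: T_def outer_def ac_simps)
  \<comment> \<open>By linearity in the matrix it suffices to treat outer products, on which
    \<open>T\<close> is the volume form itself.\<close>
  have T_rot: "T (A *v x) (A *v y) (congruence A M) = T x y M" for x y
  proof -
    have eq: "T (A *v x) (A *v y) (congruence A (outer u v)) = T x y (outer u v)" for u v
      by (simp add: congruence_outer T_outer volume_rotation[OF A])
    show ?thesis
      by (subst (1 2) matrix_expand[of M, symmetric])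
         (simp only: linear_sum[OF linear_congruence] congruence_scale linear_sum[OF linT(3)]
             linear_scale[OF linT(3)] eq)
  qed
  have hodge: "hodge_matrix b N $ i $ j = 1/2 * T (axis i 1) (axis j 1) N" for N i j
    by (simp add: hodge_matrix_def T_def)
  \<comment> \<open>Row \<open>i\<close> of \<open>A\<close> is the vector that \<open>A\<close>
    sends to the axis of \<open>i\<close>, so inserting rows into \<open>T_rot\<close> evaluates the
    star of the rotated matrix on the standard basis.\<close>
  have AA: "A *v (A $ i) = axis i 1" for i
  proof -
    have "A $ i = transpose A *v axis i 1"
      unfolding matrix_vector_mult_basis by (simp add: column_def transpose_def vec_eq_iff)
    then have "A *v (A $ i) = (A ** transpose A) *v axis i 1"
      by (simp only: matrix_vector_mul_assoc)
    then show ?thesis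
      using A by (simp add: rotation_matrix_def orthogonal_matrix_def)
  qed
  have "hodge_matrix b (congruence A M) $ i $ j = congruence A (hodge_matrix b M) $ i $ j" for i j
  proof -
    have "hodge_matrix b (congruence A M) $ i $ j = 1/2 * T (A $ i) (A $ j) M"
      using T_rot[of "A $ i" "A $ j"] by (simp add: hodge AA)
    also have "\<dots> = congruence A (hodge_matrix b M) $ i $ j"
      by (subst bilinear_form_expand[OF linT(1,2)])
         (simp add: hodge congruence_entry inner_vec_def matrix_vector_mult_def sum_distrib_left
             ac_simps)
    finally show ?thesis .
  qed
  then show ?thesis by (simp add: vec_eq_iff)
qed

lemma dual_skew_invariant:
  assumes "rotation_matrix A" "M \<in> dual_skew_matrices b s"
  shows "congruence A M \<in> dual_skew_matrices b s"
  using assms by (simp add: dual_skew_matrices_def skew_matrices_def hodge_matrix_congruence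
      congruence_scale
      transpose_congruence linear_neg[OF linear_congruence])

text \<open>For \<open>m\<close> among 1, 2, 3 this is the wedge of \<open>b 0\<close> and
  \<open>b m\<close> plus \<open>s\<close> times its star. The star of the wedge of
  \<open>b 0\<close> and \<open>b 2\<close> is the wedge of \<open>b 3\<close> and
  \<open>b 1\<close>, whence the minus sign; the last branch stands for 3.\<close>

definition dual_basis :: "real \<Rightarrow> nat \<Rightarrow> real^'n^'n" where
  "dual_basis s m = (if m = 1 then wedge (b 0) (b 1) + s *\<^sub>R wedge (b 2) (b 3)
     else if m = 2 then wedge (b 0) (b 2) - s *\<^sub>R wedge (b 1) (b 3)
     else wedge (b 0) (b 3) + s *\<^sub>R wedge (b 1) (b 2))"

lemma dual_basis_skew: "dual_basis s m \<in> skew_matrices"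
  by (simp add: dual_basis_def wedge_skew subspace_add subspace_diff subspace_scale
      subspace_skew_matrices)

context
  fixes s :: real
  assumes s: "s = 1 \<or> s = -1"
begin

lemma sign_square: "s * s = 1" using s by auto

lemma dual_basis_mem: "dual_basis s m \<in> dual_skew_matrices b s"
proof -
  have "hodge_matrix b (dual_basis s m) = s *\<^sub>R dual_basis s m"
    using enum4_distinct
    by (intro skew_eqI hodge_matrix_skew subspace_scale subspace_skew_matrices dual_basis_skew)
       (simp_all add: hodge_matrix_entries dual_basis_def wedge_entry sign_square)
  then show ?thesis by (simp add: dual_skew_matrices_def dual_basis_skew)
qed

text \<open>The eigenvalue equation determines the entries away from \<open>b 0\<close> by those in
  the row of \<open>b 0\<close>.\<close>

lemma dual_skew_expand:
  assumes "M \<in> dual_skew_matrices b s"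
  shows "M = M $ b 0 $ b 1 *\<^sub>R dual_basis s 1 + M $ b 0 $ b 2 *\<^sub>R dual_basis s 2
      + M $ b 0 $ b 3 *\<^sub>R dual_basis s 3"
    (is "M = ?R")
proof (rule skew_eqI)
  show skew: "M \<in> skew_matrices" using assms by (simp add: dual_skew_matrices_def)
  show "?R \<in> skew_matrices"
    by (intro subspace_add subspace_scale subspace_skew_matrices dual_basis_skew)
  have h: "s * M $ r $ c = hodge_matrix b M $ r $ c" for r c
    using assms by (simp add: dual_skew_matrices_def)
  have flip: "M $ b 3 $ b 2 = - M $ b 2 $ b 3" "M $ b 3 $ b 1 = - M $ b 1 $ b 3"
      "M $ b 2 $ b 1 = - M $ b 1 $ b 2"
    by (rule skew_entry[OF skew])+
  have "s * M $ b 0 $ b 1 = M $ b 2 $ b 3" "s * M $ b 0 $ b 2 = - M $ b 1 $ b 3"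
      "s * M $ b 0 $ b 3 = M $ b 1 $ b 2"
    unfolding h hodge_matrix_entries flip by simp_all
  then show "M $ b 0 $ b 1 = ?R $ b 0 $ b 1" "M $ b 0 $ b 2 = ?R $ b 0 $ b 2"
      "M $ b 0 $ b 3 = ?R $ b 0 $ b 3"
    "M $ b 1 $ b 2 = ?R $ b 1 $ b 2" "M $ b 1 $ b 3 = ?R $ b 1 $ b 3" "M $ b 2 $ b 3 = ?R $ b 2 $ b 3"
    using enum4_distinct by (simp_all add: dual_basis_def wedge_entry mult.commute)
qed

lemma dual_skew_eq_span: "dual_skew_matrices b s = span (dual_basis s ` {1, 2, 3})"
proof (intro equalityI span_minimal subsetI)
  show "subspace (dual_skew_matrices b s)" by (rule subspace_dual_skew_matrices)
  fix M assume M: "M \<in> dual_skew_matrices b s"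
  show "M \<in> span (dual_basis s ` {1, 2, 3})"
    by (subst dual_skew_expand[OF M]) (intro span_add span_scale span_base imageI; simp)
qed (auto simp: dual_basis_mem)

lemma dim_dual_skew_matrices: "dim (dual_skew_matrices b s) = 3"
proof -
  \<comment> \<open>A wedge has squared norm 2, and two orthogonal wedges with coefficients of
    square 1 give 4.\<close>
  have inner: "dual_basis s k \<bullet> dual_basis s l = (if k = l then 4 else 0)" if "k \<in> {1, 2, 3}"
      "l \<in> {1, 2, 3}" for k l
    using that enum4_distinct
    by (auto simp: dual_basis_def inner_wedge inner_add_left inner_add_right inner_diff_left
        inner_diff_right
        wedge_entry sign_square)
  have inj: "inj_on (dual_basis s) {1, 2, 3}"
  proof (rule inj_onI)
    fix k l :: nat assume "k \<in> {1, 2, 3}" "l \<in> {1, 2, 3}" "dual_basis s k = dual_basis s l"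
    then show "k = l" using inner[of k k] inner[of k l] by (auto split: if_splits)
  qed
  have "pairwise orthogonal (dual_basis s ` {1, 2, 3})"
    unfolding pairwise_image using inner by (auto simp: pairwise_def orthogonal_def)
  moreover have "0 \<notin> dual_basis s ` {1, 2, 3}"
    using inner by force
  ultimately have "independent (dual_basis s ` {1, 2, 3})"
    by (rule pairwise_orthogonal_independent)
  then have "dim (span (dual_basis s ` {1, 2, 3})) = card (dual_basis s ` {1, 2, 3})"
    unfolding dim_span by (rule dim_eq_card_independent)
  then show ?thesis
    unfolding dual_skew_eq_span card_image[OF inj] by simp
qed

text \<open>The half turn in the plane of \<open>b 0\<close> and \<open>b m\<close> fixes
  \<open>dual_basis s m\<close> and negates the other two basis elements, so half turns isolate one
  of them. Quarter turns among \<open>b 1\<close>, \<open>b 2\<close>, \<open>b 3\<close> then move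
  it to the others up to sign.\<close>

lemma dual_skew_subset:
  assumes W: "subspace W" and inv: "\<And>A M. rotation_matrix A \<Longrightarrow> M \<in> W \<Longrightarrow> congruence A M \<in> W"
    and sub: "W \<subseteq> dual_skew_matrices b s" and M: "M \<in> W" "M \<noteq> 0"
  shows "dual_skew_matrices b s \<subseteq> W"
proof -
  have rot: "congruence (plane_rot i j t) N \<in> W" if "i \<noteq> j" "N \<in> W" for i j t N
    by (rule inv[OF rotation_plane_rot[OF that(1)] that(2)])
  have expand: "M = M $ b 0 $ b 1 *\<^sub>R dual_basis s 1 + M $ b 0 $ b 2 *\<^sub>R dual_basis s 2
      + M $ b 0 $ b 3 *\<^sub>R dual_basis s 3"
    using dual_skew_expand sub M by blast
  have outer_minus: "outer (- u) v = - outer u v" "outer u (- v) = - outer u v" for u v :: "real^'n"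
    by (simp_all add: outer_def vec_eq_iff)
  have half: "congruence (plane_rot (b 0) (b m) pi) (dual_basis s k)
      = (if k = m then 1 else -1) *\<^sub>R dual_basis s k"
    if "m \<in> {1, 2, 3}" "k \<in> {1, 2, 3}" for m k
  proof -
    have "congruence (plane_rot (b 0) (b m) pi) (dual_basis s k) $ x $ y
        = ((if k = m then 1 else -1) *\<^sub>R dual_basis s k) $ x $ y" for x y
      using that enum4_cases[of x] enum4_cases[of y] enum4_distinct
      by (elim disjE insertE emptyE) (simp_all add: congruence_half_turn dual_basis_def wedge_entry)
    then show ?thesis by (simp add: vec_eq_iff)
  qed
  have two: "(2 * c) *\<^sub>R N = c *\<^sub>R N + c *\<^sub>R N" for c and N :: "real^'n^'n"
    by (simp flip: scaleR_add_left)
  have coeff: "(2 * M $ b 0 $ b m) *\<^sub>R dual_basis s m \<in> W" if m: "m \<in> {1, 2, 3}" for m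
  proof -
    have "b 0 \<noteq> b m" using m enum4_distinct by auto
    then have "M + congruence (plane_rot (b 0) (b m) pi) M \<in> W"
      by (intro subspace_add[OF W] M rot)
    also have "M + congruence (plane_rot (b 0) (b m) pi) M = (2 * M $ b 0 $ b m) *\<^sub>R dual_basis s m"
      by (subst (1 2) expand) (use m in \<open>auto simp: congruence_add congruence_scale half two\<close>)
    finally show ?thesis .
  qed
  have "\<exists>m\<in>{1, 2, 3}. M $ b 0 $ b m \<noteq> 0"
  proof (rule ccontr)
    assume "\<not> ?thesis"
    then have "M = 0" by (subst expand) simp
    then show False using M by simp
  qed
  then obtain m where m: "m \<in> {1, 2, 3}" "M $ b 0 $ b m \<noteq> 0" by blast
  have base: "dual_basis s m \<in> W"
    using subspace_scale[OF W coeff[OF m(1)], of "inverse (2 * M $ b 0 $ b m)"] m(2)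
    by (simp del: inverse_mult_distrib)
  have quarter:
    "congruence (plane_rot (b 1) (b 2) (pi/2)) (dual_basis s 1) = dual_basis s 2"
    "congruence (plane_rot (b 1) (b 2) (pi/2)) (dual_basis s 2) = - dual_basis s 1"
    "congruence (plane_rot (b 2) (b 3) (pi/2)) (dual_basis s 2) = dual_basis s 3"
    "congruence (plane_rot (b 2) (b 3) (pi/2)) (dual_basis s 3) = - dual_basis s 2"
    using enum4_distinct
    by (simp_all add: dual_basis_def wedge_def congruence_add congruence_diff congruence_scale
        congruence_outer
        plane_rot_axis outer_minus scaleR_diff_right)
  have neg: "- N \<in> W \<Longrightarrow> N \<in> W" for N
    using subspace_neg[OF W, of "- N"] by simp
  have "dual_basis s 1 \<in> W \<Longrightarrow> dual_basis s 2 \<in> W" "dual_basis s 2 \<in> W \<Longrightarrow> dual_basis s 3 \<in> W"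
    "dual_basis s 2 \<in> W \<Longrightarrow> dual_basis s 1 \<in> W" "dual_basis s 3 \<in> W \<Longrightarrow> dual_basis s 2 \<in> W"
    using rot[OF enum4_distinct(4), of _ "pi/2"] rot[OF enum4_distinct(6), of _ "pi/2"] quarter
        neg by metis+
  then have "dual_basis s k \<in> W" if "k \<in> {1, 2, 3}" for k
    using base m(1) that by auto
  then show ?thesis
    unfolding dual_skew_eq_span by (intro span_minimal W) auto
qed

end

end

section \<open>The standard actions of the similarity group\<close>

lemma Sim0E:
  assumes "g \<in> Sim0"
  obtains a A \<xi> where "g = sim_matrix a A \<xi>" "a > 0" "rotation_matrix A"
  using assms unfolding Sim0_def by blast

lemma CO0_subset_Sim0: "CO0 \<subseteq> Sim0"
  unfolding CO0_def Sim0_def by blast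

lemma CO0_one: "mat 1 \<in> CO0"
  unfolding CO0_def mem_Collect_eq
  by (rule exI[of _ 1], rule exI[of _ "mat 1"])
     (simp add: sim_matrix_one rotation_matrix_def orthogonal_matrix_id)

lemma rotation_matrix_mult:
  "rotation_matrix A \<Longrightarrow> rotation_matrix B \<Longrightarrow> rotation_matrix (A ** B :: real^'n^'n)"
  by (simp add: rotation_matrix_def orthogonal_matrix_mul det_mul)

lemma rotation_matrix_orthogonal: "rotation_matrix A \<Longrightarrow> orthogonal_matrix A"
  by (simp add: rotation_matrix_def)

lemma CO0_mult:
  assumes "g \<in> CO0" "h \<in> CO0"
  shows "g ** h \<in> CO0"
proof -
  obtain a A b B where
    *: "g = sim_matrix a A 0" "h = sim_matrix b B 0" "a > 0" "b > 0" "rotation_matrix A"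
        "rotation_matrix B"
    using assms unfolding CO0_def by blast
  then have "g ** h = sim_matrix (a * b) (A ** B) 0" "a * b > 0" "rotation_matrix (A ** B)"
    by (simp_all add: sim_matrix_mult rotation_matrix_orthogonal rotation_matrix_mult)
  then show ?thesis unfolding CO0_def by blast
qed

lemma scale_part_pos: "g \<in> Sim0 \<Longrightarrow> scale_part g > 0"
  by (auto elim!: Sim0E)

lemma rot_part_rotation: "g \<in> Sim0 \<Longrightarrow> rotation_matrix (rot_part g)"
  by (auto elim!: Sim0E)

lemma parts_mult:
  assumes "g \<in> Sim0" "h \<in> Sim0"
  shows scale_part_mult: "scale_part (g ** h) = scale_part g * scale_part h"
    and rot_part_mult: "rot_part (g ** h) = rot_part g ** rot_part h"
proof -
  obtain a A \<xi> where g: "g = sim_matrix a A \<xi>" "a > 0" "rotation_matrix A"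
    using assms(1) by (rule Sim0E)
  obtain b B \<eta> where h: "h = sim_matrix b B \<eta>" "b > 0" "rotation_matrix B"
    using assms(2) by (rule Sim0E)
  have "g ** h = sim_matrix (a * b) (A ** B) (\<xi> v* B + inverse a *\<^sub>R \<eta>)"
    using g h by (simp add: sim_matrix_mult rotation_matrix_orthogonal)
  then show "scale_part (g ** h) = scale_part g * scale_part h"
      "rot_part (g ** h) = rot_part g ** rot_part h"
    by (simp_all add: g h)
qed

lemma parts_one [simp]: "scale_part (mat 1) = 1" "rot_part (mat 1) = mat 1"
  by (simp_all flip: sim_matrix_one)

section \<open>Model actions on vectors and matrices\<close>

text \<open>The parameter \<xi> is ignored, yet this is an action of all of \<open>Sim0\<close>,
  because \<open>scale_part\<close> and \<open>rot_part\<close> are multiplicative there. One model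
  thus serves both groups.\<close>

definition vector_act :: "real \<Rightarrow> real^('n::finite idx)^('n idx) \<Rightarrow> real^'n \<Rightarrow> real^'n" where
  "vector_act w g v = scale_part g powr w *\<^sub>R (rot_part g *v v)"

definition matrix_act :: "real \<Rightarrow> real^('n::finite idx)^('n idx) \<Rightarrow> real^'n^'n \<Rightarrow> real^'n^'n" where
  "matrix_act w g M = scale_part g powr w *\<^sub>R congruence (rot_part g) M"

lemma linear_vector_act: "linear (vector_act w g)"
  unfolding vector_act_def by (intro linear_compose_scale_right matrix_vector_mul_linear)

lemma linear_matrix_act: "linear (matrix_act w g)"
  unfolding matrix_act_def by (intro linear_compose_scale_right linear_congruence)

lemma is_module_vector_act: "is_module Sim0 (vector_act w) UNIV"
proof (rule is_moduleI)
  show "vector_act w (g ** h) x = vector_act w g (vector_act w h x)" if "g \<in> Sim0" "h \<in> Sim0" for g h x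
    using that scale_part_pos[of g] scale_part_pos[of h]
    by (simp add: vector_act_def scale_part_mult rot_part_mult powr_mult matrix_vector_mul_assoc
        matrix_vector_mult_scaleR)
qed (simp_all add: linear_vector_act vector_act_def)

lemma is_module_matrix_act:
  assumes "subspace U" and inv: "\<And>A M. rotation_matrix A \<Longrightarrow> M \<in> U \<Longrightarrow> congruence A M \<in> U"
  shows "is_module Sim0 (matrix_act w) U"
proof (rule is_moduleI)
  show "matrix_act w g M \<in> U" if "g \<in> Sim0" "M \<in> U" for g M
    using that assms(1) by (simp add: matrix_act_def subspace_scale inv rot_part_rotation)
  show "matrix_act w (g ** h) M = matrix_act w g (matrix_act w h M)" if "g \<in> Sim0" "h \<in> Sim0" for g h M
    using that scale_part_pos[of g] scale_part_pos[of h]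
    by (simp add: matrix_act_def scale_part_mult rot_part_mult powr_mult congruence_mult
        congruence_scale)
qed (simp_all add: linear_matrix_act matrix_act_def assms(1), simp add: congruence_def)

lemma rotation_mem_CO0: "rotation_matrix A \<Longrightarrow> sim_matrix 1 A 0 \<in> CO0"
  unfolding CO0_def mem_Collect_eq by (rule exI[of _ 1], rule exI[of _ A]) simp

lemma irreducible_vector_act: "irreducible_module CO0 (vector_act w) (UNIV :: (real^'n) set)"
  unfolding irreducible_module_def
proof (intro conjI allI impI)
  show "is_module CO0 (vector_act w) UNIV"
    by (rule is_module_mono[OF is_module_vector_act CO0_subset_Sim0])
  show "(UNIV :: (real^'n) set) \<noteq> {0}"
  proof
    assume "(UNIV :: (real^'n) set) = {0}"
    then have "axis undefined 1 = (0 :: real^'n)" by blast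
    then show False by (simp add: axis_eq_0_iff)
  qed
  fix W :: "(real^'n) set"
  assume W: "is_module CO0 (vector_act w) W"
  show "W = {0} \<or> W = UNIV"
  proof (cases "W = {0}")
    case False
    then obtain v where v: "v \<in> W" "v \<noteq> 0"
      using subspace_0[OF is_module_subspace[OF W]] by blast
    have "A *v x \<in> W" if "rotation_matrix A" "x \<in> W" for A x
      using is_module_closed[OF W rotation_mem_CO0[OF that(1)] that(2)] by (simp add: vector_act_def)
    then have "W = UNIV"
      using rotation_invariant_subspace_UNIV[OF is_module_subspace[OF W] _ v] by blast
    then show ?thesis ..
  qed simp
qed

text \<open>Elements with a = 1 realise every rotation without a scale factor, so submodules are
  rotation invariant whatever the weight. The premise \<open>min\<close> says that each nonzero
  element of \<open>U\<close> generates it under rotations.\<close>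

lemma irreducible_matrix_act:
  assumes U: "subspace U" "\<And>A M. rotation_matrix A \<Longrightarrow> M \<in> U \<Longrightarrow> congruence A M \<in> U" "U \<noteq> {0}"
    and min: "\<And>W M. subspace W \<Longrightarrow> (\<And>A M. rotation_matrix A \<Longrightarrow> M \<in> W \<Longrightarrow> congruence A M \<in> W) \<Longrightarrow>
      W \<subseteq> U \<Longrightarrow> M \<in> W \<Longrightarrow> M \<noteq> 0 \<Longrightarrow> U \<subseteq> W"
  shows "irreducible_module CO0 (matrix_act w) U"
  unfolding irreducible_module_def
proof (intro conjI allI impI)
  show "is_module CO0 (matrix_act w) U"
    by (rule is_module_mono[OF is_module_matrix_act[OF U(1,2)] CO0_subset_Sim0])
  show "U \<noteq> {0}" by (rule U(3))
  fix W
  assume sub: "W \<subseteq> U" and W: "is_module CO0 (matrix_act w) W"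
  show "W = {0} \<or> W = U"
  proof (cases "W = {0}")
    case False
    then obtain M where M: "M \<in> W" "M \<noteq> 0"
      using subspace_0[OF is_module_subspace[OF W]] by blast
    have "congruence A N \<in> W" if "rotation_matrix A" "N \<in> W" for A N
      using is_module_closed[OF W rotation_mem_CO0[OF that(1)] that(2)] by (simp add: matrix_act_def)
    then have "U \<subseteq> W"
      using min[OF is_module_subspace[OF W] _ sub M] by blast
    then show ?thesis using sub by blast
  qed simp
qed

lemma skew_invariant: "rotation_matrix A \<Longrightarrow> M \<in> skew_matrices \<Longrightarrow> congruence A M \<in> skew_matrices"
  by (simp add: skew_matrices_def transpose_congruence linear_neg[OF linear_congruence])

lemma sym_tracefree_invariant:
  "rotation_matrix A \<Longrightarrow> M \<in> sym_tracefree_matrices \<Longrightarrow> congruence A M \<in> sym_tracefree_matrices"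
  by (simp add: sym_tracefree_matrices_def transpose_congruence trace_congruence
      rotation_matrix_orthogonal)

definition scalar_matrices :: "(real^'n^'n) set" where
  "scalar_matrices = range (\<lambda>r. r *\<^sub>R mat 1)"

lemma congruence_identity: "orthogonal_matrix A \<Longrightarrow> congruence A (mat 1) = mat 1"
  by (simp add: congruence_def orthogonal_matrix_def)

lemma scalar_invariant: "rotation_matrix A \<Longrightarrow> M \<in> scalar_matrices \<Longrightarrow> congruence A M \<in> scalar_matrices"
  by (auto simp: scalar_matrices_def congruence_scale congruence_identity rotation_matrix_orthogonal)

lemma subspace_scalar_matrices: "subspace scalar_matrices"
  unfolding scalar_matrices_def span_singleton[symmetric] by simp

lemma mat_1_nonzero: "mat 1 \<noteq> (0 :: real^'n^'n)"
  by (simp add: vec_eq_iff mat_def)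

lemma irreducible_scalar: "irreducible_module CO0 (matrix_act w) (scalar_matrices :: (real^'n^'n) set)"
proof (rule irreducible_matrix_act)
  have "mat 1 \<in> (scalar_matrices :: (real^'n^'n) set)"
    unfolding scalar_matrices_def by (rule range_eqI[of _ _ 1]) simp
  then show "(scalar_matrices :: (real^'n^'n) set) \<noteq> {0}"
    using mat_1_nonzero by blast
  fix W and M :: "real^'n^'n"
  assume W: "subspace W" "W \<subseteq> scalar_matrices" and M: "M \<in> W" "M \<noteq> 0"
  then obtain c where c: "M = c *\<^sub>R mat 1" unfolding scalar_matrices_def by blast
  then have "c \<noteq> 0" using M by auto
  then have "r *\<^sub>R mat 1 \<in> W" for r
    using subspace_scale[OF W(1) M(1), of "r / c"] by (simp add: c)
  then show "scalar_matrices \<subseteq> W" by (auto simp: scalar_matrices_def)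
qed (auto intro: subspace_scalar_matrices scalar_invariant)

lemma irreducible_skew:
  "CARD('n) \<noteq> 4 \<Longrightarrow> (skew_matrices :: (real^'n^'n) set) \<noteq> {0} \<Longrightarrow>
    irreducible_module CO0 (matrix_act w) (skew_matrices :: (real^'n^'n) set)"
  by (rule irreducible_matrix_act[OF subspace_skew_matrices skew_invariant _ skew_subset])

lemma irreducible_sym_tracefree:
  "(sym_tracefree_matrices :: (real^'n^'n) set) \<noteq> {0} \<Longrightarrow>
    irreducible_module CO0 (matrix_act w) (sym_tracefree_matrices :: (real^'n^'n) set)"
  by (rule irreducible_matrix_act[OF subspace_sym_tracefree_matrices sym_tracefree_invariant _
      sym_tracefree_subset])

lemma irreducible_dual_skew:
  fixes b :: "nat \<Rightarrow> 'n::finite"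
  assumes b: "bij_betw b {..<4} (UNIV :: 'n set)" and s: "s = 1 \<or> s = -1"
  shows "irreducible_module CO0 (matrix_act w) (dual_skew_matrices b s)"
proof (rule irreducible_matrix_act)
  show "dual_skew_matrices b s \<noteq> {0}"
    using dim_dual_skew_matrices[OF b s] by force
qed (use subspace_dual_skew_matrices dual_skew_invariant[OF b] dual_skew_subset[OF b s] in blast)+

lemma internal_direct_sum_matrices:
  "internal_direct_sum UNIV (\<lambda>j :: nat. if j = 0 then scalar_matrices else if j = 1 then skew_matrices
     else sym_tracefree_matrices :: (real^'n^'n) set) {0, 1, 2}"
  (is "internal_direct_sum _ ?S _")
proof -
  let ?n = "real CARD('n)"
  note lin = linear_add[OF linear_transpose] linear_scale[OF linear_transpose]
      linear_diff[OF linear_transpose]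
    linear_add[OF linear_trace] linear_scale[OF linear_trace] linear_diff[OF linear_trace]
  have tr1: "trace (mat 1 :: real^'n^'n) = ?n" by (simp add: trace_def mat_def)
  have trT: "trace (transpose M) = trace M" for M :: "real^'n^'n" by (simp add: trace_def transpose_def)
  have n: "?n \<noteq> 0" by simp
  have fin: "finite {0, 1, 2 :: nat}" by simp
  have sum3: "sum f {0, 1, 2 :: nat} = f 0 + f 1 + f 2" for f :: "nat \<Rightarrow> real^'n^'n"
    by (simp add: add.assoc)
  show ?thesis
    unfolding internal_direct_sum_iff[OF fin] sum3
  proof (intro conjI ballI allI impI)
    show "subspace (?S j)" for j
      by (simp add: subspace_scalar_matrices subspace_skew_matrices subspace_sym_tracefree_matrices)
    fix M :: "real^'n^'n"
    define f where "f j = (if j = 0 then (trace M / ?n) *\<^sub>R mat 1 else if j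
        = 1 then (1/2) *\<^sub>R (M - transpose M)
      else (1/2) *\<^sub>R (M + transpose M) - (trace M / ?n) *\<^sub>R mat 1)" for j :: nat
    have "f 0 \<in> scalar_matrices" 
      unfolding f_def scalar_matrices_def by (simp only: if_True refl) (rule rangeI)
    moreover have "f 1 \<in> skew_matrices"
      by (simp add: f_def skew_matrices_def lin transpose_transpose scaleR_diff_right)
    moreover have "f 2 \<in> sym_tracefree_matrices"
      by (simp add: f_def sym_tracefree_matrices_def lin transpose_transpose transpose_mat tr1 trT
          add.commute)
    moreover have "(1/2) *\<^sub>R (M - transpose M) + (1/2) *\<^sub>R (M + transpose M) = M"
      by (simp add: scaleR_diff_right scaleR_add_right flip: scaleR_add_left)
    then have "M = f 0 + f 1 + f 2" by (simp add: f_def)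
    ultimately show "\<exists>f. (\<forall>i\<in>{0, 1, 2}. f i \<in> ?S i) \<and> M = f 0 + f 1 + f 2"
      by (intro exI[of _ f]) simp
  next
    fix f :: "nat \<Rightarrow> real^'n^'n" and i
    assume f: "\<forall>i\<in>{0, 1, 2}. f i \<in> ?S i" and sum: "f 0 + f 1 + f 2 = 0" and i: "i \<in> {0, 1, 2 :: nat}"
    have f0: "f 0 \<in> scalar_matrices" and f1: "transpose (f 1) = - f 1"
      and f2: "transpose (f 2) = f 2" "trace (f 2) = 0"
      using f by (simp_all add: skew_matrices_def sym_tracefree_matrices_def)
    obtain c where c: "f 0 = c *\<^sub>R mat 1" using f0 by (auto simp: scalar_matrices_def)
    \<comment> \<open>Skew and trace-free matrices have trace 0, so the trace isolates the scalar
      part; transposition then separates the other two.\<close>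
    have "trace (f 1) = 0" using trT[of "f 1"]
        by (simp add: f1 linear_neg[OF linear_trace] del: One_nat_def)
    then have "c * ?n = 0"
      using arg_cong[OF sum, of trace]
          by (simp add: lin f2 c tr1 linear_0[OF linear_trace] del: One_nat_def)
    then have 0: "f 0 = 0" using n by (simp add: c)
    then have s: "f 1 + f 2 = 0" using sum by simp
    then have "transpose (f 1 + f 2) = 0" by (simp only: linear_0[OF linear_transpose])
    then have "f 2 = f 1" unfolding lin f1 f2 by (simp del: One_nat_def)
    then have "f 1 = 0 \<and> f 2 = 0" using s by (simp del: One_nat_def flip: scaleR_2)
    then show "f i = 0" using i 0 by auto
  qed simp_all
qed

section \<open>Coordinates on the model modules\<close>

definition dual_coords :: "((real^'m) \<Rightarrow>\<^sub>L real) \<Rightarrow> real^'m" where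
  "dual_coords \<phi> = (\<chi> k. blinfun_apply \<phi> (axis k 1))"

lemma linear_dual_coords: "linear dual_coords"
  by (rule linearI; simp add: dual_coords_def vec_eq_iff blinfun.add_left blinfun.scaleR_left)

lemma inner_dual_coords: "dual_coords \<phi> \<bullet> v = blinfun_apply \<phi> (v :: real^'m)"
proof -
  have "v = (\<Sum>k\<in>UNIV. v $ k *\<^sub>R axis k 1)"
    by (simp add: basis_expansion flip: scalar_mult_eq_scaleR)
  then have "blinfun_apply \<phi> v = blinfun_apply \<phi> (\<Sum>k\<in>UNIV. v $ k *\<^sub>R axis k 1)" by simp
  then show ?thesis
    by (simp add: blinfun.sum_right blinfun.scaleR_right dual_coords_def inner_vec_def mult.commute)
qed

lemma dual_coords_inner_right [simp]: "dual_coords (blinfun_inner_right v) = v"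
  by (simp add: dual_coords_def vec_eq_iff inner_axis)

lemma bij_dual_coords: "bij dual_coords"
proof (rule bijI')
  show "dual_coords \<phi> = dual_coords \<psi> \<longleftrightarrow> \<phi> = \<psi>" for \<phi> \<psi> :: "(real^'m) \<Rightarrow>\<^sub>L real"
    by (metis blinfun_eqI inner_dual_coords)
  show "\<exists>\<phi>. v = dual_coords \<phi>" for v :: "real^'m"
    by (rule exI[of _ "blinfun_inner_right v"]) simp
qed

lemma dual_coords_act: "dual_coords (dual_act g \<phi>) = transpose (matrix_inv g) *v dual_coords \<phi>"
proof -
  have "dual_coords (dual_act g \<phi>) $ k = dual_coords \<phi> \<bullet> (matrix_inv g *v axis k 1)" for k
    by (simp add: dual_act_def dual_coords_def[of "_ o\<^sub>L _"] inner_dual_coords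
        bounded_linear_Blinfun_apply matrix_vector_mul_bounded_linear)
  then show ?thesis
    by (simp add: vec_eq_iff matrix_vector_mul_component matrix_vector_mult_basis inner_commute
        column_def transpose_def)
qed

lemma linear_dual_act: "linear (dual_act g)"
proof (rule linearI)
  note lin = linear_add[OF linear_dual_coords] linear_scale[OF linear_dual_coords]
  show "dual_act g (\<phi> + \<psi>) = dual_act g \<phi> + dual_act g \<psi>" for \<phi> \<psi>
    by (rule injD[OF bij_is_inj[OF bij_dual_coords]])
        (simp only: dual_coords_act lin matrix_vector_right_distrib)
  show "dual_act g (c *\<^sub>R \<phi>) = c *\<^sub>R dual_act g \<phi>" for c \<phi>
    by (rule injD[OF bij_is_inj[OF bij_dual_coords]])
        (simp only: dual_coords_act lin matrix_vector_mult_scaleR)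
qed

lemma matrix_inv_eqI:
  fixes A B :: "real^'m^'m"
  assumes "A ** B = mat 1"
  shows "matrix_inv A = B"
proof -
  show ?thesis
    unfolding matrix_inv_def
  proof (rule some_equality)
    show "A ** B = mat 1 \<and> B ** A = mat 1"
      using assms by (simp add: matrix_left_right_inverse)
    show "C = B" if "A ** C = mat 1 \<and> C ** A = mat 1" for C
      using that by (metis assms matrix_mul_assoc matrix_mul_lid matrix_mul_rid)
  qed
qed

lemma matrix_inv_rotation: "rotation_matrix A \<Longrightarrow> matrix_inv A = transpose (A :: real^'n^'n)"
  by (rule matrix_inv_eqI) (simp add: rotation_matrix_def orthogonal_matrix_def)

lemma linear_covec_act: "linear (covec_act g)"
  unfolding covec_act_def by (rule linear_dual_act)

lemma covec_embedding: "equivariant_embedding Sim0 covec_act (vector_act 0) dual_coords"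
proof (rule equivariant_embedding.intro)
  show "dual_coords (covec_act g \<phi>) = vector_act 0 g (dual_coords \<phi>)" if "g \<in> Sim0" for g \<phi>
    using scale_part_pos[OF that]
    by (simp add: covec_act_def dual_coords_act vector_act_def matrix_inv_rotation
        rot_part_rotation that transpose_transpose)
qed (auto simp: Sim0_one Sim0_mult linear_dual_coords bij_is_inj bij_dual_coords)

definition covec2_coords :: "'n::finite covec \<otimes> 'n covec \<Rightarrow> real^'n^'n" where
  "covec2_coords = tensor_coords dual_coords dual_coords"

lemma linear_covec2_coords: "linear covec2_coords"
  and bij_covec2_coords: "bij covec2_coords"
  and covec2_coords_pure: "covec2_coords (\<phi> \<otimes> \<psi>) = outer (dual_coords \<phi>) (dual_coords \<psi>)"
  by (simp_all add: covec2_coords_def linear_tensor_coords bij_tensor_coords tensor_coords_pure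
      linear_dual_coords
      bij_dual_coords outer_def)

lemma linear_covec2_act: "linear (covec2_act g)"
  unfolding covec2_act_def by (intro linear_tensor_map linear_covec_act)

lemma covec2_embedding: "equivariant_embedding Sim0 covec2_act (matrix_act 0) covec2_coords"
proof (rule equivariant_embedding.intro)
  show "covec2_coords (covec2_act g t) = matrix_act 0 g (covec2_coords t)" if g: "g \<in> Sim0" for g t
  proof (rule tensor_linear_eqI[of "\<lambda>t. covec2_coords (covec2_act g t)"
      "\<lambda>t. matrix_act 0 g (covec2_coords t)"])
    show "linear (\<lambda>t. covec2_coords (covec2_act g t))"
      using linear_compose[OF linear_covec2_act linear_covec2_coords] by (simp add: o_def)
    show "linear (\<lambda>t. matrix_act 0 g (covec2_coords t))"
      using linear_compose[OF linear_covec2_coords linear_matrix_act] by (simp add: o_def)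
    show "covec2_coords (covec2_act g (\<phi> \<otimes> \<psi>)) = matrix_act 0 g (covec2_coords (\<phi> \<otimes> \<psi>))" for \<phi> \<psi>
      using equivariant_embedding.equivariant[OF covec_embedding g] scale_part_pos[OF g]
      by (simp add: covec2_act_def tensor_map_pure linear_covec_act covec2_coords_pure matrix_act_def
          congruence_outer vector_act_def)
  qed
qed (auto simp: Sim0_one Sim0_mult linear_covec2_coords bij_is_inj bij_covec2_coords)

lemma absorb_scalar_twist:
  assumes "linear (\<rho> g)"
  shows "absorb_scalar (twist w \<rho> g t) = scale_part g powr w *\<^sub>R \<rho> g (absorb_scalar t)"
proof (rule tensor_linear_eqI[of "\<lambda>t. absorb_scalar (twist w \<rho> g t)"
    "\<lambda>t. scale_part g powr w *\<^sub>R \<rho> g (absorb_scalar t)"])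
  have lw: "linear (weight_act w g)"
    by (rule linearI) (simp_all add: weight_act_def algebra_simps)
  show "linear (\<lambda>t. absorb_scalar (twist w \<rho> g t))"
    using linear_compose[OF linear_tensor_map[OF assms lw] linear_absorb_scalar]
        by (simp add: o_def twist_def)
  show "linear (\<lambda>t. scale_part g powr w *\<^sub>R \<rho> g (absorb_scalar t))"
    using linear_compose[OF linear_absorb_scalar assms]
        by (intro linear_compose_scale_right) (simp add: o_def)
  show "absorb_scalar (twist w \<rho> g (x \<otimes> r)) = scale_part g powr w *\<^sub>R \<rho> g (absorb_scalar (x \<otimes> r))"
      for x r
    by (simp add: twist_def tensor_map_pure assms lw weight_act_def linear_scale[OF assms])
qed

text \<open>Absorbing the scalar factor multiplies the model action by
  \<open>scale_part g powr w\<close>; \<sigma>' names the result, in both uses the same family of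
  actions at weight \<open>w\<close>.\<close>

lemma twist_embedding:
  assumes F: "equivariant_embedding Sim0 \<rho> \<sigma> F" and \<rho>: "\<And>g. linear (\<rho> g)"
    and \<sigma>: "\<And>g x. g \<in> Sim0 \<Longrightarrow> scale_part g powr w *\<^sub>R \<sigma> g x = \<sigma>' g x"
  shows "equivariant_embedding Sim0 (twist w \<rho>) \<sigma>' (F \<circ> absorb_scalar)"
proof (rule equivariant_embedding.intro)
  interpret F: equivariant_embedding Sim0 \<rho> \<sigma> F by (fact F)
  show "linear (F \<circ> absorb_scalar)"
    by (rule linear_compose[OF linear_absorb_scalar F.linear_F])
  show "inj (F \<circ> absorb_scalar)"
    by (rule inj_compose[OF F.inj_F bij_is_inj[OF bij_absorb_scalar]])
  show "(F \<circ> absorb_scalar) (twist w \<rho> g t) = \<sigma>' g ((F \<circ> absorb_scalar) t)" if "g \<in> Sim0" for g t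
    by (simp add: absorb_scalar_twist \<rho> linear_scale[OF F.linear_F] F.equivariant that \<sigma>)
qed (auto simp: Sim0_one Sim0_mult)

lemma twist_covec_embedding:
  "equivariant_embedding Sim0 (twist w covec_act) (vector_act w) (dual_coords \<circ> absorb_scalar)"
  by (rule twist_embedding[OF covec_embedding linear_covec_act])
     (use scale_part_pos in \<open>force simp: vector_act_def\<close>)

lemma twist_covec2_embedding:
  "equivariant_embedding Sim0 (twist w covec2_act) (matrix_act w) (covec2_coords \<circ> absorb_scalar)"
  by (rule twist_embedding[OF covec2_embedding linear_covec2_act])
     (use scale_part_pos in \<open>force simp: matrix_act_def\<close>)

text \<open>Placing the one-dimensional module on the scalar matrices makes it comparable with the
  trace part of the matrix model.\<close>

lemma weight_embedding: "equivariant_embedding Sim0 (weight_act w) (matrix_act w) (\<lambda>r. r *\<^sub>R mat 1)"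
proof (rule equivariant_embedding.intro)
  show "inj (\<lambda>r. r *\<^sub>R mat 1 :: real^'n^'n)"
    using mat_1_nonzero by (auto intro!: injI)
qed (auto simp: Sim0_one Sim0_mult weight_act_def matrix_act_def congruence_scale congruence_identity
    rot_part_rotation rotation_matrix_orthogonal linear_iff algebra_simps)

lemma equivariant_embedding_CO0:
  "equivariant_embedding Sim0 \<rho> \<sigma> F \<Longrightarrow> equivariant_embedding CO0 \<rho> \<sigma> F"
  unfolding equivariant_embedding_def using CO0_one CO0_mult CO0_subset_Sim0 by blast

section \<open>Transposition, trace and Hodge star in coordinates\<close>

lemma covec2_coords_transpose:
  fixes t :: "'n::finite covec \<otimes> 'n covec"
  shows "covec2_coords (transpose_tensor t) = transpose (covec2_coords t)"
proof (rule tensor_linear_eqI[of "\<lambda>t. covec2_coords (transpose_tensor t)"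
    "\<lambda>t. transpose (covec2_coords t)"])
  have b: "bilinear (\<lambda>x y. y \<otimes> x :: 'n covec \<otimes> 'n covec)"
    using bilinear_tensor_pure unfolding bilinear_def by blast
  show "linear (\<lambda>t :: 'n covec \<otimes> 'n covec. covec2_coords (transpose_tensor t))"
    using linear_compose[OF linear_tensor_lift[OF b] linear_covec2_coords]
        by (simp add: o_def transpose_tensor_def)
  show "linear (\<lambda>t :: 'n covec \<otimes> 'n covec. transpose (covec2_coords t))"
    using linear_compose[OF linear_covec2_coords linear_transpose] by (simp add: o_def)
  show "covec2_coords (transpose_tensor (\<phi> \<otimes> \<psi>)) = transpose (covec2_coords (\<phi> \<otimes> \<psi>))"
      for \<phi> \<psi> :: "'n covec"
    by (simp add: transpose_tensor_def tensor_lift_pure[OF b] covec2_coords_pure outer_def transpose_def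
        vec_eq_iff mult.commute)
qed

lemma tensor_trace_eq:
  fixes t :: "'n::finite covec \<otimes> 'n covec"
  shows "tensor_trace t = trace (covec2_coords t)"
proof (rule tensor_linear_eqI[of tensor_trace "\<lambda>t. trace (covec2_coords t)"])
  have b: "bilinear (\<lambda>\<phi> \<psi>. \<Sum>i\<in>UNIV. blinfun_apply \<phi> (axis i 1) * blinfun_apply (\<psi> :: 'n covec)
      (axis i 1))"
    by (auto simp: bilinear_def linear_iff blinfun.add_left blinfun.scaleR_left algebra_simps
        sum.distrib sum_distrib_left)
  show "linear (tensor_trace :: 'n covec \<otimes> 'n covec \<Rightarrow> real)" unfolding tensor_trace_def
      by (rule linear_tensor_lift[OF b])
  show "linear (\<lambda>t :: 'n covec \<otimes> 'n covec. trace (covec2_coords t))"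
    using linear_compose[OF linear_covec2_coords linear_trace] by (simp add: o_def)
  show "tensor_trace (\<phi> \<otimes> \<psi>) = trace (covec2_coords (\<phi> \<otimes> \<psi>))" for \<phi> \<psi> :: "'n covec"
    by (simp add: tensor_trace_def tensor_lift_pure[OF b] covec2_coords_pure outer_def trace_def
        dual_coords_def)
qed

lemma tensor_eval_axis:
  fixes t :: "'n::finite covec \<otimes> 'n covec"
  shows "tensor_eval t (axis k 1) (axis l 1) = covec2_coords t $ k $ l"
proof (rule tensor_linear_eqI[of "\<lambda>t. tensor_eval t (axis k 1) (axis l 1)"
    "\<lambda>t. covec2_coords t $ k $ l"])
  have b: "bilinear (\<lambda>\<phi> \<psi>. blinfun_apply \<phi> (axis k 1) * blinfun_apply (\<psi> :: 'n covec) (axis l 1))"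
    by (auto simp: bilinear_def linear_iff blinfun.add_left blinfun.scaleR_left algebra_simps)
  show "linear (\<lambda>t. tensor_eval t (axis k 1) (axis l 1))"
    unfolding tensor_eval_def by (rule linear_tensor_lift[OF b])
  show "linear (\<lambda>t. covec2_coords t $ k $ l)"
    by (rule linearI) (simp_all add: linear_add[OF linear_covec2_coords]
        linear_scale[OF linear_covec2_coords])
  show "tensor_eval (\<phi> \<otimes> \<psi>) (axis k 1) (axis l 1) = covec2_coords (\<phi> \<otimes> \<psi>) $ k $ l" for \<phi> \<psi>
    by (simp add: tensor_eval_def tensor_lift_pure[OF b] covec2_coords_pure outer_def dual_coords_def)
qed

lemma covec2_coords_hodge: "covec2_coords (hodge_star b t) = hodge_matrix b (covec2_coords t)"
  by (subst matrix_expand[symmetric])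
     (simp add: hodge_star_def linear_sum[OF linear_covec2_coords] linear_scale[OF linear_covec2_coords]
       covec2_coords_pure hodge_matrix_def tensor_eval_axis)

lemma covec2_coords_eq_iff: "covec2_coords s = covec2_coords t \<longleftrightarrow> s = t"
  using bij_covec2_coords by (metis bij_is_inj injD)

lemma two_forms_vimage: "two_forms = covec2_coords -` skew_matrices"
  by (auto simp: two_forms_def skew_matrices_def linear_neg[OF linear_covec2_coords]
      simp flip: covec2_coords_eq_iff covec2_coords_transpose)

lemma sym_tracefree_vimage: "sym_tracefree = covec2_coords -` sym_tracefree_matrices"
  by (auto simp: sym_tracefree_def sym_tracefree_matrices_def tensor_trace_eq
      simp flip: covec2_coords_eq_iff covec2_coords_transpose)

lemma dual_two_forms_vimage: "dual_two_forms b s = covec2_coords -` dual_skew_matrices b s"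
  by (auto simp: dual_two_forms_def dual_skew_matrices_def two_forms_vimage
      simp flip: linear_scale[OF linear_covec2_coords] covec2_coords_hodge covec2_coords_eq_iff)

lemma tensor_sub_vimage:
  assumes "subspace U" "V = covec2_coords -` U"
  shows "tensor_sub V UNIV = (covec2_coords \<circ> absorb_scalar) -` U"
  using tensor_sub_eq_vimage_absorb[of V] linear_subspace_vimage[OF linear_covec2_coords assms(1)]
      assms(2)
  by (simp add: vimage_comp)

lemma tensor_sub_two_forms: "tensor_sub two_forms UNIV
    = (covec2_coords \<circ> absorb_scalar) -` skew_matrices"
  and tensor_sub_sym_tracefree:
    "tensor_sub sym_tracefree UNIV = (covec2_coords \<circ> absorb_scalar) -` sym_tracefree_matrices"
  and tensor_sub_dual_two_forms:
    "tensor_sub (dual_two_forms b s) UNIV = (covec2_coords \<circ> absorb_scalar) -` dual_skew_matrices b s"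
  by (rule tensor_sub_vimage; simp add: subspace_skew_matrices subspace_sym_tracefree_matrices
      subspace_dual_skew_matrices two_forms_vimage sym_tracefree_vimage dual_two_forms_vimage)+

lemma bij_covec2_absorb: "bij (covec2_coords \<circ> absorb_scalar)"
  by (rule bij_comp[OF bij_absorb_scalar bij_covec2_coords])

lemma bij_covec_absorb: "bij (dual_coords \<circ> absorb_scalar)"
  by (rule bij_comp[OF bij_absorb_scalar bij_dual_coords])

lemma linear_covec2_absorb: "linear (covec2_coords \<circ> absorb_scalar)"
  by (rule linear_compose[OF linear_absorb_scalar linear_covec2_coords])

lemma linear_covec_absorb: "linear (dual_coords \<circ> absorb_scalar)"
  by (rule linear_compose[OF linear_absorb_scalar linear_dual_coords])

section \<open>The quotient of the Lorentz algebra by the similarity algebra\<close>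

definition mid :: "real^('n::finite idx) \<Rightarrow> real^'n" where
  "mid x = (\<chi> i. x $ Mid i)"

lemma lorentz_form_mid: "lorentz_form x y = x $ First * y $ Last + x $ Last * y $ First + mid x \<bullet> mid y"
  by (simp add: lorentz_form_def mid_def inner_vec_def)

text \<open>In the middle component \<open>A\<close> is pulled out in front, so that its
  orthogonality cancels in inner products.\<close>

lemma sim_matrix_vector:
  shows sim_matrix_vector_First: "(sim_matrix a A \<xi> *v x) $ First = a * x $ First"
    and sim_matrix_vector_mid: "mid (sim_matrix a A \<xi> *v x) = A *v (mid x - (a * x $ First) *\<^sub>R \<xi>)"
    and sim_matrix_vector_Last:
      "(sim_matrix a A \<xi> *v x) $ Last = - (a / 2) * (\<xi> \<bullet> \<xi>) * x $ First + \<xi> \<bullet> mid x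
          + inverse a * x $ Last"
proof -
  show "(sim_matrix a A \<xi> *v x) $ First = a * x $ First"
    by (simp add: sim_matrix_def matrix_vector_mult_def sum_idx)
  show "(sim_matrix a A \<xi> *v x) $ Last = - (a / 2) * (\<xi> \<bullet> \<xi>) * x $ First + \<xi> \<bullet> mid x
      + inverse a * x $ Last"
    by (simp add: sim_matrix_def matrix_vector_mult_def sum_idx mid_def inner_vec_def)
  have "mid (sim_matrix a A \<xi> *v x) = A *v mid x - (a * x $ First) *\<^sub>R (A *v \<xi>)"
    by (simp add: vec_eq_iff mid_def sim_matrix_def matrix_vector_mult_def[of "\<chi> r c. _ r c"]
        matrix_vector_mult_def[of A "\<chi> i. x $ Mid i"] sum_idx)
  then show "mid (sim_matrix a A \<xi> *v x) = A *v (mid x - (a * x $ First) *\<^sub>R \<xi>)"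
    by (simp add: matrix_vector_mult_diff_distrib matrix_vector_mult_scaleR)
qed

lemma lorentz_form_Sim0:
  assumes "g \<in> Sim0"
  shows "lorentz_form (g *v x) (g *v y) = lorentz_form x y"
proof -
  obtain a A \<xi> where g: "g = sim_matrix a A \<xi>" "a > 0" "rotation_matrix A"
    using assms by (rule Sim0E)
  have A: "(A *v u) \<bullet> (A *v v) = u \<bullet> v" for u v
  proof -
    have "(A *v u) v* A = (transpose A ** A) *v u"
      by (simp only: matrix_vector_mul_assoc flip: transpose_matrix_vector)
    then show ?thesis
      using g(3) by (simp add: rotation_matrix_def orthogonal_matrix_def flip: dot_lmul_matrix)
  qed
  show ?thesis
    using g(2) unfolding g(1) lorentz_form_mid sim_matrix_vector A
    by (simp add: inner_diff_left inner_diff_right inner_commute[of "mid x" \<xi>]) (simp add: field_simps)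
qed

lemma sim_matrix_inv:
  assumes "a > 0" "rotation_matrix A"
  shows "matrix_inv (sim_matrix a A \<xi>) = sim_matrix (inverse a) (transpose A) (- a *\<^sub>R (A *v \<xi>))"
proof (rule matrix_inv_eqI)
  have "orthogonal_matrix (transpose A)" "A ** transpose A = mat 1"
    using assms(2) by (simp_all add: rotation_matrix_def orthogonal_matrix_transpose
        orthogonal_matrix_def)
  then show "sim_matrix a A \<xi> ** sim_matrix (inverse a) (transpose A) (- a *\<^sub>R (A *v \<xi>)) = mat 1"
    using assms(1) by (simp add: sim_matrix_mult sim_matrix_one[symmetric])
qed

lemma Sim0_inv:
  assumes "g \<in> Sim0"
  shows "matrix_inv g \<in> Sim0" "g ** matrix_inv g = mat 1" "matrix_inv g ** g = mat 1"
proof -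
  obtain a A \<xi> where g: "g = sim_matrix a A \<xi>" "a > 0" "rotation_matrix A"
    using assms by (rule Sim0E)
  have rot: "rotation_matrix (transpose A)"
    using g(3) by (simp add: rotation_matrix_def orthogonal_matrix_transpose)
  then show "matrix_inv g \<in> Sim0"
    unfolding g(1) sim_matrix_inv[OF g(2,3)] Sim0_def using g(2) by fastforce
  show 1: "g ** matrix_inv g = mat 1"
    unfolding g(1) sim_matrix_inv[OF g(2,3)] using g(2,3) rot
    by (simp add: sim_matrix_mult sim_matrix_one[symmetric] rotation_matrix_def orthogonal_matrix_def)
  then show "matrix_inv g ** g = mat 1"
    by (simp add: matrix_left_right_inverse)
qed

lemma so_lorentz_conjugate:
  assumes g: "g \<in> Sim0" and X: "X \<in> so_lorentz"
  shows "g ** X ** matrix_inv g \<in> so_lorentz"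
proof -
  have "lorentz_form ((g ** X ** matrix_inv g) *v x) y
      + lorentz_form x ((g ** X ** matrix_inv g) *v y) = 0" for x y
  proof -
    define x' y' where "x' = matrix_inv g *v x" and "y' = matrix_inv g *v y"
    have xy: "x = g *v x'" "y = g *v y'"
      by (simp_all add: x'_def y'_def matrix_vector_mul_assoc Sim0_inv[OF g])
    have "(g ** X ** matrix_inv g) *v x = g *v (X *v x')"
        "(g ** X ** matrix_inv g) *v y = g *v (X *v y')"
      by (simp_all add: x'_def y'_def matrix_vector_mul_assoc matrix_mul_assoc)
    then show ?thesis
      using X by (simp add: so_lorentz_def xy lorentz_form_Sim0[OF g])
  qed
  then show ?thesis by (simp add: so_lorentz_def)
qed

lemma so_lorentz_entries:
  assumes "X \<in> so_lorentz"
  shows "X $ First $ Last = 0" "X $ Last $ First = 0" "X $ Last $ Last = - X $ First $ First"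
    "X $ First $ Mid i = - X $ Mid i $ Last" "X $ Mid i $ First = - X $ Last $ Mid i"
    "X $ Mid j $ Mid i = - X $ Mid i $ Mid j"
proof -
  have X: "lorentz_form (X *v x) y + lorentz_form x (X *v y) = 0" for x y
    using assms by (simp add: so_lorentz_def)
  have col: "(X *v axis c 1) $ r = X $ r $ c" for r c
    by (simp add: matrix_vector_mult_basis column_def)
  have l: "lorentz_form x (axis First 1) = x $ Last" "lorentz_form x (axis Last 1) = x $ First"
    "lorentz_form x (axis (Mid i) 1) = x $ Mid i" "lorentz_form (axis First 1) x = x $ Last"
    "lorentz_form (axis Last 1) x = x $ First" "lorentz_form (axis (Mid i) 1) x = x $ Mid i"
        for x and i :: 'a
    by (simp_all add: lorentz_form_def axis_def if_distrib[of "\<lambda>x. _ * x"]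
        if_distrib[of "\<lambda>x. x * _"] cong: if_cong)
  show "X $ First $ Last = 0" "X $ Last $ First = 0"
    using X[of "axis Last 1" "axis Last 1"] X[of "axis First 1" "axis First 1"] by (simp_all add: l col)
  show "X $ Last $ Last = - X $ First $ First" "X $ First $ Mid i = - X $ Mid i $ Last"
    "X $ Mid i $ First = - X $ Last $ Mid i" "X $ Mid j $ Mid i = - X $ Mid i $ Mid j"
    using X[of "axis First 1" "axis Last 1"] X[of "axis (Mid i) 1" "axis Last 1"]
      X[of "axis (Mid i) 1" "axis First 1"] X[of "axis (Mid i) 1" "axis (Mid j) 1"]
    by (simp_all add: l col eq_neg_iff_add_eq_0 add.commute)
qed

section \<open>Generators of the similarity algebra\<close>

definition mid_block :: "real^'n^'n \<Rightarrow> real^('n::finite idx)^('n idx)" where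
  "mid_block Z = (\<chi> r c. case r of Mid i \<Rightarrow> (case c of Mid j \<Rightarrow> Z $ i $ j | _ \<Rightarrow> 0) | _ \<Rightarrow> 0)"

lemma linear_mid_block: "linear mid_block"
  by (rule linearI; simp add: mid_block_def vec_eq_iff split: idx.split)

lemma lie_algebra_ofI:
  assumes "\<And>t. \<gamma> t \<in> G" "\<gamma> 0 = mat 1" "(\<gamma> has_vector_derivative X) (at (0::real))"
  shows "X \<in> lie_algebra_of G"
  using assms unfolding lie_algebra_of_def by blast

lemma wedge_mem_sim_algebra: "mid_block (wedge i j) \<in> sim_algebra"
proof (cases "i = j")
  case True
  then show ?thesis
    by (simp add: wedge_self linear_0[OF linear_mid_block] subspace_0 subspace_sim_algebra)
next
  case False
  \<comment> \<open>\<open>C\<close> projects onto the plane and \<open>S\<close> generates its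
    rotations up to sign; the path is affine in the cosine and sine of \<open>t\<close>, with
    derivative \<open>- S\<close> at 0.\<close>
  define C S where "C = mid_block (outer (axis i 1) (axis i 1) + outer (axis j 1) (axis j 1))"
    and "S = mid_block (wedge i j)"
  have path: "sim_matrix 1 (plane_rot i j t) 0 = (mat 1 - C) + (cos t *\<^sub>R C - sin t *\<^sub>R S)" for t
    using False unfolding vec_eq_iff
    by (auto simp: sim_matrix_def plane_rot_def mid_block_def C_def S_def wedge_def outer_def
        mat_def axis_def
        split: idx.split)
  have "- S \<in> lie_algebra_of Sim0"
  proof (rule lie_algebra_ofI)
    show "sim_matrix 1 (plane_rot i j t) 0 \<in> Sim0" for t
      using rotation_mem_CO0[OF rotation_plane_rot[OF False]] CO0_subset_Sim0 by blast
    show "sim_matrix 1 (plane_rot i j 0) 0 = mat 1"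
      by (simp add: plane_rot_0 sim_matrix_one)
    show "((\<lambda>t. sim_matrix 1 (plane_rot i j t) 0) has_vector_derivative - S) (at 0)"
      unfolding path by (auto intro!: derivative_eq_intros)
  qed
  then show ?thesis
    using subspace_neg[OF subspace_sim_algebra, of "- S"] by (simp add: sim_algebra_def S_def)
qed

lemma mid_block_mem_sim_algebra: "Z \<in> skew_matrices \<Longrightarrow> mid_block Z \<in> sim_algebra"
  by (subst skew_expand, assumption)
     (simp add: linear_sum[OF linear_mid_block] linear_scale[OF linear_mid_block] subspace_sum
         subspace_scale
       subspace_sim_algebra wedge_mem_sim_algebra)

definition scale_generator :: "real^('n::finite idx)^('n idx)" where
  "scale_generator = axis First (axis First 1) - axis Last (axis Last 1)"

lemma scale_generator_mem_sim_algebra: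
  "(scale_generator :: real^('n::finite idx)^('n idx)) \<in> sim_algebra"
  unfolding sim_algebra_def
proof (rule lie_algebra_ofI)
  let ?F = "axis First (axis First 1) :: real^('n idx)^('n idx)"
  let ?L = "axis Last (axis Last 1) :: real^('n idx)^('n idx)"
  have path: "sim_matrix (exp t) (mat 1) 0 = (mat 1 - ?F - ?L) + (exp t *\<^sub>R ?F + exp (- t) *\<^sub>R ?L)" for t
    unfolding vec_eq_iff by (auto simp: sim_matrix_def mat_def axis_def exp_minus split: idx.split)
  show "sim_matrix (exp t) (mat 1) 0 \<in> (Sim0 :: (real^('n idx)^('n idx)) set)" for t
    unfolding Sim0_def mem_Collect_eq
    by (rule exI[of _ "exp t"], rule exI[of _ "mat 1"], rule exI[of _ 0])
       (simp add: rotation_matrix_def orthogonal_matrix_id)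
  show "sim_matrix (exp 0) (mat 1) 0 = (mat 1 :: real^('n idx)^('n idx))"
    by (simp add: sim_matrix_one)
  show "((\<lambda>t. sim_matrix (exp t) (mat 1) 0) has_vector_derivative
      (scale_generator :: real^('n idx)^('n idx))) (at 0)"
    unfolding path scale_generator_def by (auto intro!: derivative_eq_intros)
qed

definition null_generator :: "real^'n \<Rightarrow> real^('n::finite idx)^('n idx)" where
  "null_generator \<xi> = (\<chi> r c. case r of First \<Rightarrow> 0
     | Mid i \<Rightarrow> (case c of First \<Rightarrow> - \<xi> $ i | _ \<Rightarrow> 0)
     | Last \<Rightarrow> (case c of Mid i \<Rightarrow> \<xi> $ i | _ \<Rightarrow> 0))"

lemma null_generator_mem_sim_algebra: "null_generator \<xi> \<in> sim_algebra"
  unfolding sim_algebra_def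
proof (rule lie_algebra_ofI)
  \<comment> \<open>Only the corner entry is quadratic in \<open>t\<close>, and it does not
    contribute to the derivative at 0.\<close>
  have path: "sim_matrix 1 (mat 1) (t *\<^sub>R \<xi>)
      = mat 1 + (t *\<^sub>R null_generator \<xi> + (t * t) *\<^sub>R axis Last (axis First (- (\<xi> \<bullet> \<xi>) / 2)))" for t
    unfolding vec_eq_iff sim_matrix_def matrix_vector_mul_lid
    by (auto simp: mat_def axis_def null_generator_def split: idx.split)
  show "sim_matrix 1 (mat 1) (t *\<^sub>R \<xi>) \<in> Sim0" for t
    unfolding Sim0_def mem_Collect_eq
    by (rule exI[of _ 1], rule exI[of _ "mat 1"], rule exI[of _ "t *\<^sub>R \<xi>"])
       (simp add: rotation_matrix_def orthogonal_matrix_id)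
  show "sim_matrix 1 (mat 1) (0 *\<^sub>R \<xi>) = mat 1"
    by (simp add: sim_matrix_one)
  show "((\<lambda>t. sim_matrix 1 (mat 1) (t *\<^sub>R \<xi>)) has_vector_derivative null_generator \<xi>) (at 0)"
    unfolding path by (auto intro!: derivative_eq_intros)
qed

text \<open>For \<open>X\<close> in \<open>so_lorentz\<close> these are the coordinates of X e_{n+1}
  modulo the null line: its \<open>First\<close> component vanishes and its \<open>Last\<close>
  component lies along the line.\<close>

definition null_entries :: "real^('n::finite idx)^('n idx) \<Rightarrow> real^'n" where
  "null_entries X = (\<chi> i. X $ Mid i $ Last)"

lemma linear_null_entries: "linear null_entries"
  by (rule linearI; simp add: null_entries_def vec_eq_iff)

text \<open>These entries vanish identically on \<open>Sim0\<close>, hence so do their derivatives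
  along any curve in it.\<close>

lemma null_entries_sim_algebra:
  fixes X :: "real^('n::finite idx)^('n idx)"
  assumes "X \<in> sim_algebra"
  shows "null_entries X = 0"
proof -
  obtain \<gamma> where \<gamma>: "\<And>t. \<gamma> t \<in> Sim0" "(\<gamma> has_vector_derivative X) (at (0::real))"
    using assms unfolding sim_algebra_def lie_algebra_of_def by blast
  have "bounded_linear (\<lambda>M :: real^('n idx)^('n idx). M $ Mid i $ Last)" for i :: 'n
    by (intro bounded_linear_compose[OF bounded_linear_vec_nth bounded_linear_vec_nth])
  then have "((\<lambda>t. \<gamma> t $ Mid i $ Last) has_vector_derivative X $ Mid i $ Last) (at 0)" for i
    using \<gamma>(2) by (rule bounded_linear.has_vector_derivative)
  moreover have "\<gamma> t $ Mid i $ Last = 0" for t i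
    using \<gamma>(1)[of t] by (auto elim!: Sim0E simp: sim_matrix_def)
  ultimately have "X $ Mid i $ Last = 0" for i
    using vector_derivative_unique_at[of "\<lambda>t. 0" "X $ Mid i $ Last" 0 0] by simp
  then show ?thesis by (simp add: null_entries_def vec_eq_iff)
qed

text \<open>The Lie algebra is given only through tangents to curves. One inclusion differentiates;
  the other decomposes \<open>X\<close> into scale, rotation and null generators, all obtained from
  explicit curves.\<close>

lemma sim_algebra_iff:
  assumes X: "X \<in> so_lorentz"
  shows "X \<in> sim_algebra \<longleftrightarrow> null_entries X = 0"
proof
  assume "null_entries X = 0"
  then have 0: "X $ Mid i $ Last = 0" for i by (simp add: null_entries_def vec_eq_iff)
  define Z where "Z = (\<chi> i j. X $ Mid i $ Mid j)"
  have "Z \<in> skew_matrices"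
    by (rule skewI) (simp add: Z_def so_lorentz_entries(6)[OF X, symmetric])
  moreover have "X = X $ First $ First *\<^sub>R scale_generator + mid_block Z
      + null_generator (\<chi> i. X $ Last $ Mid i)"
  proof -
    have "X $ r $ c = (X $ First $ First *\<^sub>R scale_generator + mid_block Z
        + null_generator (\<chi> i. X $ Last $ Mid i)) $ r $ c" for r c
      by (cases r; cases c) (simp_all add: so_lorentz_entries(1-5)[OF X] 0 Z_def scale_generator_def
        mid_block_def null_generator_def axis_def)
    then show ?thesis unfolding vec_eq_iff by iprover
  qed
  ultimately show "X \<in> sim_algebra"
    by (metis subspace_add subspace_scale subspace_sim_algebra scale_generator_mem_sim_algebra
        mid_block_mem_sim_algebra null_generator_mem_sim_algebra)
qed (rule null_entries_sim_algebra)

definition quotient_coords :: "'n::finite so_mod_sim \<Rightarrow> real^'n" where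
  "quotient_coords x = null_entries (rep_so_mod_sim x)"

lemma rep_so_mod_sim_mem: "rep_so_mod_sim x \<in> so_lorentz"
  and abs_rep_so_mod_sim: "abs_so_mod_sim (rep_so_mod_sim x) = x"
  using Quotient3_rep_reflp[OF Quotient3_so_mod_sim, of x]
      Quotient3_abs_rep[OF Quotient3_so_mod_sim, of x]
  by (simp_all add: subquotient_rel_def)

lemma so_rel_refl: "X \<in> so_lorentz \<Longrightarrow> subquotient_rel so_lorentz sim_algebra X X"
  by (rule subquotient_rel_refl[OF subspace_sim_algebra])

text \<open>The choice of representative is harmless: two of them differ by an element of
  \<open>sim_algebra\<close>, whose \<open>null_entries\<close> vanish.\<close>

lemma quotient_coords_abs:
  assumes "X \<in> so_lorentz"
  shows "quotient_coords (abs_so_mod_sim X) = null_entries X"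
proof -
  have "subquotient_rel so_lorentz sim_algebra (rep_so_mod_sim (abs_so_mod_sim X)) X"
    by (rule Quotient3_rep_abs[OF Quotient3_so_mod_sim so_rel_refl[OF assms]])
  then have "null_entries (rep_so_mod_sim (abs_so_mod_sim X) - X) = 0"
    by (intro null_entries_sim_algebra) (simp add: subquotient_rel_def)
  then show ?thesis
    by (simp add: quotient_coords_def linear_diff[OF linear_null_entries])
qed

lemma linear_quotient_coords: "linear (quotient_coords :: 'n::finite so_mod_sim \<Rightarrow> _)"
proof (rule linearI)
  note mem = rep_so_mod_sim_mem subspace_add[OF subspace_so_lorentz]
      subspace_scale[OF subspace_so_lorentz]
  show "quotient_coords (x + y) = quotient_coords x + quotient_coords y" for x y :: "'n so_mod_sim"
  proof -
    have "x + y = abs_so_mod_sim (rep_so_mod_sim x + rep_so_mod_sim y)"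
      using plus_so_mod_sim.abs_eq[OF so_rel_refl so_rel_refl, OF rep_so_mod_sim_mem
          rep_so_mod_sim_mem, of x y]
      by (simp add: abs_rep_so_mod_sim)
    then show ?thesis
      by (simp add: quotient_coords_abs mem linear_add[OF linear_null_entries])
         (simp add: quotient_coords_def)
  qed
  show "quotient_coords (c *\<^sub>R x) = c *\<^sub>R quotient_coords x" for c and x :: "'n so_mod_sim"
  proof -
    have "c *\<^sub>R x = abs_so_mod_sim (c *\<^sub>R rep_so_mod_sim x)"
      using scaleR_so_mod_sim.abs_eq[OF so_rel_refl, OF rep_so_mod_sim_mem, of c x]
      by (simp add: abs_rep_so_mod_sim)
    then show ?thesis
      by (simp add: quotient_coords_abs mem linear_scale[OF linear_null_entries])
         (simp add: quotient_coords_def)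
  qed
qed

lemma bij_quotient_coords: "bij (quotient_coords :: 'n::finite so_mod_sim \<Rightarrow> real^'n)"
proof (rule bijI)
  show "inj (quotient_coords :: 'n so_mod_sim \<Rightarrow> real^'n)"
    unfolding linear_injective_0[OF linear_quotient_coords]
  proof (intro allI impI)
    fix x :: "'n so_mod_sim" assume "quotient_coords x = 0"
    then have "rep_so_mod_sim x \<in> sim_algebra"
      by (simp add: quotient_coords_def sim_algebra_iff rep_so_mod_sim_mem)
    then have "subquotient_rel so_lorentz sim_algebra (rep_so_mod_sim x) 0"
      by (simp add: subquotient_rel_def rep_so_mod_sim_mem subspace_0 subspace_so_lorentz)
    then have "abs_so_mod_sim (rep_so_mod_sim x) = abs_so_mod_sim 0"
      by (rule Quotient3_rel_abs[OF Quotient3_so_mod_sim])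
    then show "x = 0" by (simp add: abs_rep_so_mod_sim zero_so_mod_sim.abs_eq)
  qed
  show "surj (quotient_coords :: 'n so_mod_sim \<Rightarrow> real^'n)"
  proof (rule surjI)
    fix v :: "real^'n"
    \<comment> \<open>An element of \<open>so_lorentz\<close> that sends e_{n+1} to
      \<open>v\<close>; skewness for the Lorentz form dictates its \<open>First\<close> row.\<close>
    define X where "X = (\<chi> r c. case r of First \<Rightarrow> (case c of Mid i \<Rightarrow> - v $ i | _ \<Rightarrow> 0)
      | Mid i \<Rightarrow> (case c of Last \<Rightarrow> v $ i | _ \<Rightarrow> 0) | Last \<Rightarrow> 0)"
    have "(X *v x) $ First = - (v \<bullet> mid x)" "(X *v x) $ Last = 0" "mid (X *v x) = (x $ Last) *\<^sub>R v" for x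
      by (simp_all add: X_def matrix_vector_mult_def sum_idx mid_def inner_vec_def sum_negf vec_eq_iff)
    then have "X \<in> so_lorentz"
      by (simp add: so_lorentz_def lorentz_form_mid inner_commute)
    then show "quotient_coords (abs_so_mod_sim X) = v"
      by (simp add: quotient_coords_abs) (simp add: null_entries_def X_def vec_eq_iff)
  qed
qed

lemma quotient_coords_adjoint:
  fixes g :: "real^('n::finite idx)^('n idx)"
  assumes g: "g \<in> Sim0"
  shows "quotient_coords (adjoint_act g x) = vector_act 1 g (quotient_coords x)"
proof -
  obtain a A \<xi> where h: "g = sim_matrix a A \<xi>" "a > 0" "rotation_matrix A"
    using g by (rule Sim0E)
  define X where "X = rep_so_mod_sim x"
  have X: "X \<in> so_lorentz" by (simp add: X_def rep_so_mod_sim_mem)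
  have inv: "matrix_inv g *v axis Last 1 = a *\<^sub>R axis Last 1"
  proof -
    have "(matrix_inv g *v axis Last 1) $ r = (a *\<^sub>R axis Last 1) $ r" for r
      unfolding h(1) sim_matrix_inv[OF h(2,3)] matrix_vector_mult_basis
      by (cases r) (simp_all add: column_def sim_matrix_def axis_def)
    then show ?thesis by (simp add: vec_eq_iff)
  qed
  have entries: "null_entries Y = mid (Y *v axis Last 1)" for Y :: "real^('n idx)^('n idx)"
    by (simp add: null_entries_def mid_def matrix_vector_mult_basis column_def)
  have "(g ** X ** matrix_inv g) *v axis Last 1 = g *v (a *\<^sub>R (X *v axis Last 1))"
    by (simp add: inv matrix_vector_mult_scaleR flip: matrix_vector_mul_assoc)
  \<comment> \<open>Without a \<open>First\<close> component the parameter \<xi> does not reach the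
    middle part of the image under \<open>g\<close>.\<close>
  moreover have "(X *v axis Last 1) $ First = 0"
    using so_lorentz_entries(1)[OF X] by (simp add: matrix_vector_mult_basis column_def)
  ultimately have "null_entries (g ** X ** matrix_inv g) = a *\<^sub>R (A *v null_entries X)"
    by (simp add: entries h(1) sim_matrix_vector_mid)
        (simp add: mid_def vec_eq_iff matrix_vector_mult_def sum_distrib_left ac_simps)
  moreover have "quotient_coords (adjoint_act g x) = null_entries (g ** X ** matrix_inv g)"
    unfolding adjoint_act_def X_def[symmetric]
        by (rule quotient_coords_abs[OF so_lorentz_conjugate[OF g X]])
  ultimately show ?thesis
    using h(2) by (simp add: quotient_coords_def X_def vector_act_def h(1))
qed

text \<open>\<open>adjoint_act\<close> uses chosen representatives, so its linearity is inherited
  from the coordinate model.\<close>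

lemma linear_adjoint_act:
  assumes "g \<in> Sim0"
  shows "linear (adjoint_act g)"
proof (rule linearI)
  note lin = linear_add[OF linear_quotient_coords] linear_scale[OF linear_quotient_coords]
    linear_add[OF linear_vector_act] linear_scale[OF linear_vector_act]
  show "adjoint_act g (x + y) = adjoint_act g x + adjoint_act g y" for x y
    by (rule injD[OF bij_is_inj[OF bij_quotient_coords]])
        (simp only: quotient_coords_adjoint[OF assms] lin)
  show "adjoint_act g (c *\<^sub>R x) = c *\<^sub>R adjoint_act g x" for c x
    by (rule injD[OF bij_is_inj[OF bij_quotient_coords]])
        (simp only: quotient_coords_adjoint[OF assms] lin)
qed

section \<open>The filtered module and its associated graded\<close>

definition GG_coords :: "'n::finite GG \<Rightarrow> real^'n^('n idx)" where
  "GG_coords = tensor_coords dual_coords quotient_coords"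

lemma linear_GG_coords: "linear (GG_coords :: 'n::finite GG \<Rightarrow> _)"
  and bij_GG_coords: "bij (GG_coords :: 'n::finite GG \<Rightarrow> _)"
  by (simp_all add: GG_coords_def linear_tensor_coords bij_tensor_coords linear_dual_coords
      bij_dual_coords
      linear_quotient_coords bij_quotient_coords)

text \<open>The inverse transpose of \<open>g\<close> mixes the rows, as on the dual space;
  \<open>vector_act 1\<close> acts inside each row, as on the quotient of the Lie algebras.\<close>

definition GG_coords_act :: "real^('n::finite idx)^('n idx) \<Rightarrow> real^'n^('n idx) \<Rightarrow> real^'n^('n idx)" where
  "GG_coords_act g M = (\<chi> k. vector_act 1 g (\<Sum>l\<in>UNIV. matrix_inv g $ l $ k *\<^sub>R M $ l))"

lemma linear_vec_lambda:
  assumes "\<And>k. linear (f k)"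
  shows "linear (\<lambda>x. \<chi> k. f k x)"
  by (rule linearI; simp add: vec_eq_iff linear_add[OF assms] linear_scale[OF assms])

lemma linear_GG_coords_act: "linear (GG_coords_act g)"
proof -
  have "linear (\<lambda>M :: real^'a^('a idx). \<Sum>l\<in>UNIV. matrix_inv g $ l $ k *\<^sub>R M $ l)" for k
    by (intro linear_compose_sum ballI linear_compose_scale_right bounded_linear.linear
        bounded_linear_vec_nth)
  then show ?thesis
    unfolding GG_coords_act_def[abs_def]
    by (intro linear_vec_lambda linear_compose[OF _ linear_vector_act, unfolded o_def])
qed

lemma GG_coords_equivariant:
  assumes g: "g \<in> Sim0"
  shows "GG_coords (GG_act g t) = GG_coords_act g (GG_coords t)"
proof (rule tensor_linear_eqI[of "\<lambda>t. GG_coords (GG_act g t)" "\<lambda>t. GG_coords_act g (GG_coords t)"])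
  note lin = linear_dual_act[of g] linear_adjoint_act[OF g]
  show "linear (\<lambda>t. GG_coords (GG_act g t))"
    using linear_compose[OF linear_tensor_map[OF lin] linear_GG_coords] by (simp add: o_def GG_act_def)
  show "linear (\<lambda>t. GG_coords_act g (GG_coords t))"
    using linear_compose[OF linear_GG_coords linear_GG_coords_act] by (simp add: o_def)
  fix \<phi> x
  have pure: "GG_coords (\<psi> \<otimes> y) $ k = dual_coords \<psi> $ k *\<^sub>R quotient_coords y" for \<psi> y k
    by (simp add: GG_coords_def tensor_coords_pure linear_dual_coords linear_quotient_coords vec_eq_iff)
  have "GG_coords (GG_act g (\<phi> \<otimes> x)) $ k = GG_coords_act g (GG_coords (\<phi> \<otimes> x)) $ k" for k
    by (simp add: GG_act_def tensor_map_pure lin pure quotient_coords_adjoint[OF g] dual_coords_act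
        GG_coords_act_def linear_sum[OF linear_vector_act] linear_scale[OF linear_vector_act]
        matrix_vector_mult_def transpose_def scaleR_sum_left del: transpose_matrix_vector)
  then show "GG_coords (GG_act g (\<phi> \<otimes> x)) = GG_coords_act g (GG_coords (\<phi> \<otimes> x))"
    by (simp add: vec_eq_iff)
qed

text \<open>\<open>matrix_inv g\<close> is block lower triangular, so a row receives contributions
  only from its own block and from later rows, which are assumed to vanish. There remain the
  diagonal blocks a, \<open>transpose A\<close> and 1/a for \<open>Last\<close>, \<open>Mid\<close>
  and \<open>First\<close>, each combined with the factor a of \<open>vector_act 1\<close>.\<close>

lemma GG_coords_act_rows:
  assumes g: "g \<in> Sim0"
  shows "GG_coords_act g M $ Last = vector_act 2 g (M $ Last)"
    and "M $ Last = 0 \<Longrightarrow> (\<chi> i. GG_coords_act g M $ Mid i) = matrix_act 1 g (\<chi> i. M $ Mid i)"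
    and "M $ Last = 0 \<Longrightarrow> (\<And>i. M $ Mid i = 0) \<Longrightarrow> GG_coords_act g M $ First = vector_act 0 g (M $ First)"
proof -
  obtain a A \<xi> where h: "g = sim_matrix a A \<xi>" "a > 0" "rotation_matrix A"
    using g by (rule Sim0E)
  have inv: "matrix_inv g = sim_matrix (inverse a) (transpose A) (- a *\<^sub>R (A *v \<xi>))"
    unfolding h(1) by (rule sim_matrix_inv[OF h(2,3)])
  have v: "vector_act 1 g v = a *\<^sub>R (A *v v)" "vector_act 0 g v = A *v v"
      "vector_act 2 g v = (a * a) *\<^sub>R (A *v v)" for v
    using h(2) by (simp_all add: vector_act_def h(1) power2_eq_square)
  show "GG_coords_act g M $ Last = vector_act 2 g (M $ Last)"
    by (simp add: GG_coords_act_def v inv sum_idx sim_matrix_def matrix_vector_mult_scaleR)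
  show "GG_coords_act g M $ First = vector_act 0 g (M $ First)" if "M $ Last = 0" "\<And>i. M $ Mid i = 0"
    using that h(2) by (simp add: GG_coords_act_def v inv sum_idx sim_matrix_def
        matrix_vector_mult_scaleR)
  show "(\<chi> i. GG_coords_act g M $ Mid i) = matrix_act 1 g (\<chi> i. M $ Mid i)" if "M $ Last = 0"
  proof -
    have "GG_coords_act g M $ Mid i $ j = matrix_act 1 g (\<chi> i. M $ Mid i) $ i $ j" for i j
    proof -
      have "GG_coords_act g M $ Mid i $ j = a * (\<Sum>k\<in>UNIV. A $ i $ k * (A *v M $ Mid k) $ j)"
        using that by (simp add: GG_coords_act_def v inv sum_idx sim_matrix_def transpose_def
            linear_sum[OF matrix_vector_mul_linear] linear_scale[OF matrix_vector_mul_linear])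
      also have "(\<Sum>k\<in>UNIV. A $ i $ k * (A *v M $ Mid k) $ j) = congruence A (\<chi> i. M $ Mid i) $ i $ j"
        by (simp add: congruence_entry inner_vec_def[of "A $ i"] matrix_vector_mul_component
            inner_commute)
      finally show ?thesis
        using h(2) by (simp add: matrix_act_def h(1))
    qed
    then show ?thesis by (simp add: vec_eq_iff)
  qed
qed

lemma is_module_GG_coords: "is_module Sim0 GG_coords_act (UNIV :: (real^'n^('n::finite idx)) set)"
proof (rule is_moduleI)
  have inv_one: "matrix_inv (mat 1) = (mat 1 :: real^('n idx)^('n idx))"
    by (rule matrix_inv_eqI) simp
  show "GG_coords_act (mat 1) M = M" for M :: "real^'n^('n idx)"
  proof -
    have "mat 1 $ l $ k *\<^sub>R M $ l = (if l = k then M $ l else 0)" for k l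
      by (simp add: mat_def)
    then have "(\<Sum>l\<in>UNIV. mat 1 $ l $ k *\<^sub>R M $ l) = M $ k" for k by simp
    then show ?thesis
      by (simp only: GG_coords_act_def inv_one is_module_one[OF is_module_vector_act UNIV_I]) simp
  qed
  fix g h :: "real^('n idx)^('n idx)" and M :: "real^'n^('n idx)"
  assume g: "g \<in> Sim0" and h: "h \<in> Sim0"
  have inv: "matrix_inv (g ** h) = matrix_inv h ** matrix_inv g"
    by (rule matrix_inv_eqI) (metis Sim0_inv(2)[OF g] Sim0_inv(2)[OF h] matrix_mul_assoc matrix_mul_rid)
  have vact: "vector_act 1 (g ** h) v = vector_act 1 g (vector_act 1 h v)" for v
    by (rule is_module_mult[OF is_module_vector_act g h UNIV_I])
  have "GG_coords_act (g ** h) M $ k = GG_coords_act g (GG_coords_act h M) $ k" for k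
  proof -
    have "(\<Sum>l\<in>UNIV. (matrix_inv h ** matrix_inv g) $ l $ k *\<^sub>R M $ l)
        = (\<Sum>l\<in>UNIV. \<Sum>p\<in>UNIV. matrix_inv g $ p $ k *\<^sub>R matrix_inv h $ l $ p *\<^sub>R M $ l)"
      by (simp add: matrix_matrix_mult_def scaleR_sum_left mult.commute)
    also have "\<dots> = (\<Sum>p\<in>UNIV. matrix_inv g $ p $ k *\<^sub>R (\<Sum>l\<in>UNIV. matrix_inv h $ l $ p *\<^sub>R M $ l))"
      by (subst sum.swap) (simp add: scaleR_sum_right)
    finally have e: "(\<Sum>l\<in>UNIV. (matrix_inv h ** matrix_inv g) $ l $ k *\<^sub>R M $ l)
        = (\<Sum>p\<in>UNIV. matrix_inv g $ p $ k *\<^sub>R (\<Sum>l\<in>UNIV. matrix_inv h $ l $ p *\<^sub>R M $ l))" .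
    show ?thesis
      unfolding GG_coords_act_def vec_lambda_beta inv vact e
      by (simp only: linear_sum[OF linear_vector_act[of 1 h]] linear_scale[OF linear_vector_act[of 1 h]])
  qed
  then show "GG_coords_act (g ** h) M = GG_coords_act g (GG_coords_act h M)"
    by (simp add: vec_eq_iff)
qed (simp_all add: linear_GG_coords_act)

lemma GG_embedding: "equivariant_embedding Sim0 GG_act GG_coords_act GG_coords"
  by (rule equivariant_embedding.intro)
     (simp_all add: Sim0_one Sim0_mult linear_GG_coords bij_is_inj bij_GG_coords GG_coords_equivariant)

lemma is_module_GG: "is_module Sim0 GG_act (UNIV :: 'n::finite GG set)"
  by (rule equivariant_embedding.is_module_pullback[OF GG_embedding])
     (simp add: bij_is_surj bij_GG_coords is_module_GG_coords)

lemma annihilator_null_line: "\<phi> \<in> annihilator null_line \<longleftrightarrow> dual_coords \<phi> $ Last = 0"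
  by (auto simp: annihilator_def null_line_def span_singleton dual_coords_def blinfun.scaleR_right)

lemma annihilator_null_line_perp:
  "\<phi> \<in> annihilator null_line_perp \<longleftrightarrow> dual_coords \<phi> $ Last = 0 \<and> (\<forall>i. dual_coords \<phi> $ Mid i = 0)"
proof -
  have perp: "x \<in> null_line_perp \<longleftrightarrow> x $ First = 0" for x :: "'a lorentz_space"
    by (auto simp: null_line_perp_def null_line_def span_singleton lorentz_form_def axis_def)
  show ?thesis
  proof
    assume "\<phi> \<in> annihilator null_line_perp"
    then show "dual_coords \<phi> $ Last = 0 \<and> (\<forall>i. dual_coords \<phi> $ Mid i = 0)"
      by (simp add: annihilator_def perp dual_coords_def axis_def)
  next
    assume "dual_coords \<phi> $ Last = 0 \<and> (\<forall>i. dual_coords \<phi> $ Mid i = 0)"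
    then show "\<phi> \<in> annihilator null_line_perp"
      by (auto simp: annihilator_def perp inner_dual_coords[symmetric] inner_vec_def sum_idx)
  qed
qed

text \<open>Annihilating e_{n+1} kills the last coordinate of a covector. The orthogonal space of
  the null line is cut out by a vanishing \<open>First\<close> component, so annihilating it leaves
  only the first coordinate.\<close>

lemma GG_filtration_iff:
  fixes t :: "'n::finite GG"
  shows "t \<in> GG_filtration (-2)"
    and "t \<in> GG_filtration (-1) \<longleftrightarrow> GG_coords t $ Last = 0"
    and "t \<in> GG_filtration 0 \<longleftrightarrow> GG_coords t $ Last = 0 \<and> (\<forall>i. GG_coords t $ Mid i = 0)"
    and "t \<in> GG_filtration 1 \<longleftrightarrow> t = 0"
proof -
  note mem = mem_tensor_sub_UNIV_iff[OF linear_dual_coords linear_quotient_coords bij_dual_coords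
      bij_quotient_coords,
      of t, folded GG_coords_def]
  have zero: "(\<forall>k. dual_coords \<phi> $ k = 0) \<longleftrightarrow> \<phi> = 0" for \<phi> :: "'n lorentz_space \<Rightarrow>\<^sub>L real"
    using linear_injective_0[OF linear_dual_coords] bij_is_inj[OF bij_dual_coords]
        linear_0[OF linear_dual_coords]
    by (metis vec_eq_iff zero_index)
  have "(dual_filtration (-1) :: ('n lorentz_space \<Rightarrow>\<^sub>L real) set) = {\<phi>. \<forall>k\<in>{}. dual_coords \<phi> $ k = 0}"
    "(dual_filtration 0 :: ('n lorentz_space \<Rightarrow>\<^sub>L real) set) = {\<phi>. \<forall>k\<in>{Last}. dual_coords \<phi> $ k = 0}"
    "(dual_filtration 1 :: ('n lorentz_space \<Rightarrow>\<^sub>L real) set)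
      = {\<phi>. \<forall>k\<in>insert Last (range Mid). dual_coords \<phi> $ k = 0}"
    "(dual_filtration 2 :: ('n lorentz_space \<Rightarrow>\<^sub>L real) set) = {\<phi>. \<forall>k\<in>UNIV. dual_coords \<phi> $ k = 0}"
    by (auto simp: dual_filtration_def annihilator_null_line annihilator_null_line_perp zero)
  then have sets:
    "GG_filtration (-2) = tensor_sub {\<phi> :: 'n lorentz_space \<Rightarrow>\<^sub>L real. \<forall>k\<in>{}. dual_coords \<phi> $ k = 0} UNIV"
    "GG_filtration (-1) = tensor_sub
        {\<phi> :: 'n lorentz_space \<Rightarrow>\<^sub>L real. \<forall>k\<in>{Last}. dual_coords \<phi> $ k = 0} UNIV"
    "GG_filtration 0
      = tensor_sub {\<phi> :: 'n lorentz_space \<Rightarrow>\<^sub>L real. \<forall>k\<in>insert Last (range Mid). dual_coords \<phi> $ k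
          = 0} UNIV"
    "GG_filtration 1 = tensor_sub {\<phi> :: 'n lorentz_space \<Rightarrow>\<^sub>L real. \<forall>k\<in>UNIV. dual_coords \<phi> $ k = 0} UNIV"
    by (simp_all only: GG_filtration_def) simp_all
  show "t \<in> GG_filtration (-2)" "t \<in> GG_filtration (-1) \<longleftrightarrow> GG_coords t $ Last = 0"
    "t \<in> GG_filtration 0 \<longleftrightarrow> GG_coords t $ Last = 0 \<and> (\<forall>i. GG_coords t $ Mid i = 0)"
    unfolding sets mem by simp_all
  have "t \<in> GG_filtration 1 \<longleftrightarrow> GG_coords t = 0"
    unfolding sets mem by (simp add: vec_eq_iff[of "GG_coords t"])
  then show "t \<in> GG_filtration 1 \<longleftrightarrow> t = 0"
    using linear_injective_0[OF linear_GG_coords] bij_is_inj[OF bij_GG_coords]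
        linear_0[OF linear_GG_coords] by metis
qed

lemma GG_act_filtration:
  assumes g: "g \<in> Sim0" and t: "t \<in> GG_filtration i" and i: "i \<in> {0, -1, -2}"
  shows "GG_act g t \<in> GG_filtration i"
proof -
  have "(\<forall>i. GG_coords_act g (GG_coords t) $ Mid i = 0)" if "GG_coords t $ Last = 0"
      "\<forall>i. GG_coords t $ Mid i = 0"
  proof -
    have z: "(\<chi> i. GG_coords t $ Mid i) = 0" using that(2) by (simp add: vec_eq_iff)
    have "(\<chi> i. GG_coords_act g (GG_coords t) $ Mid i) = 0"
      unfolding GG_coords_act_rows(2)[OF g that(1)] z by (rule linear_0[OF linear_matrix_act])
    then show ?thesis by (simp add: vec_eq_iff)
  qed
  then show ?thesis
    using i t by (auto simp: GG_filtration_iff GG_coords_equivariant[OF g] GG_coords_act_rows(1)[OF g]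
        linear_0[OF linear_vector_act])
qed

lemma is_module_GG_filtration: "i \<in> {0, -1, -2} \<Longrightarrow> is_module Sim0 GG_act (GG_filtration i)"
  using GG_act_filtration is_module_linear[OF is_module_GG] is_module_one[OF is_module_GG UNIV_I]
    is_module_mult[OF is_module_GG _ _ UNIV_I]
  by (intro is_moduleI) (auto simp: subspace_GG_filtration)

section \<open>Coordinates on the graded pieces\<close>

text \<open>\<open>L\<close> is defined on the whole filtered module, but only its restriction to
  the numerator counts: it is onto with the denominator as kernel, so it descends to the
  quotient.\<close>

locale graded_piece_coords =
  fixes L :: "'n::finite GG \<Rightarrow> 'v::real_vector"
    and \<sigma> :: "real^('n idx)^('n idx) \<Rightarrow> 'v \<Rightarrow> 'v"
  assumes linear_L: "linear L"
    and kernel: "x \<in> gr_numerator TYPE('k) \<Longrightarrow> L x = 0 \<longleftrightarrow> x \<in> gr_denominator TYPE('k)"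
    and onto: "\<exists>x\<in>gr_numerator TYPE('k). L x = v"
    and closed: "g \<in> Sim0 \<Longrightarrow> x \<in> gr_numerator TYPE('k) \<Longrightarrow> GG_act g x \<in> gr_numerator TYPE('k)"
    and act: "g \<in> Sim0 \<Longrightarrow> x \<in> gr_numerator TYPE('k) \<Longrightarrow> L (GG_act g x) = \<sigma> g (L x)"
begin

definition coords :: "('n, 'k) gr \<Rightarrow> 'v" where
  "coords u = L (gr_repr u)"

lemma coords_proj:
  assumes "x \<in> gr_numerator TYPE('k)"
  shows "coords (gr_proj x) = L x"
proof -
  let ?y = "gr_repr (gr_proj x :: ('n, 'k) gr)"
  have "?y - x \<in> gr_denominator TYPE('k)" by (rule gr_repr_proj[OF assms])
  moreover have "?y - x \<in> gr_numerator TYPE('k)"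
    by (intro subspace_diff subspace_GG_filtration gr_repr_mem assms)
  ultimately have "L (?y - x) = 0" using kernel by blast
  then show ?thesis by (simp add: coords_def linear_diff[OF linear_L])
qed

lemma linear_coords: "linear coords"
proof (rule linearI)
  show "coords (u + v) = coords u + coords v" for u v
    unfolding plus_gr_def
    by (subst coords_proj) (simp_all add: subspace_add subspace_GG_filtration gr_repr_mem
        linear_add[OF linear_L] coords_def)
  show "coords (c *\<^sub>R u) = c *\<^sub>R coords u" for c u
    unfolding scaleR_gr_def
    by (subst coords_proj) (simp_all add: subspace_scale subspace_GG_filtration gr_repr_mem
        linear_scale[OF linear_L] coords_def)
qed

lemma bij_coords: "bij coords"
proof (rule bijI)
  show "inj coords"
  proof (rule injI)
    fix u v assume "coords u = coords v"
    then have "L (gr_repr u - gr_repr v) = 0"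
      by (simp add: coords_def linear_diff[OF linear_L])
    then have "gr_repr u - gr_repr v \<in> gr_denominator TYPE('k)"
      using kernel subspace_diff[OF subspace_GG_filtration gr_repr_mem gr_repr_mem] by blast
    then have "(gr_proj (gr_repr u) :: ('n, 'k) gr) = gr_proj (gr_repr v)"
      by (simp add: gr_proj_eq_iff gr_repr_mem)
    then show "u = v" by (simp add: gr_proj_repr)
  qed
  show "surj coords"
    unfolding surj_def using onto coords_proj by metis
qed

lemma embedding: "equivariant_embedding Sim0 gr_act \<sigma> coords"
proof (rule equivariant_embedding.intro)
  show "coords (gr_act g u) = \<sigma> g (coords u)" if "g \<in> Sim0" for g u
    using that by (simp add: gr_act_def coords_proj closed gr_repr_mem act) (simp add: coords_def)
qed (auto simp: Sim0_one Sim0_mult linear_coords bij_is_inj bij_coords)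

lemma gr_act_proj:
  assumes "g \<in> Sim0" "x \<in> gr_numerator TYPE('k)"
  shows "gr_act g (gr_proj x :: ('n, 'k) gr) = gr_proj (GG_act g x)"
  by (rule injD[OF bij_is_inj[OF bij_coords]])
     (simp add: equivariant_embedding.equivariant[OF embedding] coords_proj closed act assms)

end

lemma ex_GG_coords: "\<exists>t :: 'n::finite GG. GG_coords t = M"
  using bij_is_surj[OF bij_GG_coords] by (metis surjD)

lemma graded_piece_2:
  "graded_piece_coords TYPE(2) (\<lambda>t :: 'n::finite GG. GG_coords t $ Last) (vector_act 2)"
proof
  show "\<exists>x\<in>gr_numerator TYPE(2). GG_coords x $ Last = v" for v :: "real^'n"
  proof -
    obtain t :: "'n GG" where "GG_coords t = (\<chi> k. v)"
      using ex_GG_coords by blast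
    then show ?thesis by (intro bexI[of _ t]) (simp_all add: GG_filtration_iff)
  qed
qed (auto simp: linear_add[OF linear_GG_coords] linear_scale[OF linear_GG_coords] GG_filtration_iff
    GG_coords_equivariant GG_coords_act_rows intro!: linearI)

lemma graded_piece_1:
  "graded_piece_coords TYPE(1) (\<lambda>t :: 'n::finite GG. (\<chi> i. GG_coords t $ Mid i) :: real^'n^'n)
      (matrix_act 1)"
proof
  show "\<exists>x\<in>gr_numerator TYPE(1). (\<chi> i. GG_coords x $ Mid i) = M" for M :: "real^'n^'n"
  proof -
    obtain t :: "'n GG" where "GG_coords t = (\<chi> k. case k of Mid i \<Rightarrow> M $ i | _ \<Rightarrow> 0)"
      using ex_GG_coords by blast
    then show ?thesis by (intro bexI[of _ t]) (simp_all add: GG_filtration_iff vec_eq_iff)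
  qed
  show "GG_act g x \<in> gr_numerator TYPE(1)" if "g \<in> Sim0" "x \<in> gr_numerator TYPE(1)"
      for g and x :: "'n GG"
    using GG_act_filtration[OF that(1), of x "-1"] that(2) by simp
qed (auto simp: linear_add[OF linear_GG_coords] linear_scale[OF linear_GG_coords] GG_filtration_iff
    GG_coords_equivariant GG_coords_act_rows vec_eq_iff intro!: linearI)

lemma graded_piece_0:
  "graded_piece_coords TYPE(0) (\<lambda>t :: 'n::finite GG. GG_coords t $ First) (vector_act 0)"
proof
  show "\<exists>x\<in>gr_numerator TYPE(0). GG_coords x $ First = v" for v :: "real^'n"
  proof -
    obtain t :: "'n GG" where "GG_coords t = (\<chi> k. case k of First \<Rightarrow> v | _ \<Rightarrow> 0)"
      using ex_GG_coords by blast
    then show ?thesis by (intro bexI[of _ t]) (simp_all add: GG_filtration_iff)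
  qed
  show "(GG_coords x $ First = 0) = (x \<in> gr_denominator TYPE(0))" if "x \<in> gr_numerator TYPE(0)"
      for x :: "'n GG"
  proof -
    \<comment> \<open>The denominator is the zero subspace, so the claim is that the first row
      determines whether an element of the numerator vanishes.\<close>
    have "x = 0 \<longleftrightarrow> GG_coords x = 0"
      using linear_injective_0[OF linear_GG_coords] bij_is_inj[OF bij_GG_coords]
          linear_0[OF linear_GG_coords] by metis
    also have "\<dots> \<longleftrightarrow> GG_coords x $ First = 0"
      using that by (auto simp: GG_filtration_iff vec_eq_iff[of _ "0 :: real^'n^('n idx)"] intro:
          idx.exhaust)
        (metis idx.exhaust)
    finally show ?thesis by (simp add: GG_filtration_iff)
  qed
  show "GG_act g x \<in> gr_numerator TYPE(0)" if "g \<in> Sim0" "x \<in> gr_numerator TYPE(0)"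
      for g and x :: "'n GG"
    using GG_act_filtration[OF that(1), of x 0] that(2) by simp
qed (auto simp: linear_add[OF linear_GG_coords] linear_scale[OF linear_GG_coords] GG_filtration_iff
    GG_coords_equivariant GG_coords_act_rows intro!: linearI)

section \<open>Transport from the models to the graded pieces\<close>

lemma irreducible_CO0_vimage:
  assumes F: "equivariant_embedding Sim0 \<rho> \<sigma> F" and "bij F" and irr: "irreducible_module CO0 \<sigma> U"
  shows "irreducible_module CO0 \<rho> (F -` U)"
proof -
  have "F ` (F -` U) = U" using \<open>bij F\<close> by (simp add: bij_is_surj surj_image_vimage_eq)
  then show ?thesis
    using equivariant_embedding.irreducible_module_pullback[OF equivariant_embedding_CO0[OF F]]
        irr by metis
qed

lemma module_vimage:
  assumes F: "equivariant_embedding G \<rho> \<sigma> F" and "bij F" and "is_module G \<sigma> U"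
  shows "is_module G \<rho> (F -` U)"
proof -
  have "F ` (F -` U) = U" using \<open>bij F\<close> by (simp add: bij_is_surj surj_image_vimage_eq)
  then show ?thesis
    using equivariant_embedding.is_module_pullback[OF F] assms(3) by metis
qed

lemma irreducible_Sim0_vimage:
  assumes F: "equivariant_embedding Sim0 \<rho> \<sigma> F" and "bij F" and irr: "irreducible_module CO0 \<sigma> U"
    and "is_module Sim0 \<sigma> U"
  shows "irreducible_module Sim0 \<rho> (F -` U)"
  using irreducible_CO0_vimage[OF assms(1-3)] module_vimage[OF F assms(2,4)] CO0_subset_Sim0
  by (rule irreducible_module_mono)

lemma isomorphic_CO0_vimage:
  assumes F: "equivariant_embedding Sim0 \<rho> \<sigma> F" "bij F" and F':
      "equivariant_embedding Sim0 \<rho>' \<sigma> F'" "bij F'"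
    and M: "is_module Sim0 \<sigma> U"
  shows "isomorphic_modules CO0 \<rho> (F -` U) \<rho>' (F' -` U)"
proof (rule isomorphic_modules_via[OF equivariant_embedding_CO0[OF F(1)]
    equivariant_embedding_CO0[OF F'(1)]])
  have "F ` (F -` U) = U" "F' ` (F' -` U) = U"
    using F(2) F'(2) by (simp_all add: bij_is_surj surj_image_vimage_eq)
  then show "F ` (F -` U) = F' ` (F' -` U)" "is_module CO0 \<sigma> (F ` (F -` U))"
    using is_module_mono[OF M CO0_subset_Sim0] by simp_all
qed

text \<open>Forgets the construction: irreducibility and isomorphism type depend only on the
  existence of a bijective equivariant coordinate map.\<close>

lemma ex_graded_coords_2:
  "\<exists>F :: ('n::finite, 2) gr \<Rightarrow> real^'n. equivariant_embedding Sim0 gr_act (vector_act 2) F \<and> bij F"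
  using graded_piece_coords.embedding[OF graded_piece_2]
      graded_piece_coords.bij_coords[OF graded_piece_2] by blast

lemma ex_graded_coords_1:
  "\<exists>F :: ('n::finite, 1) gr \<Rightarrow> real^'n^'n. equivariant_embedding Sim0 gr_act (matrix_act 1) F \<and> bij F"
  using graded_piece_coords.embedding[OF graded_piece_1]
      graded_piece_coords.bij_coords[OF graded_piece_1] by blast

lemma ex_graded_coords_0:
  "\<exists>F :: ('n::finite, 0) gr \<Rightarrow> real^'n. equivariant_embedding Sim0 gr_act (vector_act 0) F \<and> bij F"
  using graded_piece_coords.embedding[OF graded_piece_0]
      graded_piece_coords.bij_coords[OF graded_piece_0] by blast

lemma is_module_gr_2: "is_module Sim0 gr_act (UNIV :: ('n::finite, 2) gr set)"
  and is_module_gr_1: "is_module Sim0 gr_act (UNIV :: ('n, 1) gr set)"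
  and is_module_gr_0: "is_module Sim0 gr_act (UNIV :: ('n, 0) gr set)"
proof -
  have matrix: "is_module Sim0 (matrix_act 1) (UNIV :: (real^'n^'n) set)"
    by (rule is_module_matrix_act) auto
  show "is_module Sim0 gr_act (UNIV :: ('n, 2) gr set)"
    using ex_graded_coords_2 module_vimage[OF _ _ is_module_vector_act] by fastforce
  show "is_module Sim0 gr_act (UNIV :: ('n, 1) gr set)"
    using ex_graded_coords_1 module_vimage[OF _ _ matrix] by fastforce
  show "is_module Sim0 gr_act (UNIV :: ('n, 0) gr set)"
    using ex_graded_coords_0 module_vimage[OF _ _ is_module_vector_act] by fastforce
qed

lemma is_module_assoc_gr: "is_module Sim0 assoc_gr_act (UNIV :: 'n::finite assoc_gr set)"
proof (rule is_moduleI)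
  note modules = is_module_gr_2 is_module_gr_1 is_module_gr_0
  note linear = modules[THEN is_module_linear]
  show "linear (assoc_gr_act g :: 'n assoc_gr \<Rightarrow> _)" if g: "g \<in> Sim0" for g
    by (rule linearI) (auto simp: assoc_gr_act_def linear[THEN linear_add, OF g]
        linear[THEN linear_scale, OF g])
  show "assoc_gr_act (mat 1) x = x" for x :: "'n assoc_gr"
    by (cases x) (simp add: assoc_gr_act_def modules[THEN is_module_one])
  show "assoc_gr_act (g ** h) x = assoc_gr_act g (assoc_gr_act h x)" if "g \<in> Sim0" "h \<in> Sim0"
      for g h and x :: "'n assoc_gr"
    by (cases x) (simp add: assoc_gr_act_def modules[THEN is_module_mult, OF that])
qed simp_all

text \<open>The denominator in degree 0 is zero, so passing to cosets loses nothing; this expresses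
  the equality of the degree 0 piece with the smallest filtration step.\<close>

lemma is_module_iso_gr_proj:
  "is_module_iso Sim0 GG_act (GG_filtration 0) gr_act (UNIV :: ('n::finite, 0) gr set) gr_proj"
  unfolding is_module_iso_def
proof (intro conjI ballI allI)
  show "is_module Sim0 GG_act (GG_filtration 0 :: 'n GG set)"
    by (simp add: is_module_GG_filtration)
  show "is_module Sim0 gr_act (UNIV :: ('n, 0) gr set)"
    by (rule is_module_gr_0)
  show "bij_betw gr_proj (GG_filtration 0) (UNIV :: ('n, 0) gr set)"
  proof (rule bij_betwI')
    show "(gr_proj x :: ('n, 0) gr) = gr_proj y \<longleftrightarrow> x = y" if "x \<in> GG_filtration 0"
        "y \<in> GG_filtration 0" for x y
      using gr_proj_eq_iff[where 'k = 0, of x y] that by (simp add: GG_filtration_iff)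
    show "\<exists>x\<in>GG_filtration 0. u = gr_proj x" for u :: "('n, 0) gr"
      using gr_repr_mem[of u] gr_proj_repr[of u] by (intro bexI[of _ "gr_repr u"]) simp_all
  qed simp
  show "(gr_proj (x + y) :: ('n, 0) gr) = gr_proj x + gr_proj y"
    if "x \<in> GG_filtration 0" "y \<in> GG_filtration 0" for x y
    using gr_proj_add[where 'b = 0, of x y] that by simp
  show "(gr_proj (c *\<^sub>R x) :: ('n, 0) gr) = c *\<^sub>R gr_proj x" if "x \<in> GG_filtration 0" for c x
    using gr_proj_scaleR[where 'b = 0, of x c] that by simp
  show "(gr_proj (GG_act g x) :: ('n, 0) gr) = gr_act g (gr_proj x)" if "g \<in> Sim0"
      "x \<in> GG_filtration 0" for g x
    using graded_piece_coords.gr_act_proj[OF graded_piece_0 that(1), of x] that(2) by simp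
qed

lemma GG_filtration_strict:
  "(GG_filtration 0 :: 'n::finite GG set) \<subset> GG_filtration (-1)"
  "(GG_filtration (-1) :: 'n GG set) \<subset> GG_filtration (-2)"
proof -
  \<comment> \<open>\<open>axis undefined 1\<close> is a nonzero vector for every index type, as
    types are inhabited.\<close>
  obtain t :: "'n GG" where t: "GG_coords t = (\<chi> k. case k of Mid i \<Rightarrow> axis undefined 1 | _ \<Rightarrow> 0)"
    using ex_GG_coords by blast
  have "t \<in> GG_filtration (-1)" "t \<notin> GG_filtration 0"
    by (simp_all add: GG_filtration_iff t axis_eq_0_iff)
  moreover have "(GG_filtration 0 :: 'n GG set) \<subseteq> GG_filtration (-1)"
    by (auto simp: GG_filtration_iff)
  ultimately show "(GG_filtration 0 :: 'n GG set) \<subset> GG_filtration (-1)"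
    by blast
  obtain t :: "'n GG" where t: "GG_coords t = (\<chi> k. axis undefined 1)"
    using ex_GG_coords by blast
  have "t \<notin> GG_filtration (-1)"
    by (simp add: GG_filtration_iff t axis_eq_0_iff)
  then show "(GG_filtration (-1) :: 'n GG set) \<subset> GG_filtration (-2)"
    by (auto simp: GG_filtration_iff)
qed

lemma vimage_zero:
  assumes "linear F" "bij F"
  shows "F -` {0} = {0}"
proof -
  have "F x = 0 \<longleftrightarrow> x = 0" for x
    using inj_eq[OF bij_is_inj[OF assms(2)], of x 0] by (simp add: linear_0[OF assms(1)])
  then show ?thesis by auto
qed

text \<open>All summands are preimages of matrix spaces under one coordinate map. For a single index
  the antisymmetric and the trace-free symmetric summands are zero, hence the conditional
  irreducibility; the splitting in dimension four depends on the orientation given by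
  \<open>b\<close>.\<close>

lemma graded_degree_minus_1:
  "\<exists>S :: nat \<Rightarrow> ('n::finite, 1) gr set.
     internal_direct_sum UNIV S {0, 1, 2} \<and>
     (\<forall>j\<in>{0, 1, 2}. is_module Sim0 gr_act (S j)) \<and>
     isomorphic_modules CO0 gr_act (S 0) (weight_act 1) UNIV \<and>
     isomorphic_modules CO0 gr_act (S 1) (twist 1 covec2_act) (tensor_sub two_forms UNIV) \<and>
     isomorphic_modules CO0 gr_act (S 2) (twist 1 covec2_act) (tensor_sub sym_tracefree UNIV) \<and>
     irreducible_module Sim0 gr_act (S 0) \<and>
     (CARD('n) \<noteq> 4 \<longrightarrow> S 1 \<noteq> {0} \<longrightarrow> irreducible_module Sim0 gr_act (S 1)) \<and>
     (S 2 \<noteq> {0} \<longrightarrow> irreducible_module Sim0 gr_act (S 2)) \<and>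
     (CARD('n) = 4 \<longrightarrow> (\<forall>b. bij_betw b {..<4} (UNIV :: 'n set) \<longrightarrow>
        (\<exists>T :: real \<Rightarrow> ('n, 1) gr set.
           internal_direct_sum (S 1) T {1, -1} \<and>
           (\<forall>s\<in>{1, -1}. irreducible_module Sim0 gr_act (T s) \<and>
              isomorphic_modules CO0 gr_act (T s)
                (twist 1 covec2_act) (tensor_sub (dual_two_forms b s) UNIV)))))"
proof -
  obtain F :: "('n, 1) gr \<Rightarrow> real^'n^'n"
    where F: "equivariant_embedding Sim0 gr_act (matrix_act 1) F" and bij: "bij F"
    using ex_graded_coords_1 by blast
  have lin: "linear F" using F by (rule equivariant_embedding.linear_F)
  define V :: "nat \<Rightarrow> (real^'n^'n) set" where
    "V j = (if j = 0 then scalar_matrices else if j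
        = 1 then skew_matrices else sym_tracefree_matrices)" for j
  define S where "S j = F -` V j" for j
  have V: "V 0 = scalar_matrices" "V 1 = skew_matrices" "V 2 = sym_tracefree_matrices"
    by (simp_all add: V_def)
  have mod: "is_module Sim0 (matrix_act 1) (V j)" for j
    by (rule is_module_matrix_act)
       (auto simp: V_def subspace_scalar_matrices subspace_skew_matrices subspace_sym_tracefree_matrices
         scalar_invariant skew_invariant sym_tracefree_invariant split: if_splits)
  have nz: "V j \<noteq> {0}" if "S j \<noteq> {0}" for j
    using that vimage_zero[OF lin bij] by (auto simp: S_def)
  note iso = isomorphic_CO0_vimage[OF F bij twist_covec2_embedding bij_covec2_absorb]
  have "internal_direct_sum UNIV V {0, 1, 2}"
    using internal_direct_sum_matrices[where 'n = 'n] by (simp only: V_def[abs_def])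
  then have "internal_direct_sum (F -` UNIV) (\<lambda>j. F -` V j) {0, 1, 2}"
    by (intro internal_direct_sum_vimage[OF lin bij]) simp
  then have ds: "internal_direct_sum UNIV S {0, 1, 2}"
    by (simp only: vimage_UNIV S_def[abs_def])
  have S0: "isomorphic_modules CO0 gr_act (S 0) (weight_act 1) UNIV"
  proof (rule isomorphic_modules_via[OF equivariant_embedding_CO0[OF F]
      equivariant_embedding_CO0[OF weight_embedding]])
    have "F ` S 0 = scalar_matrices"
      using bij by (simp add: S_def V bij_is_surj surj_image_vimage_eq)
    then show "F ` S 0 = range (\<lambda>r. r *\<^sub>R mat 1)" "is_module CO0 (matrix_act 1) (F ` S 0)"
      using is_module_mono[OF mod[of 0] CO0_subset_Sim0] by (simp_all only: scalar_matrices_def V)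
  qed
  have T: "\<exists>T :: real \<Rightarrow> ('n, 1) gr set. internal_direct_sum (S 1) T {1, -1} \<and>
      (\<forall>s\<in>{1, -1}. irreducible_module Sim0 gr_act (T s) \<and>
        isomorphic_modules CO0 gr_act (T s) (twist 1 covec2_act) (tensor_sub (dual_two_forms b s) UNIV))"
    if b: "bij_betw b {..<4} (UNIV :: 'n set)" for b
  proof (intro exI conjI ballI)
    show "internal_direct_sum (S 1) (\<lambda>s. F -` dual_skew_matrices b s) {1, -1}"
      unfolding S_def V by (rule
          internal_direct_sum_vimage[OF lin bij _ internal_direct_sum_dual_skew[OF b]]) simp
    fix s :: real assume "s \<in> {1, -1}"
    then have s: "s = 1 \<or> s = -1" by simp
    have M: "is_module Sim0 (matrix_act 1) (dual_skew_matrices b s)"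
      by (rule is_module_matrix_act[OF subspace_dual_skew_matrices dual_skew_invariant[OF b]])
    show "irreducible_module Sim0 gr_act (F -` dual_skew_matrices b s)"
      by (rule irreducible_Sim0_vimage[OF F bij irreducible_dual_skew[OF b s] M])
    show "isomorphic_modules CO0 gr_act (F -` dual_skew_matrices b s)
        (twist 1 covec2_act) (tensor_sub (dual_two_forms b s) UNIV)"
      unfolding tensor_sub_dual_two_forms by (rule iso[OF M])
  qed
  show ?thesis
  proof (rule exI[of _ S], intro conjI ballI impI allI)
    show "is_module Sim0 gr_act (S j)" for j
      unfolding S_def by (rule module_vimage[OF F bij mod])
    show "isomorphic_modules CO0 gr_act (S 1) (twist 1 covec2_act) (tensor_sub two_forms UNIV)"
      unfolding S_def tensor_sub_two_forms V(2)[symmetric] by (rule iso[OF mod])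
    show "isomorphic_modules CO0 gr_act (S 2) (twist 1 covec2_act) (tensor_sub sym_tracefree UNIV)"
      unfolding S_def tensor_sub_sym_tracefree V(3)[symmetric] by (rule iso[OF mod])
    show "irreducible_module Sim0 gr_act (S 0)"
      unfolding S_def by (rule irreducible_Sim0_vimage[OF F bij _ mod]) (simp only: V irreducible_scalar)
    show "irreducible_module Sim0 gr_act (S 1)" if "CARD('n) \<noteq> 4" "S 1 \<noteq> {0}"
    proof -
      have "irreducible_module CO0 (matrix_act 1) (V 1)"
        using nz[OF that(2)] unfolding V by (rule irreducible_skew[OF that(1)])
      then show ?thesis unfolding S_def by (rule irreducible_Sim0_vimage[OF F bij _ mod])
    qed
    show "irreducible_module Sim0 gr_act (S 2)" if "S 2 \<noteq> {0}"
    proof -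
      have "irreducible_module CO0 (matrix_act 1) (V 2)"
        using nz[OF that] unfolding V by (rule irreducible_sym_tracefree)
      then show ?thesis unfolding S_def by (rule irreducible_Sim0_vimage[OF F bij _ mod])
    qed
  qed (fact ds | fact S0 | rule T, assumption)+
qed

theorem proposition3p3:
  shows
    "\<comment> \<open>the filtration and its associated graded\<close>
     (\<forall>i\<in>{0, -1, -2}. is_module Sim0 GG_act (GG_filtration i :: 'n::finite GG set)) \<and>
     (GG_filtration 0 :: 'n GG set) \<subset> GG_filtration (-1) \<and>
     (GG_filtration (-1) :: 'n GG set) \<subset> GG_filtration (-2) \<and>
     (GG_filtration (-2) :: 'n GG set) = UNIV \<and>
     is_module Sim0 assoc_gr_act (UNIV :: 'n assoc_gr set) \<and>

     \<comment> \<open>degree 0\<close>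
     is_module_iso Sim0 GG_act (GG_filtration 0) gr_act (UNIV :: ('n, 0) gr set) gr_proj \<and>
     isomorphic_modules CO0 gr_act (UNIV :: ('n, 0) gr set) covec_act (UNIV :: 'n covec set) \<and>
     irreducible_module Sim0 gr_act (UNIV :: ('n, 0) gr set) \<and>

     \<comment> \<open>degree -2\<close>
     is_module Sim0 gr_act (UNIV :: ('n, 2) gr set) \<and>
     isomorphic_modules CO0 gr_act (UNIV :: ('n, 2) gr set)
       (twist 2 covec_act) (UNIV :: ('n covec \<otimes> real) set) \<and>
     irreducible_module Sim0 gr_act (UNIV :: ('n, 2) gr set) \<and>

     \<comment> \<open>degree -1\<close>
     (\<exists>S :: nat \<Rightarrow> ('n, 1) gr set.
        internal_direct_sum UNIV S {0, 1, 2} \<and>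
        (\<forall>j\<in>{0, 1, 2}. is_module Sim0 gr_act (S j)) \<and>
        isomorphic_modules CO0 gr_act (S 0) (weight_act 1) UNIV \<and>
        isomorphic_modules CO0 gr_act (S 1) (twist 1 covec2_act) (tensor_sub two_forms UNIV) \<and>
        isomorphic_modules CO0 gr_act (S 2) (twist 1 covec2_act) (tensor_sub sym_tracefree UNIV) \<and>
        irreducible_module Sim0 gr_act (S 0) \<and>
        (CARD('n) \<noteq> 4 \<longrightarrow> S 1 \<noteq> {0} \<longrightarrow> irreducible_module Sim0 gr_act (S 1)) \<and>
        (S 2 \<noteq> {0} \<longrightarrow> irreducible_module Sim0 gr_act (S 2)) \<and>
        (CARD('n) = 4 \<longrightarrow> (\<forall>b. bij_betw b {..<4} (UNIV :: 'n set) \<longrightarrow>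
           (\<exists>T :: real \<Rightarrow> ('n, 1) gr set.
              internal_direct_sum (S 1) T {1, -1} \<and>
              (\<forall>s\<in>{1, -1}. irreducible_module Sim0 gr_act (T s) \<and>
                 isomorphic_modules CO0 gr_act (T s)
                   (twist 1 covec2_act) (tensor_sub (dual_two_forms b s) UNIV)))))) \<and>

     \<comment> \<open>dimensions of the model modules\<close>
     dim (UNIV :: ('n covec \<otimes> real) set) = CARD('n) \<and>
     dim (UNIV :: real set) = 1 \<and>
     real (dim (tensor_sub (two_forms :: ('n covec \<otimes> 'n covec) set) (UNIV :: real set)))
       = 1/2 * real CARD('n) * (real CARD('n) - 1) \<and>
     real (dim (tensor_sub (sym_tracefree :: ('n covec \<otimes> 'n covec) set) (UNIV :: real set)))
       = 1/2 * real CARD('n) * (real CARD('n) + 1) - 1 \<and>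
     dim (UNIV :: 'n covec set) = CARD('n) \<and>

     \<comment> \<open>irreducibility of the model modules\<close>
     irreducible_module CO0 (twist 2 covec_act) (UNIV :: ('n covec \<otimes> real) set) \<and>
     irreducible_module (CO0 :: (real^('n idx)^('n idx)) set) (weight_act 1) UNIV \<and>
     irreducible_module CO0 covec_act (UNIV :: 'n covec set) \<and>
     (CARD('n) \<noteq> 4 \<longrightarrow> tensor_sub two_forms UNIV \<noteq> ({0} :: (('n covec \<otimes> 'n covec) \<otimes> real) set) \<longrightarrow>
        irreducible_module CO0 (twist 1 covec2_act)
          (tensor_sub two_forms UNIV :: (('n covec \<otimes> 'n covec) \<otimes> real) set)) \<and>
     (tensor_sub sym_tracefree UNIV \<noteq> ({0} :: (('n covec \<otimes> 'n covec) \<otimes> real) set) \<longrightarrow>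
        irreducible_module CO0 (twist 1 covec2_act)
          (tensor_sub sym_tracefree UNIV :: (('n covec \<otimes> 'n covec) \<otimes> real) set)) \<and>
     (CARD('n) = 4 \<longrightarrow> (\<forall>b. bij_betw b {..<4} (UNIV :: 'n set) \<longrightarrow>
        internal_direct_sum (tensor_sub two_forms UNIV :: (('n covec \<otimes> 'n covec) \<otimes> real) set)
          (\<lambda>s. tensor_sub (dual_two_forms b s) UNIV) {1, -1} \<and>
        (\<forall>s\<in>{1, -1}.
           irreducible_module CO0 (twist 1 covec2_act)
             (tensor_sub (dual_two_forms b s) UNIV :: (('n covec \<otimes> 'n covec) \<otimes> real) set) \<and>
           dim (tensor_sub (dual_two_forms b s) (UNIV :: real set)) = 3)))"
proof (intro conjI)
  show "\<forall>i\<in>{0, -1, -2}. is_module Sim0 GG_act (GG_filtration i :: 'n GG set)"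
    by (intro ballI is_module_GG_filtration)
  show "(GG_filtration (-2) :: 'n GG set) = UNIV"
    by (auto simp: GG_filtration_iff)
  obtain F :: "('n, 0) gr \<Rightarrow> real^'n" where F: "equivariant_embedding Sim0 gr_act (vector_act 0) F"
      "bij F"
    using ex_graded_coords_0 by blast
  \<comment> \<open>Covectors and the degree 0 piece share the model \<open>vector_act 0\<close> on
    the whole vector space.\<close>
  show "isomorphic_modules CO0 gr_act (UNIV :: ('n, 0) gr set) covec_act (UNIV :: 'n covec set)"
    using isomorphic_CO0_vimage[OF F covec_embedding bij_dual_coords is_module_vector_act] by simp
  show "irreducible_module Sim0 gr_act (UNIV :: ('n, 0) gr set)"
    using irreducible_Sim0_vimage[OF F irreducible_vector_act is_module_vector_act] by simp
  obtain F :: "('n, 2) gr \<Rightarrow> real^'n" where F: "equivariant_embedding Sim0 gr_act (vector_act 2) F"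
      "bij F"
    using ex_graded_coords_2 by blast
  show "isomorphic_modules CO0 gr_act (UNIV :: ('n, 2) gr set) (twist 2 covec_act)
      (UNIV :: ('n covec \<otimes> real) set)"
    using isomorphic_CO0_vimage[OF F twist_covec_embedding bij_covec_absorb is_module_vector_act] by simp
  show "irreducible_module Sim0 gr_act (UNIV :: ('n, 2) gr set)"
    using irreducible_Sim0_vimage[OF F irreducible_vector_act is_module_vector_act] by simp
  show "dim (UNIV :: ('n covec \<otimes> real) set) = CARD('n)"
    using dim_vimage[OF linear_covec_absorb bij_covec_absorb, of "UNIV :: (real^'n) set"] by simp
  show "dim (UNIV :: 'n covec set) = CARD('n)"
    using dim_vimage[OF linear_dual_coords bij_dual_coords, of "UNIV :: (real^'n) set"] by simp
  show "dim (UNIV :: real set) = 1" by simp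
  show "real (dim (tensor_sub (two_forms :: ('n covec \<otimes> 'n covec) set) (UNIV :: real set)))
      = 1/2 * real CARD('n) * (real CARD('n) - 1)"
    unfolding tensor_sub_two_forms dim_vimage[OF linear_covec2_absorb bij_covec2_absorb]
        by (rule dim_skew_matrices)
  show "real (dim (tensor_sub (sym_tracefree :: ('n covec \<otimes> 'n covec) set) (UNIV :: real set)))
      = 1/2 * real CARD('n) * (real CARD('n) + 1) - 1"
    unfolding tensor_sub_sym_tracefree dim_vimage[OF linear_covec2_absorb bij_covec2_absorb]
    by (rule dim_sym_tracefree_matrices)
  show "irreducible_module CO0 (twist 2 covec_act) (UNIV :: ('n covec \<otimes> real) set)"
    using irreducible_CO0_vimage[OF twist_covec_embedding bij_covec_absorb irreducible_vector_act]
        by simp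
  show "irreducible_module CO0 covec_act (UNIV :: 'n covec set)"
    using irreducible_CO0_vimage[OF covec_embedding bij_dual_coords irreducible_vector_act] by simp
  show "irreducible_module (CO0 :: (real^('n idx)^('n idx)) set) (weight_act 1) UNIV"
    using irreducible_scalar[where 'n = 'n]
    by (intro equivariant_embedding.irreducible_module_pullback[OF
        equivariant_embedding_CO0[OF weight_embedding]])
       (simp only: scalar_matrices_def)
  note transport = irreducible_CO0_vimage[OF twist_covec2_embedding bij_covec2_absorb]
  \<comment> \<open>The nonvanishing hypotheses concern tensor modules, the irreducibility lemmas
    matrices; the linear bijection translates.\<close>
  have nz: "U \<noteq> {0}" if "(covec2_coords \<circ> absorb_scalar) -` U \<noteq>
      ({0} :: (('n covec \<otimes> 'n covec) \<otimes> real) set)"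
    for U :: "(real^'n^'n) set"
    using that vimage_zero[OF linear_covec2_absorb bij_covec2_absorb] by auto
  show "CARD('n) \<noteq> 4 \<longrightarrow> tensor_sub two_forms UNIV \<noteq> ({0} :: (('n covec \<otimes> 'n covec) \<otimes> real) set) \<longrightarrow>
      irreducible_module CO0 (twist 1 covec2_act)
        (tensor_sub two_forms UNIV :: (('n covec \<otimes> 'n covec) \<otimes> real) set)"
    unfolding tensor_sub_two_forms by (intro impI transport irreducible_skew nz)
  show "tensor_sub sym_tracefree UNIV \<noteq> ({0} :: (('n covec \<otimes> 'n covec) \<otimes> real) set) \<longrightarrow>
      irreducible_module CO0 (twist 1 covec2_act)
        (tensor_sub sym_tracefree UNIV :: (('n covec \<otimes> 'n covec) \<otimes> real) set)"
    unfolding tensor_sub_sym_tracefree by (intro impI transport irreducible_sym_tracefree nz)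
  show "CARD('n) = 4 \<longrightarrow> (\<forall>b. bij_betw b {..<4} (UNIV :: 'n set) \<longrightarrow>
      internal_direct_sum (tensor_sub two_forms UNIV :: (('n covec \<otimes> 'n covec) \<otimes> real) set)
        (\<lambda>s. tensor_sub (dual_two_forms b s) UNIV) {1, -1} \<and>
      (\<forall>s\<in>{1, -1}.
         irreducible_module CO0 (twist 1 covec2_act)
           (tensor_sub (dual_two_forms b s) UNIV :: (('n covec \<otimes> 'n covec) \<otimes> real) set) \<and>
         dim (tensor_sub (dual_two_forms b s) (UNIV :: real set)) = 3))"
    unfolding tensor_sub_two_forms tensor_sub_dual_two_forms
  proof (intro impI allI conjI ballI)
    fix b :: "nat \<Rightarrow> 'n" assume b: "bij_betw b {..<4} UNIV"
    show "internal_direct_sum ((covec2_coords \<circ> absorb_scalar) -` skew_matrices ::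
        (('n covec \<otimes> 'n covec) \<otimes> real) set)
        (\<lambda>s. (covec2_coords \<circ> absorb_scalar) -` dual_skew_matrices b s) {1, -1}"
      by (rule internal_direct_sum_vimage[OF linear_covec2_absorb bij_covec2_absorb _
          internal_direct_sum_dual_skew[OF b]]) simp
    fix s :: real assume "s \<in> {1, -1}"
    then have s: "s = 1 \<or> s = -1" by simp
    show "irreducible_module CO0 (twist 1 covec2_act)
        ((covec2_coords \<circ> absorb_scalar) -` dual_skew_matrices b s ::
            (('n covec \<otimes> 'n covec) \<otimes> real) set)"
      by (rule transport[OF irreducible_dual_skew[OF b s]])
    show "dim ((covec2_coords \<circ> absorb_scalar) -` dual_skew_matrices b s ::
        (('n covec \<otimes> 'n covec) \<otimes> real) set) = 3"
      unfolding dim_vimage[OF linear_covec2_absorb bij_covec2_absorb]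
          by (rule dim_dual_skew_matrices[OF b s])
  qed
qed (fact GG_filtration_strict is_module_assoc_gr is_module_iso_gr_proj is_module_gr_2
    graded_degree_minus_1)+

end
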